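(* Let $W$ be a twisted Coxeter group, pick a standard parabolic subgroup $W'\subseteq\tilde W$, let $\mathcal O$ be a $W'$-orbit consisting of involutions and pick an element $w$ in $\mathcal O$. (Two statements are made simultaneously: a "max" version and, after "resp.", a "min" version.) (i) There exists an element $w'$ in $\mathcal O_{\mathrm{max}}$ such that $w\overset{+}{\twoheadrightarrow}w'$ by $W'$ (resp. an element $w'$ in $\mathcal O_{\mathrm{min}}$ such that $w\overset{-}{\twoheadrightarrow}w'$ by $W'$). (ii) The following are equivalent: (a) The element $w$ lies in $\mathcal O_{\mathrm{max}}$ (resp. $\mathcal O_{\mathrm{min}}$). (b) The set of roots $\mathfrak R_w\cap{}_{W'}\mathfrak R_+$ is given by ${}_{W'}\mathfrak R_+\setminus\mathfrak R^w$ (resp. ${}_{W'}\mathfrak R_+\cap\mathfrak R^w_{-1}$). (c) $w$ satisfies the following explicit description, which is amenable to an algorithmic classification. Let $J$ denote the set of simple reflections such that $W'=\tilde W_J$ and consider the subset $J'=\{s_j\in J: s_jws_j=w\text{ and }\ell(w)<\ell(ws_j)\}\subseteq J$ (resp. $J'=\{s_j\in J: s_jws_j=w\text{ and }\ell(w)>\ell(ws_j)\}\subseteq J$). Decompose $w$ into $w=w^{J'}w_{J'}$, where $w_{J'}$ denotes the identity element (resp. the longest element) of $\tilde W_{J'}$ and $w^{J'}$ is the maximal (resp. minimal) left coset representative for $w$ in $\tilde W_{J'}$. Then ${}_J\mathfrak R_+\cap{}_{J'}\mathfrak R_+={}_J\mathfrak R_+\cap\mathfrak R^w$ (resp. ${}_J\mathfrak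 R_+\cap{}_{J'}\mathfrak R_+={}_J\mathfrak R_+\cap\mathfrak R^w_{-1}$), and the element $w^{J'}$ is an involution, is a maximal (resp. minimal) length double coset representative in $\tilde W_J\times\tilde W_{J'}$, and permutes the simple roots of ${}_{J'}\mathfrak R_+$. If $W'=\tilde W$, then this is also equivalent to (d) The closure of the dominant Weyl chamber contains an open subset of $V^w_{-1}$ (resp. of $V^w_{1}$). In particular, there is an equality $|\mathfrak R|=\ell_f(\mathcal O)+2\,\ell(\mathcal O^{\mathrm{dom}})$ (for $\tilde W$-orbits $\mathcal O$ of involutions in twisted finite Coxeter groups, where $\mathcal O^{\mathrm{dom}}$ is defined).
   Context: Twisted Coxeter groups. $(\tilde W,\{s_i\}_{i=1}^n)$ is a Coxeter system and $W=\Omega\ltimes\tilde W$, where $\Omega$ is a group acting on $\tilde W$ by automorphisms, each preserving the set of simple reflections. $W$ is a twisted finite Coxeter group if $\tilde W$ is finite. $W$ acts on the real reflection representation $V$ of $\tilde W$ (with basis the simple roots $\alpha_i$, which $\Omega$ permutes). $\mathfrak R$ is the set of roots, $\mathfrak R_+$ and $\mathfrak R_-$ are the positive and negative roots, $\mathfrak R_w=\{\beta\in\mathfrak R_+:w(\beta)\in\mathfrak R_-\}$ and $\ell(w)=|\mathfrak R_w|$. For a set $J$ of simple reflections, $\tilde W_J$ is the standard parabolic subgroup it generates, and ${}_J\mathfrak R_+={}_{\tilde W_J}\mathfrak R_+$ is the set of positive roots of the corresponding standard parabolic subsystem. A left coset representative for $w$ in $\tilde W_{J'}$ is a representative of the coset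 $w\tilde W_{J'}$; a double coset representative in $\tilde W_J\times\tilde W_{J'}$ is a representative of a double coset $\tilde W_Jx\tilde W_{J'}$; maximal/minimal refers to length. A $W'$-orbit is an orbit of $W'$ acting on $W$ by conjugation. $\mathcal O_{\mathrm{max}}$ and $\mathcal O_{\mathrm{min}}$ are the subsets of elements of maximal, respectively minimal, length in $\mathcal O$. An involution is an element with $w^2=\mathrm{id}$. $\mathfrak R^w$ is the set of roots fixed by $w$ and $\ell_f(w)=|\mathfrak R^w|$, which is constant on $\mathcal O$ with value $\ell_f(\mathcal O)$. $V^w_{\pm1}=\{v\in V:w(v)=\pm v\}$, and $\mathfrak R^w_{-1}=\mathfrak R_w\cap V^w_{-1}$ is the set of (positive) roots on which $w$ acts as $-1$. $w\overset{+}{\twoheadrightarrow}w'$ (resp. $w\overset{-}{\twoheadrightarrow}w'$) by $W'$ means that there is a (possibly trivial) finite sequence from $w$ to $w'$ in which each element is obtained from the previous one by conjugating with a simple reflection of $W'$, and the length strictly increases (resp. strictly decreases) at every step. For $W$ finite, an element $w$ is dominant if the closure of the dominant Weyl chamber contains an open subset of $V_w=\mathrm{im}(\mathrm{id}_V-w)$. For a $\tilde W$-orbit $\mathcal O$, $\mathcal O^{\mathrm{dom}}$ is the set of its dominant elements and $\ell(\mathcal O^{\mathrm{dom}})$ denotes their common length.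
   Formalization: (i) max assumes O_max nonempty; (c) max, contradictory as written, is given in two forms: w_{J'}=id with w^{J'} the shortest coset element, or (W' finite) w_{J'} longest and simple roots permuted up to sign -1; (d) is read in the dual of V when the Coxeter group is infinite. *)

theory Defs
  imports "HOL-Analysis.Analysis" "HOL-Algebra.Generated_Groups" "HOL-Algebra.Multiplicative_Group"
begin

section \<open>Coxeter systems\<close>

definition word_prod :: "('a, 'z) monoid_scheme \<Rightarrow> ('i \<Rightarrow> 'a) \<Rightarrow> 'i list \<Rightarrow> 'a" where
  "word_prod G s xs = foldr (\<lambda>i g. s i \<otimes>\<^bsub>G\<^esub> g) xs \<one>\<^bsub>G\<^esub>"

text \<open>The order of \<open>s i \<otimes> s j\<close>; it is \<open>0\<close> when that order is infinite.\<close>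

definition coxeter_matrix :: "('a, 'z) monoid_scheme \<Rightarrow> ('i \<Rightarrow> 'a) \<Rightarrow> 'i \<Rightarrow> 'i \<Rightarrow> nat" where
  "coxeter_matrix G s i j = group.ord G (s i \<otimes>\<^bsub>G\<^esub> s j)"

text \<open>One insertion of a defining relator \<open>(i j)\<^sup>m\<close>, where \<open>m = M i j\<close> is finite. For \<open>i = j\<close> the relator is
  \<open>i i\<close>, so no formal inverses of the generators are needed.\<close>

inductive relator_step :: "('i \<Rightarrow> 'i \<Rightarrow> nat) \<Rightarrow> 'i list \<Rightarrow> 'i list \<Rightarrow> bool" for M where
  "M i j \<noteq> 0 \<Longrightarrow> relator_step M (xs @ ys) (xs @ concat (replicate (M i j) [i, j]) @ ys)"

locale coxeter_system = group G for G (structure) +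
  fixes s :: "'i \<Rightarrow> 'a"
  assumes simple_closed: "range s \<subseteq> carrier G"
    and simple_inj: "inj s"
    and simple_order: "ord (s i) = 2"
    and simple_generate: "generate G (range s) = carrier G"
    and presentation:
      "word_prod G s xs = word_prod G s ys \<Longrightarrow> equivclp (relator_step (coxeter_matrix G s)) xs ys"


section \<open>Twisted Coxeter groups\<close>

text \<open>The carrier is the whole group \<open>W\<close>; \<open>cox\<close> is the Coxeter group, \<open>twist\<close> the group acting on it, and
  \<open>sref\<close> enumerates the simple reflections. The semidirect product is internal, so the action of
  \<open>twist\<close> on \<open>cox\<close> is conjugation.\<close>

record ('a, 'i) twisted_coxeter = "'a monoid" +
  cox :: "'a set"
  twist :: "'a set"
  sref :: "'i \<Rightarrow> 'a"

locale twisted_coxeter_group = group W for W :: "('a, 'i) twisted_coxeter" (structure) +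
  assumes cox_normal: "cox W \<lhd> W"
    and twist_subgroup: "subgroup (twist W) W"
    and twist_int_cox: "twist W \<inter> cox W = {\<one>}"
    and twist_mult_cox: "twist W <#> cox W = carrier W"
    and cox_system: "coxeter_system (W\<lparr>carrier := cox W\<rparr>) (sref W)"
    and twist_preserves_simple: "\<omega> \<in> twist W \<Longrightarrow> (\<lambda>x. \<omega> \<otimes> x \<otimes> inv \<omega>) ` range (sref W) = range (sref W)"

definition parabolic :: "('a, 'i) twisted_coxeter \<Rightarrow> 'i set \<Rightarrow> 'a set" where
  "parabolic W J = generate W (sref W ` J)"


section \<open>The reflection representation\<close>

definition simple_root :: "'i \<Rightarrow> real ^ 'i" where
  "simple_root i = axis i 1"

definition cox_form :: "('a, 'i::finite) twisted_coxeter \<Rightarrow> real ^ 'i \<Rightarrow> real ^ 'i \<Rightarrow> real" where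
  "cox_form W u v = (\<Sum>i\<in>UNIV. \<Sum>j\<in>UNIV. u $ i * v $ j *
     (let m = coxeter_matrix W (sref W) i j in if m = 0 then - 1 else - cos (pi / real m)))"

definition simple_reflection :: "('a, 'i::finite) twisted_coxeter \<Rightarrow> 'i \<Rightarrow> real ^ 'i \<Rightarrow> real ^ 'i" where
  "simple_reflection W i v = v - (2 * cox_form W (simple_root i) v) *\<^sub>R simple_root i"

definition twist_perm :: "('a, 'i) twisted_coxeter \<Rightarrow> 'a \<Rightarrow> 'i \<Rightarrow> 'i" where
  "twist_perm W \<omega> i = (THE j. sref W j = \<omega> \<otimes>\<^bsub>W\<^esub> sref W i \<otimes>\<^bsub>W\<^esub> inv\<^bsub>W\<^esub> \<omega>)"

definition twist_map :: "('a, 'i::finite) twisted_coxeter \<Rightarrow> 'a \<Rightarrow> real ^ 'i \<Rightarrow> real ^ 'i" where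
  "twist_map W \<omega> v = (\<Sum>i\<in>UNIV. v $ i *\<^sub>R simple_root (twist_perm W \<omega> i))"

text \<open>The action on \<open>V\<close>. The map is independent of the chosen expression \<open>w = \<omega> s\<^sub>1 \<dots> s\<^sub>k\<close> because the
  simple reflections of \<open>V\<close> satisfy the Coxeter relations.\<close>

definition act :: "('a, 'i::finite) twisted_coxeter \<Rightarrow> 'a \<Rightarrow> real ^ 'i \<Rightarrow> real ^ 'i" where
  "act W w = (THE f. \<exists>\<omega>\<in>twist W. \<exists>xs. w = \<omega> \<otimes>\<^bsub>W\<^esub> word_prod W (sref W) xs \<and>
     f = twist_map W \<omega> \<circ> foldr (\<lambda>i g. simple_reflection W i \<circ> g) xs id)"

definition eigenspace :: "('a, 'i::finite) twisted_coxeter \<Rightarrow> 'a \<Rightarrow> real \<Rightarrow> (real ^ 'i) set" where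
  "eigenspace W w c = {v. act W w v = c *\<^sub>R v}"


section \<open>Roots and length\<close>

definition parabolic_roots :: "('a, 'i::finite) twisted_coxeter \<Rightarrow> 'i set \<Rightarrow> (real ^ 'i) set" where
  "parabolic_roots W J = {act W x (simple_root j) | x j. x \<in> parabolic W J \<and> j \<in> J}"

definition roots :: "('a, 'i::finite) twisted_coxeter \<Rightarrow> (real ^ 'i) set" where
  "roots W = {act W x (simple_root i) | x i. x \<in> cox W}"

definition pos_roots :: "('a, 'i::finite) twisted_coxeter \<Rightarrow> (real ^ 'i) set" where
  "pos_roots W = {\<beta> \<in> roots W. \<forall>i. \<beta> $ i \<ge> 0}"

definition neg_roots :: "('a, 'i::finite) twisted_coxeter \<Rightarrow> (real ^ 'i) set" where
  "neg_roots W = {\<beta> \<in> roots W. \<forall>i. \<beta> $ i \<le> 0}"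

definition parabolic_pos_roots :: "('a, 'i::finite) twisted_coxeter \<Rightarrow> 'i set \<Rightarrow> (real ^ 'i) set" where
  "parabolic_pos_roots W J = parabolic_roots W J \<inter> pos_roots W"

definition inversions :: "('a, 'i::finite) twisted_coxeter \<Rightarrow> 'a \<Rightarrow> (real ^ 'i) set" where
  "inversions W w = {\<beta> \<in> pos_roots W. act W w \<beta> \<in> neg_roots W}"

definition len :: "('a, 'i::finite) twisted_coxeter \<Rightarrow> 'a \<Rightarrow> nat" where
  "len W w = card (inversions W w)"

definition fixed_roots :: "('a, 'i::finite) twisted_coxeter \<Rightarrow> 'a \<Rightarrow> (real ^ 'i) set" where
  "fixed_roots W w = {\<beta> \<in> roots W. act W w \<beta> = \<beta>}"

definition fixed_len :: "('a, 'i::finite) twisted_coxeter \<Rightarrow> 'a \<Rightarrow> nat" where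
  "fixed_len W w = card (fixed_roots W w)"

definition minus_roots :: "('a, 'i::finite) twisted_coxeter \<Rightarrow> 'a \<Rightarrow> (real ^ 'i) set" where
  "minus_roots W w = inversions W w \<inter> eigenspace W w (- 1)"

definition max_len :: "('a, 'i::finite) twisted_coxeter \<Rightarrow> 'a set \<Rightarrow> 'a set" where
  "max_len W X = {u \<in> X. \<forall>v\<in>X. len W v \<le> len W u}"

definition min_len :: "('a, 'i::finite) twisted_coxeter \<Rightarrow> 'a set \<Rightarrow> 'a set" where
  "min_len W X = {u \<in> X. \<forall>v\<in>X. len W u \<le> len W v}"


section \<open>Conjugation\<close>

definition conj_orbits :: "('a, 'i) twisted_coxeter \<Rightarrow> 'a set \<Rightarrow> 'a set set" where
  "conj_orbits W H = {{x \<otimes>\<^bsub>W\<^esub> y \<otimes>\<^bsub>W\<^esub> inv\<^bsub>W\<^esub> x | x. x \<in> H} | y. y \<in> carrier W}"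

definition conj_simple :: "('a, 'i) twisted_coxeter \<Rightarrow> 'i \<Rightarrow> 'a \<Rightarrow> 'a" where
  "conj_simple W j w = sref W j \<otimes>\<^bsub>W\<^esub> w \<otimes>\<^bsub>W\<^esub> sref W j"

definition ascends :: "('a, 'i::finite) twisted_coxeter \<Rightarrow> 'i set \<Rightarrow> 'a \<Rightarrow> 'a \<Rightarrow> bool" where
  "ascends W J = (\<lambda>u v. \<exists>j\<in>J. v = conj_simple W j u \<and> len W u < len W v)\<^sup>*\<^sup>*"

definition descends :: "('a, 'i::finite) twisted_coxeter \<Rightarrow> 'i set \<Rightarrow> 'a \<Rightarrow> 'a \<Rightarrow> bool" where
  "descends W J = (\<lambda>u v. \<exists>j\<in>J. v = conj_simple W j u \<and> len W v < len W u)\<^sup>*\<^sup>*"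

definition involution :: "('a, 'i) twisted_coxeter \<Rightarrow> 'a \<Rightarrow> bool" where
  "involution W w \<longleftrightarrow> w \<in> carrier W \<and> w \<otimes>\<^bsub>W\<^esub> w = \<one>\<^bsub>W\<^esub>"


section \<open>Coset descriptions of extremal involutions\<close>

definition double_coset :: "('a, 'i) twisted_coxeter \<Rightarrow> 'i set \<Rightarrow> 'a \<Rightarrow> 'i set \<Rightarrow> 'a set" where
  "double_coset W J x K = (parabolic W J #>\<^bsub>W\<^esub> x) <#>\<^bsub>W\<^esub> parabolic W K"

definition ascent_set :: "('a, 'i::finite) twisted_coxeter \<Rightarrow> 'i set \<Rightarrow> 'a \<Rightarrow> 'i set" where
  "ascent_set W J w = {j \<in> J. conj_simple W j w = w \<and> len W w < len W (w \<otimes>\<^bsub>W\<^esub> sref W j)}"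

definition descent_set :: "('a, 'i::finite) twisted_coxeter \<Rightarrow> 'i set \<Rightarrow> 'a \<Rightarrow> 'i set" where
  "descent_set W J w = {j \<in> J. conj_simple W j w = w \<and> len W w > len W (w \<otimes>\<^bsub>W\<^esub> sref W j)}"

definition min_description :: "('a, 'i::finite) twisted_coxeter \<Rightarrow> 'i set \<Rightarrow> 'a \<Rightarrow> bool" where
  "min_description W J w \<longleftrightarrow>
    (let K = descent_set W J w in
      \<exists>x v. w = x \<otimes>\<^bsub>W\<^esub> v
        \<and> v \<in> max_len W (parabolic W K)
        \<and> x \<in> min_len W (w <#\<^bsub>W\<^esub> parabolic W K)
        \<and> parabolic_pos_roots W J \<inter> parabolic_pos_roots W K = parabolic_pos_roots W J \<inter> minus_roots W w
        \<and> involution W x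
        \<and> x \<in> min_len W (double_coset W J x K)
        \<and> bij_betw (act W x) (simple_root ` K) (simple_root ` K))"

text \<open>For maximal elements the simple reflections in \<open>K\<close> are ascents of \<open>w\<close>, so \<open>w\<close> is the shortest
  element of \<open>w <# parabolic W K\<close> and, unless \<open>K = {}\<close>, the requirements ``\<open>w = x \<otimes> v\<close>'', ``\<open>v = \<one>\<close>''
  and ``\<open>x\<close> is the longest element of its left coset'' are incompatible. There are two consistent forms:
  either \<open>v = \<one>\<close>, with \<open>x\<close> the shortest element of its left coset and maximality in the double coset
  measured among such distinguished left coset representatives;\<close>

definition left_reps :: "('a, 'i::finite) twisted_coxeter \<Rightarrow> 'i set \<Rightarrow> 'a set" where
  "left_reps W K = {y \<in> carrier W. y \<in> min_len W (y <#\<^bsub>W\<^esub> parabolic W K)}"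

definition max_description :: "('a, 'i::finite) twisted_coxeter \<Rightarrow> 'i set \<Rightarrow> 'a \<Rightarrow> bool" where
  "max_description W J w \<longleftrightarrow>
    (let K = ascent_set W J w in
      \<exists>x v. w = x \<otimes>\<^bsub>W\<^esub> v
        \<and> v = \<one>\<^bsub>W\<^esub>
        \<and> parabolic_pos_roots W J \<inter> parabolic_pos_roots W K = parabolic_pos_roots W J \<inter> fixed_roots W w
        \<and> involution W x
        \<and> x \<in> max_len W (double_coset W J x K \<inter> left_reps W K)
        \<and> bij_betw (act W x) (simple_root ` K) (simple_root ` K))"

text \<open>or \<open>x\<close> is the longest element of its left coset and of its double coset, in which case \<open>v\<close> is the
  longest element of \<open>parabolic W K\<close> and \<open>x\<close> permutes the simple roots indexed by \<open>K\<close> up to the sign \<open>-1\<close>.\<close>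

definition max_description_longest :: "('a, 'i::finite) twisted_coxeter \<Rightarrow> 'i set \<Rightarrow> 'a \<Rightarrow> bool" where
  "max_description_longest W J w \<longleftrightarrow>
    (let K = ascent_set W J w in
      \<exists>x v. w = x \<otimes>\<^bsub>W\<^esub> v
        \<and> v \<in> max_len W (parabolic W K)
        \<and> x \<in> max_len W (w <#\<^bsub>W\<^esub> parabolic W K)
        \<and> parabolic_pos_roots W J \<inter> parabolic_pos_roots W K = parabolic_pos_roots W J \<inter> fixed_roots W w
        \<and> involution W x
        \<and> x \<in> max_len W (double_coset W J x K)
        \<and> bij_betw (\<lambda>\<alpha>. - act W x \<alpha>) (simple_root ` K) (simple_root ` K))"


section \<open>Weyl chambers\<close>

definition contains_open_subset :: "'v::topological_space set \<Rightarrow> 'v set \<Rightarrow> bool" where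
  "contains_open_subset C E \<longleftrightarrow> (\<exists>U. U \<noteq> {} \<and> openin (top_of_set E) U \<and> U \<subseteq> C)"

definition dominant_chamber :: "('a, 'i::finite) twisted_coxeter \<Rightarrow> (real ^ 'i) set" where
  "dominant_chamber W = {v. \<forall>i. cox_form W (simple_root i) v > 0}"

text \<open>When \<open>cox W\<close> is infinite the chamber in \<open>V\<close> may be empty (e.g. in affine type), and the
  fundamental chamber is the one in the dual space. Here \<open>f :: real ^ 'i\<close> stands for the linear form
  \<open>\<lambda>v. f \<bullet> v\<close>, whose value at \<open>simple_root i\<close> is \<open>f $ i\<close>; the action is the contragredient one.\<close>

definition dual_chamber :: "(real ^ 'i::finite) set" where
  "dual_chamber = {f. \<forall>i. f \<bullet> simple_root i > 0}"

definition dual_eigenspace :: "('a, 'i::finite) twisted_coxeter \<Rightarrow> 'a \<Rightarrow> real \<Rightarrow> (real ^ 'i) set" where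
  "dual_eigenspace W w c = {f. \<forall>v. f \<bullet> act W (inv\<^bsub>W\<^esub> w) v = c * (f \<bullet> v)}"

definition dominant :: "('a, 'i::finite) twisted_coxeter \<Rightarrow> 'a \<Rightarrow> bool" where
  "dominant W w \<longleftrightarrow> contains_open_subset (closure (dominant_chamber W)) (range (\<lambda>v. v - act W w v))"

end

theory Submission
  imports Defs
begin

text \<open>
Write \<open>R\<close> and \<open>P\<close> for the roots and the positive roots, and \<open>\<alpha>\<^sub>j\<close> for the simple roots. Conjugating an
involution \<open>w\<close> by the simple reflection \<open>s\<^sub>j\<close> lengthens it if \<open>w \<alpha>\<^sub>j\<close> is positive and different from
\<open>\<alpha>\<^sub>j\<close>, shortens it if \<open>w \<alpha>\<^sub>j\<close> is negative and different from \<open>- \<alpha>\<^sub>j\<close>, and fixes it if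
\<open>w \<alpha>\<^sub>j = \<plusminus> \<alpha>\<^sub>j\<close> (\<open>conj_simple_ascent\<close>, \<open>conj_simple_descent\<close>, \<open>conj_simple_fixed\<close>). Local extremality of
\<open>w\<close> under these moves is therefore a condition on the roots \<open>w \<alpha>\<^sub>j\<close> with \<open>j \<in> J\<close>. With \<open>e = - 1\<close> for
maximality and \<open>e = 1\<close> for minimality it reads: each \<open>e w \<alpha>\<^sub>j\<close> is positive or equal to \<open>- \<alpha>\<^sub>j\<close>. This is
the predicate \<open>extremal e J w\<close>, and every part of the theorem is proved by comparison with it.

Local extremality spreads from the simple roots to all positive roots \<open>\<beta>\<close> of the parabolic subsystem of \<open>J\<close>
(\<open>extremal_root_cases\<close>). Indeed, let \<open>\<beta> = \<Sum> c\<^sub>j \<alpha>\<^sub>j\<close> with \<open>c\<^sub>j \<ge> 0\<close>, and let \<open>K\<close> be the set of those \<open>j\<close> with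
\<open>e w \<alpha>\<^sub>j = - \<alpha>\<^sub>j\<close>. If \<open>e w \<beta>\<close> is negative, the coordinates of \<open>- e w \<beta>\<close> outside \<open>K\<close> are both \<open>\<ge> 0\<close> and
\<open>\<le> 0\<close>, so \<open>- e w \<beta>\<close> lies in the span of the \<open>\<alpha>\<^sub>k\<close> with \<open>k \<in> K\<close>, on which \<open>e w\<close> is \<open>- 1\<close>; as \<open>w\<close> is
an involution, \<open>\<beta>\<close> lies in that span as well and \<open>e w \<beta> = - \<beta>\<close>. This is the description by inversions.

Local extremality implies extremality in the whole orbit because the length of \<open>x w x\<^sup>-\<^sup>1\<close> is half the number of
roots \<open>\<gamma>\<close> for which \<open>x \<gamma>\<close> and \<open>x w \<gamma>\<close> have different signs (\<open>switched_conj\<close>). An element \<open>x\<close> of the parabolic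
subgroup changes signs only inside the parabolic subsystem, and there the description by inversions makes the
set for \<open>x = 1\<close> the largest, respectively the smallest, possible one. Every element that is not locally
extremal admits an improving conjugation; hence descending chains reach a minimal element, and ascending chains
reach a maximal one if there is any.

For the coset descriptions, \<open>K\<close> is \<open>ascent_set\<close> or \<open>descent_set\<close>, \<open>w\<close> commutes with its parabolic subgroup,
and the longest element \<open>v\<close> of that subgroup, when it is used, is an involution that permutes the simple
roots of \<open>K\<close> up to sign; all length comparisons are inclusions of sets of roots (\<open>len_mult_le\<close>). For the
chambers, a linear form \<open>f\<close> with \<open>f \<circ> w = e f\<close> vanishes on \<open>\<alpha>\<^sub>k\<close> for \<open>k \<in> K\<close>, and if \<open>w\<close>
is extremal, the form \<open>g + e (g \<circ> w)\<close>, where \<open>g\<close> has value \<open>1\<close> on all simple roots, is positive on the others.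
Conversely, a simple root that violates extremality forces \<open>f\<close> to vanish on it. The form of a finite
Coxeter group is nondegenerate, which transports the statement to \<open>V\<close>.

The background on Coxeter groups is developed on the way: the action on \<open>V\<close> is well defined because the
reflections satisfy the Coxeter relations (\<open>refl_word_eq\<close>), and every root is positive or negative
(\<open>ascent_root_nonneg\<close>). Both rest on an explicit computation in rank two.
\<close>

section \<open>Words in the simple reflections and the invariant form\<close>

text \<open>The reflection representation has the simple roots as a basis indexed by \<open>'i\<close>; the locale only adds that this
index type is finite.\<close>

locale finite_rank_twisted_coxeter = twisted_coxeter_group W
  for W :: "('a, 'i::finite) twisted_coxeter" (structure)
begin

abbreviation word :: "'i list \<Rightarrow> 'a" where
  "word \<equiv> word_prod W (sref W)"

abbreviation m :: "'i \<Rightarrow> 'i \<Rightarrow> nat" where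
  "m \<equiv> coxeter_matrix W (sref W)"

abbreviation form :: "real ^ 'i \<Rightarrow> real ^ 'i \<Rightarrow> real" where
  "form \<equiv> cox_form W"

abbreviation \<sigma> :: "'i \<Rightarrow> real ^ 'i \<Rightarrow> real ^ 'i" where
  "\<sigma> \<equiv> simple_reflection W"

lemma cox_subgroup: "subgroup (cox W) W"
  using cox_normal by (rule normal_imp_subgroup)

lemma cox_closed: "x \<in> cox W \<Longrightarrow> x \<in> carrier W"
  using subgroup.mem_carrier[OF cox_subgroup] .

lemma ord_cox: "x \<in> cox W \<Longrightarrow> group.ord (W\<lparr>carrier := cox W\<rparr>) x = ord x"
  by (simp add: ord_def group.ord_def[OF subgroup_imp_group[OF cox_subgroup]]
      nat_pow_consistent[symmetric])

lemma sref_cox [simp]: "sref W i \<in> cox W"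
  using coxeter_system.simple_closed[OF cox_system] by auto

lemma sref_closed [simp]: "sref W i \<in> carrier W"
  by (simp add: cox_closed)

lemma inj_sref: "inj (sref W)"
  by (rule coxeter_system.simple_inj[OF cox_system])

lemma sref_square [simp]: "sref W i \<otimes> sref W i = \<one>"
proof -
  have "ord (sref W i) = 2"
    using coxeter_system.simple_order[OF cox_system, of i] by (simp add: ord_cox)
  then show ?thesis
    using pow_ord_eq_1[of "sref W i"] by (simp add: numeral_2_eq_2)
qed

lemma inv_sref [simp]: "inv (sref W i) = sref W i"
  using inv_equality[OF sref_square] by simp

lemma sref_cancel [simp]: "x \<in> carrier W \<Longrightarrow> x \<otimes> sref W i \<otimes> sref W i = x"
  by (simp add: m_assoc)

lemma sref_cancel_left [simp]: "x \<in> carrier W \<Longrightarrow> sref W i \<otimes> (sref W i \<otimes> x) = x"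
  by (simp add: m_assoc[symmetric])

lemma word_Nil [simp]: "word [] = \<one>"
  and word_Cons [simp]: "word (i # xs) = sref W i \<otimes> word xs"
  by (simp_all add: word_prod_def)

lemma word_cox [simp]: "word xs \<in> cox W"
  by (induction xs)
    (simp_all add: subgroup.one_closed[OF cox_subgroup] subgroup.m_closed[OF cox_subgroup])

lemma word_closed [simp]: "word xs \<in> carrier W"
  by (simp add: cox_closed)

lemma word_append [simp]: "word (xs @ ys) = word xs \<otimes> word ys"
  by (induction xs) (simp_all add: m_assoc)

lemma generate_sref_eq_words:
  assumes "x \<in> generate W (sref W ` J)"
  obtains xs where "set xs \<subseteq> J" "x = word xs"
proof -
  have "\<exists>xs. set xs \<subseteq> J \<and> x = word xs"
    using assms
  proof induction
    case one
    show ?case by (rule exI[of _ "[]"]) simp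
  next
    case (incl h)
    then obtain i where "i \<in> J" "h = sref W i" by auto
    then show ?case by (intro exI[of _ "[i]"]) simp
  next
    case (inv h)
    then obtain i where "i \<in> J" "h = sref W i" by auto
    then show ?case by (intro exI[of _ "[i]"]) simp
  next
    case (eng h1 h2)
    then obtain xs ys where "set xs \<subseteq> J" "h1 = word xs" "set ys \<subseteq> J" "h2 = word ys" by auto
    then show ?case by (intro exI[of _ "xs @ ys"]) simp
  qed
  then show thesis using that by auto
qed

lemma generate_sref: "generate W (range (sref W)) = cox W"
  using generate_consistent[OF coxeter_system.simple_closed[OF cox_system, simplified] cox_subgroup]
    coxeter_system.simple_generate[OF cox_system] by simp

lemma cox_eq_words:
  assumes "x \<in> cox W"
  obtains xs where "x = word xs"
  using generate_sref_eq_words[of x UNIV] assms by (auto simp: generate_sref)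

text \<open>The presentation is stated for the Coxeter group as a structure of its own; multiplication and orders of its
elements agree with those in \<open>W\<close>.\<close>

lemma word_presentation:
  assumes "word xs = word ys"
  shows "equivclp (relator_step m) xs ys"
proof -
  have "coxeter_matrix (W\<lparr>carrier := cox W\<rparr>) (sref W) = m"
    by (auto simp: fun_eq_iff coxeter_matrix_def ord_cox subgroup.m_closed[OF cox_subgroup])
  moreover have "word_prod (W\<lparr>carrier := cox W\<rparr>) (sref W) zs = word zs" for zs
    by (simp add: word_prod_def)
  ultimately show ?thesis
    using coxeter_system.presentation[OF cox_system, of xs ys] assms by simp
qed

lemma m_sym: "m i j = m j i"
  using ord_inv[of "sref W i \<otimes> sref W j"]
  by (simp add: coxeter_matrix_def inv_mult_group)

lemma m_diag [simp]: "m i i = 1"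
  by (simp add: coxeter_matrix_def)

text \<open>Keeps \<open>pi / m i j\<close> strictly below \<open>pi\<close>, so that its sine is positive.\<close>

lemma m_ne_1: "i \<noteq> j \<Longrightarrow> m i j \<noteq> 1"
  using ord_eq_1[of "sref W i \<otimes> sref W j"] inv_equality[of "sref W i" "sref W j"] inj_sref
  by (auto simp: coxeter_matrix_def inj_eq)

lemma simple_root_nth: "simple_root i $ j = (if i = j then 1 else 0)"
  by (auto simp: simple_root_def axis_def)

lemma simple_root_expansion: "v = (\<Sum>i\<in>UNIV. v $ i *\<^sub>R simple_root i)" for v :: "real ^ 'i"
  by (simp add: vec_eq_iff simple_root_nth if_distrib cong: if_cong)

lemma form_bilinear: "bilinear form"
  unfolding bilinear_def cox_form_def
  by (auto intro!: linearI simp: algebra_simps sum.distrib sum_distrib_left)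

lemmas form_simps =
  bilinear_ladd[OF form_bilinear] bilinear_radd[OF form_bilinear]
  bilinear_lsub[OF form_bilinear] bilinear_rsub[OF form_bilinear]
  bilinear_lneg[OF form_bilinear] bilinear_rneg[OF form_bilinear]
  bilinear_lmul[OF form_bilinear] bilinear_rmul[OF form_bilinear]
  bilinear_lzero[OF form_bilinear] bilinear_rzero[OF form_bilinear]

lemma form_sym: "form u v = form v u"
  unfolding cox_form_def
  by (subst sum.swap) (simp add: m_sym Let_def mult.commute)

lemma form_simple:
  "form (simple_root i) (simple_root j) = (if m i j = 0 then - 1 else - cos (pi / real (m i j)))"
proof -
  have "(\<Sum>k\<in>UNIV. \<Sum>l\<in>UNIV. (if i = k then 1 else 0) * (if j = l then 1 else 0) * f k l) = f i j"
    for f :: "'i \<Rightarrow> 'i \<Rightarrow> real"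
  proof -
    have "(\<Sum>l\<in>UNIV. (if i = k then 1 else 0) * (if j = l then 1 else 0) * f k l) =
        (if i = k then f k j else 0)" for k
      by (simp add: if_distrib[of "\<lambda>x. x * _"] cong: if_cong)
    then show ?thesis by simp
  qed
  then show ?thesis
    by (simp add: cox_form_def simple_root_nth Let_def)
qed

lemma form_simple_diag [simp]: "form (simple_root i) (simple_root i) = 1"
  by (simp add: form_simple)

lemma refl_linear: "linear (\<sigma> i)"
  by (rule linearI) (simp_all add: simple_reflection_def form_simps algebra_simps)

lemma refl_simple [simp]: "\<sigma> i (simple_root i) = - simple_root i"
  by (simp add: simple_reflection_def algebra_simps scaleR_2)

lemma refl_refl [simp]: "\<sigma> i (\<sigma> i v) = v"
  by (simp add: simple_reflection_def form_simps algebra_simps flip: scaleR_left.add)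

lemma form_refl [simp]: "form (\<sigma> i u) (\<sigma> i v) = form u v"
  by (simp add: simple_reflection_def form_simps algebra_simps form_sym[of u "simple_root i"])

end

section \<open>Alternating words and Chebyshev coefficients\<close>

text \<open>Words of length \<open>k\<close> in \<open>i\<close> and \<open>j\<close> that alternate and end in \<open>j\<close>. Growing them at the front
matches the computation of their action on \<open>simple_root i\<close>.\<close>

primrec alternating :: "'i \<Rightarrow> 'i \<Rightarrow> nat \<Rightarrow> 'i list" where
  "alternating i j 0 = []"
| "alternating i j (Suc k) = (if even k then j else i) # alternating i j k"

lemma length_alternating [simp]: "length (alternating i j k) = k"
  by (induction k) simp_all

lemma alternating_snoc: "alternating i j (Suc k) = alternating j i k @ [j]"
  by (induction k) simp_all

lemma relator_alternating: "concat (replicate k [i, j]) = alternating i j (2 * k)"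
  by (induction k) simp_all

lemma alternating_add:
  "alternating i j (n + k) =
    (if even k then alternating i j n else alternating j i n) @ alternating i j k"
  by (induction n) auto

lemma rev_alternating:
  "rev (alternating i j k) = (if even k then alternating j i k else alternating i j k)"
proof (induction k arbitrary: i j)
  case (Suc k)
  have "rev (alternating i j (Suc k)) = j # rev (alternating j i k)"
    by (simp only: alternating_snoc) simp
  then show ?case
    by (simp only: Suc.IH) simp
qed simp

text \<open>\<open>cheb c (k + 1)\<close> is the Chebyshev polynomial of the second kind \<open>U\<^sub>k\<close> at \<open>c / 2\<close>.\<close>

fun cheb :: "real \<Rightarrow> nat \<Rightarrow> real" where
  "cheb c 0 = 0"
| "cheb c (Suc 0) = 1"
| "cheb c (Suc (Suc k)) = c * cheb c (Suc k) - cheb c k"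

lemma cheb_sin: "sin t * cheb (2 * cos t) k = sin (real k * t)"
proof (induction k rule: induct_nat_012)
  case (ge2 k)
  have "sin (real (Suc (Suc k)) * t) = sin (real (Suc k) * t + t)"
    by (simp add: algebra_simps)
  moreover have "sin (real k * t) = sin (real (Suc k) * t - t)"
    by (simp add: algebra_simps)
  ultimately have "sin (real (Suc (Suc k)) * t) = 2 * cos t * sin (real (Suc k) * t) - sin (real k * t)"
    by (simp only: sin_add sin_diff) (simp add: algebra_simps)
  moreover have "sin t * cheb (2 * cos t) (Suc (Suc k)) =
      2 * cos t * (sin t * cheb (2 * cos t) (Suc k)) - sin t * cheb (2 * cos t) k"
    by (simp add: algebra_simps)
  ultimately show ?case
    using ge2 by simp
qed simp_all

lemma cheb_2: "cheb 2 k = real k"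
  by (induction k rule: induct_nat_012) simp_all

context finite_rank_twisted_coxeter
begin

section \<open>The simple reflections satisfy the Coxeter relations\<close>

definition refl_word :: "'i list \<Rightarrow> real ^ 'i \<Rightarrow> real ^ 'i" where
  "refl_word xs = foldr (\<lambda>i g. \<sigma> i \<circ> g) xs id"

lemma refl_word_Nil [simp]: "refl_word [] v = v"
  and refl_word_Cons [simp]: "refl_word (i # xs) v = \<sigma> i (refl_word xs v)"
  by (simp_all add: refl_word_def)

lemma refl_word_append [simp]: "refl_word (xs @ ys) v = refl_word xs (refl_word ys v)"
  by (induction xs) simp_all

lemma refl_word_linear: "linear (refl_word xs)"
proof (induction xs)
  case (Cons i xs)
  have "refl_word (i # xs) = \<sigma> i \<circ> refl_word xs" by (simp add: fun_eq_iff)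
  then show ?case using linear_compose[OF Cons refl_linear] by metis
next
  case Nil
  have "refl_word [] = id" by (simp add: fun_eq_iff)
  then show ?case using linear_id by metis
qed

lemma refl_word_rev [simp]: "refl_word (rev xs) (refl_word xs v) = v"
  by (induction xs arbitrary: v) simp_all

lemma form_refl_word [simp]: "form (refl_word xs u) (refl_word xs v) = form u v"
  by (induction xs) simp_all

text \<open>Equals \<open>2 cos (\<pi> / m)\<close> for \<open>m = m i j\<close> finite, and \<open>2\<close> for \<open>m\<close> infinite.\<close>

definition cheb_coeff :: "'i \<Rightarrow> 'i \<Rightarrow> real" where
  "cheb_coeff i j = - 2 * form (simple_root i) (simple_root j)"

text \<open>The reflection in \<open>simple_root p\<close> sends \<open>a q + b p\<close> to \<open>a q + (c a - b) p\<close>, where \<open>p\<close> and \<open>q\<close> stand for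
two simple roots and \<open>c\<close> for their coefficient; applying the two reflections in turn therefore produces the
Chebyshev recursion.\<close>

lemma refl_word_alternating:
  "refl_word (alternating i j k) (simple_root i) =
    cheb (cheb_coeff i j) (Suc k) *\<^sub>R simple_root (if even k then i else j) +
    cheb (cheb_coeff i j) k *\<^sub>R simple_root (if even k then j else i)"
proof (induction k)
  case (Suc k)
  let ?c = "cheb_coeff i j"
  have *: "\<sigma> p (a *\<^sub>R simple_root q + b *\<^sub>R simple_root p) =
      (- 2 * form (simple_root p) (simple_root q) * a - b) *\<^sub>R simple_root p + a *\<^sub>R simple_root q"
    for p q a b
    by (simp add: vec_eq_iff simple_reflection_def form_simps algebra_simps)
  show ?case
    using Suc.IH by (simp add: * cheb_coeff_def form_sym[of "simple_root j" "simple_root i"])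
qed simp

lemma cheb_coeff_cos:
  assumes "m i j \<noteq> 0"
  shows "cheb_coeff i j = 2 * cos (pi / m i j)"
  using assms by (simp add: cheb_coeff_def form_simple)

lemma sin_pi_m_pos: "m i j \<noteq> 0 \<Longrightarrow> i \<noteq> j \<Longrightarrow> 0 < sin (pi / m i j)"
  using m_ne_1[of i j] by (intro sin_gt_zero) (auto simp: field_simps)

text \<open>The values are \<open>sin (k \<pi> / m) / sin (\<pi> / m)\<close>, or \<open>k\<close> if \<open>m\<close> is infinite;
in the range considered \<open>k \<pi> / m\<close> does not exceed \<open>\<pi>\<close>.\<close>

lemma cheb_coeff_nonneg:
  assumes "i \<noteq> j" "m i j = 0 \<or> k \<le> m i j"
  shows "0 \<le> cheb (cheb_coeff i j) k"
proof (cases "m i j = 0")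
  case True
  then show ?thesis by (simp add: cheb_coeff_def form_simple cheb_2)
next
  case False
  let ?t = "pi / m i j"
  have "real k * ?t \<le> pi"
    using assms False by (simp add: field_simps)
  then have "0 \<le> sin (real k * ?t)"
    by (intro sin_ge_zero) auto
  then show ?thesis
    using cheb_sin[of ?t k] sin_pi_m_pos[OF False assms(1)] cheb_coeff_cos[OF False]
    by (metis mult_less_0_iff linorder_not_less)
qed

lemma alternating_fixes_simple:
  assumes "i \<noteq> j" "m i j \<noteq> 0"
  shows "refl_word (alternating i j (2 * m i j)) (simple_root i) = simple_root i"
proof -
  let ?t = "pi / m i j" and ?k = "2 * m i j"
  have t: "sin ?t \<noteq> 0" using sin_pi_m_pos[OF assms(2,1)] by simp
  have "real ?k * ?t = 2 * pi" "real (Suc ?k) * ?t = ?t + 2 * pi"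
    using assms(2) by (simp_all add: field_simps)
  then have "sin ?t * cheb (2 * cos ?t) ?k = 0" "sin ?t * cheb (2 * cos ?t) (Suc ?k) = sin ?t"
    by (simp_all only: cheb_sin) simp_all
  then have "cheb (cheb_coeff i j) ?k = 0" "cheb (cheb_coeff i j) (Suc ?k) = 1"
    using t by (simp_all add: cheb_coeff_cos[OF assms(2)] del: cheb.simps)
  then show ?thesis
    by (simp only: refl_word_alternating) simp
qed

lemma refl_word_fixed:
  assumes "\<And>i. i \<in> set xs \<Longrightarrow> form (simple_root i) v = 0"
  shows "refl_word xs v = v"
  using assms by (induction xs) (simp_all add: simple_reflection_def)

lemma set_alternating: "set (alternating i j k) \<subseteq> {i, j}"
  by (induction k) auto

text \<open>The relator fixes the plane of the two simple roots by the Chebyshev formula. The form is nondegenerate on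
that plane, so every vector differs from an element of the plane by a vector that both reflections fix.\<close>

lemma refl_word_relator:
  assumes "m i j \<noteq> 0"
  shows "refl_word (concat (replicate (m i j) [i, j])) v = v"
proof (cases "i = j")
  case False
  let ?R = "refl_word (alternating i j (2 * m i j))"
  let ?a = "simple_root i" and ?b = "simple_root j"
  let ?g = "form ?a ?b"
  have Ra: "?R ?a = ?a"
    using alternating_fixes_simple[OF False assms] .
  have "refl_word (alternating j i (2 * m j i)) ?b = ?b"
    using alternating_fixes_simple[of j i] False assms m_sym[of i j] by simp
  then have "refl_word (rev (alternating i j (2 * m i j))) ?b = ?b"
    by (simp add: rev_alternating m_sym[of i j])
  then have Rb: "?R ?b = ?b"
    using refl_word_rev[of "rev (alternating i j (2 * m i j))" ?b] by simp
  have "?g\<^sup>2 \<noteq> 1"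
  proof -
    have "?g = - cos (pi / m i j)" using assms by (simp add: form_simple)
    then show ?thesis
      using sin_pi_m_pos[OF assms False] sin_squared_eq[of "pi / m i j"] by auto
  qed
  then have d: "1 - ?g * ?g \<noteq> 0" by (simp add: power2_eq_square)
  \<comment> \<open>Coordinates of the orthogonal projection to the plane, by Cramer's rule with determinant \<open>1 - g\<^sup>2\<close>.\<close>
  define x where "x = (form ?a v - ?g * form ?b v) / (1 - ?g * ?g)"
  define y where "y = (form ?b v - ?g * form ?a v) / (1 - ?g * ?g)"
  define p where "p = x *\<^sub>R ?a + y *\<^sub>R ?b"
  have "form ?a p = form ?a v" "form ?b p = form ?b v"
    using d unfolding p_def x_def y_def
    by (simp_all add: form_simps form_sym[of ?b ?a] divide_simps) (simp_all add: algebra_simps)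
  then have "?R (v - p) = v - p"
    using set_alternating by (intro refl_word_fixed) (fastforce simp: form_simps)
  moreover have "?R p = p"
    by (simp add: p_def linear_add[OF refl_word_linear] linear_scale[OF refl_word_linear] Ra Rb)
  ultimately have "?R ((v - p) + p) = (v - p) + p"
    by (simp only: linear_add[OF refl_word_linear])
  then show ?thesis
    by (simp add: relator_alternating)
qed simp

lemma refl_word_eq:
  assumes "word xs = word ys"
  shows "refl_word xs = refl_word ys"
proof -
  have step: "refl_word xs = refl_word ys" if "relator_step m xs ys" for xs ys
    using that by cases (auto simp: fun_eq_iff refl_word_relator)
  from word_presentation[OF assms] show ?thesis
    by (induction rule: equivclp_induct) (auto dest: step)
qed

section \<open>The action of the twisted group\<close>

abbreviation tperm :: "'a \<Rightarrow> 'i \<Rightarrow> 'i" where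
  "tperm \<equiv> twist_perm W"

abbreviation tmap :: "'a \<Rightarrow> real ^ 'i \<Rightarrow> real ^ 'i" where
  "tmap \<equiv> twist_map W"

abbreviation action :: "'a \<Rightarrow> real ^ 'i \<Rightarrow> real ^ 'i" (infixr "\<cdot>" 75) where
  "w \<cdot> v \<equiv> act W w v"

lemma inv_cancel [simp]:
  assumes "x \<in> carrier W" "y \<in> carrier W"
  shows "inv x \<otimes> (x \<otimes> y) = y" "x \<otimes> (inv x \<otimes> y) = y"
  using assms by (simp_all flip: m_assoc)

lemma conj_eq_one:
  assumes "t \<in> carrier W" "x \<in> carrier W"
  shows "t \<otimes> x \<otimes> inv t = \<one> \<longleftrightarrow> x = \<one>"
proof
  assume "t \<otimes> x \<otimes> inv t = \<one>"
  then have "inv t \<otimes> (t \<otimes> x \<otimes> inv t) \<otimes> t = inv t \<otimes> \<one> \<otimes> t" by simp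
  then show "x = \<one>" using assms by (simp add: m_assoc)
qed (use assms in simp)

lemma twist_closed: "t \<in> twist W \<Longrightarrow> t \<in> carrier W"
  using subgroup.mem_carrier[OF twist_subgroup] .

lemma sref_twist_perm:
  assumes "t \<in> twist W"
  shows "sref W (tperm t i) = t \<otimes> sref W i \<otimes> inv t"
proof -
  have "t \<otimes> sref W i \<otimes> inv t \<in> range (sref W)"
    using twist_preserves_simple[OF assms] by blast
  then obtain j where "sref W j = t \<otimes> sref W i \<otimes> inv t"
    by force
  then show ?thesis
    unfolding twist_perm_def using theI[of "\<lambda>j. sref W j = t \<otimes> sref W i \<otimes> inv t" j] inj_sref
    by (metis injD)
qed

lemma twist_perm_mult:
  assumes "t \<in> twist W" "u \<in> twist W"
  shows "tperm (t \<otimes> u) i = tperm t (tperm u i)"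
proof (rule injD[OF inj_sref])
  have "t \<otimes> u \<in> twist W"
    using assms subgroup.m_closed[OF twist_subgroup] by simp
  then show "sref W (tperm (t \<otimes> u) i) = sref W (tperm t (tperm u i))"
    using assms by (simp add: sref_twist_perm twist_closed inv_mult_group m_assoc)
qed

lemma twist_perm_one: "tperm \<one> i = i"
  by (rule injD[OF inj_sref]) (simp add: sref_twist_perm subgroup.one_closed[OF twist_subgroup])

text \<open>Conjugation preserves orders.\<close>

lemma m_twist_perm:
  assumes t: "t \<in> twist W"
  shows "m (tperm t i) (tperm t j) = m i j"
proof -
  have tc: "t \<in> carrier W" using twist_closed[OF t] .
  have conj_pow: "(t \<otimes> x \<otimes> inv t) [^] n = t \<otimes> (x [^] n) \<otimes> inv t" if x: "x \<in> carrier W" for x and n :: nat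
  proof (induction n)
    case (Suc n)
    have "(t \<otimes> x \<otimes> inv t) [^] Suc n = t \<otimes> x [^] n \<otimes> (inv t \<otimes> (t \<otimes> (x \<otimes> inv t)))"
      using Suc x tc by (simp add: m_assoc)
    then show ?case using x tc by (simp add: m_assoc)
  qed (use tc in simp)
  let ?x = "sref W i \<otimes> sref W j"
  have "sref W (tperm t i) \<otimes> sref W (tperm t j) = t \<otimes> sref W i \<otimes> (inv t \<otimes> (t \<otimes> (sref W j \<otimes> inv t)))"
    using tc by (simp add: sref_twist_perm[OF t] m_assoc)
  also have "\<dots> = t \<otimes> ?x \<otimes> inv t"
    using tc by (simp add: m_assoc)
  finally have *: "sref W (tperm t i) \<otimes> sref W (tperm t j) = t \<otimes> ?x \<otimes> inv t" .
  have "(t \<otimes> ?x \<otimes> inv t) [^] n = \<one> \<longleftrightarrow> ?x [^] n = \<one>" for n :: nat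
    using tc by (simp add: conj_pow conj_eq_one)
  then have "ord (t \<otimes> ?x \<otimes> inv t) = ord ?x"
    unfolding ord_def by simp
  then show ?thesis by (simp add: coxeter_matrix_def *)
qed

lemma twist_map_linear: "linear (tmap t)"
  by (rule linearI) (simp_all add: twist_map_def algebra_simps sum.distrib scaleR_sum_right)

lemma twist_map_simple [simp]: "tmap t (simple_root i) = simple_root (tperm t i)"
  by (simp add: twist_map_def simple_root_nth if_distrib[of "\<lambda>x. x *\<^sub>R _"] cong: if_cong)

lemma linear_eq_on_simple:
  assumes "linear f" "linear g" "\<And>i. f (simple_root i) = g (simple_root i)"
  shows "f = (g :: real ^ 'i \<Rightarrow> 'v::real_vector)"
proof
  fix v :: "real ^ 'i"
  have "f v = (\<Sum>i\<in>UNIV. v $ i *\<^sub>R f (simple_root i))"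
    by (subst simple_root_expansion[of v])
      (simp add: linear_sum[OF assms(1)] linear_scale[OF assms(1)])
  moreover have "g v = (\<Sum>i\<in>UNIV. v $ i *\<^sub>R g (simple_root i))"
    by (subst simple_root_expansion[of v])
      (simp add: linear_sum[OF assms(2)] linear_scale[OF assms(2)])
  ultimately show "f v = g v" by (simp add: assms(3))
qed

lemma form_twist_map:
  assumes "t \<in> twist W"
  shows "form (tmap t u) (tmap t v) = form u v"
proof -
  have fs: "form (simple_root (tperm t i)) (simple_root (tperm t j)) = form (simple_root i) (simple_root j)"
    for i j by (simp add: form_simple m_twist_perm[OF assms])
  have lin: "linear (\<lambda>v. form a (f v))" if "linear f" for f :: "real ^ 'i \<Rightarrow> real ^ 'i" and a
    using linear_compose[OF that, of "form a"] form_bilinear by (simp add: o_def bilinear_def)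
  have "(\<lambda>v. form (simple_root (tperm t i)) (tmap t v)) = form (simple_root i)" for i
    by (rule linear_eq_on_simple[OF lin[OF twist_map_linear]])
      (use form_bilinear fs in \<open>auto simp: bilinear_def\<close>)
  then have 1: "form (tmap t (simple_root i)) (tmap t v) = form (simple_root i) v" for i v
    by (simp add: fun_eq_iff)
  have "(\<lambda>u. form (tmap t v) (tmap t u)) = form v"
    by (rule linear_eq_on_simple[OF lin[OF twist_map_linear]])
      (use form_bilinear 1 form_sym in \<open>auto simp: bilinear_def\<close>)
  then show ?thesis by (metis form_sym)
qed

lemma twist_map_refl:
  assumes "t \<in> twist W"
  shows "tmap t (\<sigma> i v) = \<sigma> (tperm t i) (tmap t v)"
  using form_twist_map[OF assms, of "simple_root i" v]
  by (simp add: simple_reflection_def linear_diff[OF twist_map_linear] linear_scale[OF twist_map_linear])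

lemma twist_map_refl_word:
  assumes "t \<in> twist W"
  shows "tmap t (refl_word xs v) = refl_word (map (tperm t) xs) (tmap t v)"
  by (induction xs) (simp_all add: twist_map_refl[OF assms])

text \<open>Moves an element of \<open>twist W\<close> past a word, by permuting its letters.\<close>

lemma word_twist:
  assumes "t \<in> twist W"
  shows "word (map (tperm t) xs) \<otimes> t = t \<otimes> word xs"
proof (induction xs)
  case (Cons i xs)
  have "word (map (tperm t) (i # xs)) \<otimes> t = t \<otimes> sref W i \<otimes> (inv t \<otimes> (t \<otimes> word xs))"
    using Cons twist_closed[OF assms] by (simp add: sref_twist_perm[OF assms] m_assoc)
  also have "\<dots> = t \<otimes> word (i # xs)"
    using twist_closed[OF assms] by (simp add: m_assoc)
  finally show ?case .
qed (use twist_closed[OF assms] in simp)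

lemma twist_map_mult:
  assumes "t \<in> twist W" "u \<in> twist W"
  shows "tmap (t \<otimes> u) v = tmap t (tmap u v)"
proof -
  have "tmap (t \<otimes> u) = tmap t \<circ> tmap u"
    using linear_compose[OF twist_map_linear twist_map_linear]
    by (intro linear_eq_on_simple[OF twist_map_linear]) (auto simp: twist_perm_mult[OF assms])
  then show ?thesis by simp
qed

lemma twist_map_one: "tmap \<one> = (\<lambda>v. v)"
  by (intro linear_eq_on_simple[OF twist_map_linear]) (simp_all add: twist_perm_one linear_ident)

lemma twist_word_cases:
  assumes "w \<in> carrier W"
  obtains t xs where "t \<in> twist W" "w = t \<otimes> word xs"
proof -
  from assms twist_mult_cox obtain t x where "t \<in> twist W" "x \<in> cox W" "w = t \<otimes> x"
    unfolding set_mult_def by blast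
  then show thesis using that cox_eq_words[of x] by metis
qed

text \<open>The element of \<open>twist W\<close> in such a product is unique because \<open>twist W\<close> meets \<open>cox W\<close> trivially, and
two words for the remaining factor act equally by \<open>refl_word_eq\<close>.\<close>

lemma act_twist_word:
  assumes "t \<in> twist W"
  shows "act W (t \<otimes> word xs) = tmap t \<circ> refl_word xs"
  unfolding act_def
proof (rule the_equality)
  show "\<exists>\<omega>\<in>twist W. \<exists>ys. t \<otimes> word xs = \<omega> \<otimes> word ys \<and>
      tmap t \<circ> refl_word xs = tmap \<omega> \<circ> foldr (\<lambda>i g. \<sigma> i \<circ> g) ys id"
    using assms unfolding refl_word_def by blast
next
  fix f
  assume "\<exists>\<omega>\<in>twist W. \<exists>ys. t \<otimes> word xs = \<omega> \<otimes> word ys \<and>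
      f = tmap \<omega> \<circ> foldr (\<lambda>i g. \<sigma> i \<circ> g) ys id"
  then obtain u ys where u: "u \<in> twist W" and eq: "t \<otimes> word xs = u \<otimes> word ys"
    and f: "f = tmap u \<circ> refl_word ys"
    unfolding refl_word_def by blast
  have tc: "t \<in> carrier W" and uc: "u \<in> carrier W"
    using assms u twist_closed by auto
  have "inv u \<otimes> t = word ys \<otimes> inv (word xs)"
  proof -
    have "inv u \<otimes> t = inv u \<otimes> (t \<otimes> word xs) \<otimes> inv (word xs)"
      using tc uc by (simp add: m_assoc)
    then show ?thesis using tc uc by (simp add: eq)
  qed
  moreover have "inv u \<otimes> t \<in> twist W"
    using assms u twist_subgroup by (simp add: subgroup.m_closed subgroup.m_inv_closed)
  moreover have "word ys \<otimes> inv (word xs) \<in> cox W"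
    using cox_subgroup by (simp add: subgroup.m_closed subgroup.m_inv_closed)
  ultimately have "inv u \<otimes> t = \<one>"
    using twist_int_cox by auto
  then have "t = u"
    using tc uc inv_cancel(2)[of u t] by simp
  moreover from this have "word xs = word ys"
    using eq uc by (metis inv_cancel(1) word_closed)
  ultimately show "f = tmap t \<circ> refl_word xs"
    using f refl_word_eq[of xs ys] by simp
qed

lemma act_word: "act W (word xs) = refl_word xs"
  using act_twist_word[OF subgroup.one_closed[OF twist_subgroup], of xs]
  by (simp add: twist_map_one o_def)

lemma act_twist: "t \<in> twist W \<Longrightarrow> act W t = tmap t"
  using act_twist_word[of t "[]"] twist_closed[of t] by (simp add: fun_eq_iff)

lemma act_one [simp]: "\<one> \<cdot> v = v"
  using act_word[of "[]"] by simp

lemma act_sref [simp]: "sref W i \<cdot> v = \<sigma> i v"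
  using act_word[of "[i]"] by simp

lemma act_mult:
  assumes "x \<in> carrier W" "y \<in> carrier W"
  shows "(x \<otimes> y) \<cdot> v = x \<cdot> y \<cdot> v"
proof -
  obtain t xs where t: "t \<in> twist W" and x: "x = t \<otimes> word xs"
    using twist_word_cases[OF assms(1)] .
  obtain u ys where u: "u \<in> twist W" and y: "y = u \<otimes> word ys"
    using twist_word_cases[OF assms(2)] .
  define u' where "u' = inv u"
  have u': "u' \<in> twist W"
    using u twist_subgroup by (simp add: u'_def subgroup.m_inv_closed)
  have tc: "t \<in> carrier W" "u \<in> carrier W" "u' \<in> carrier W"
    using t u u' twist_closed by auto
  define zs where "zs = map (tperm u') xs"
  have "map (tperm u) zs = xs"
    using u u' tc(2) by (simp add: zs_def u'_def o_def twist_perm_one flip: twist_perm_mult)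
  then have "word xs \<otimes> u = u \<otimes> word zs" and move: "refl_word xs (tmap u v) = tmap u (refl_word zs v)" for v
    using word_twist[OF u, of zs] twist_map_refl_word[OF u, of zs v] by auto
  then have "x \<otimes> y = (t \<otimes> u) \<otimes> word (zs @ ys)"
    unfolding x y using tc by (simp add: m_assoc[symmetric]) (simp add: m_assoc)
  then have "act W (x \<otimes> y) = tmap (t \<otimes> u) \<circ> refl_word (zs @ ys)"
    using act_twist_word[of "t \<otimes> u" "zs @ ys"] t u subgroup.m_closed[OF twist_subgroup] by simp
  then show ?thesis
    using t u by (simp add: x y act_twist_word twist_map_mult move)
qed

lemma act_inv [simp]: "x \<in> carrier W \<Longrightarrow> inv x \<cdot> x \<cdot> v = v"
  by (simp flip: act_mult)

lemma act_inv' [simp]: "x \<in> carrier W \<Longrightarrow> x \<cdot> inv x \<cdot> v = v"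
  by (simp flip: act_mult)

lemma act_linear:
  assumes "x \<in> carrier W"
  shows "linear (act W x)"
proof -
  obtain t xs where "t \<in> twist W" "x = t \<otimes> word xs"
    using twist_word_cases[OF assms] .
  then show ?thesis
    using linear_compose[OF refl_word_linear twist_map_linear] by (simp add: act_twist_word)
qed

lemma form_act [simp]:
  assumes "x \<in> carrier W"
  shows "form (x \<cdot> u) (x \<cdot> v) = form u v"
proof -
  obtain t xs where "t \<in> twist W" "x = t \<otimes> word xs"
    using twist_word_cases[OF assms] .
  then show ?thesis by (simp add: act_twist_word form_twist_map)
qed

section \<open>Positivity of roots\<close>

lemma cox_mult [simp]: "x \<in> cox W \<Longrightarrow> y \<in> cox W \<Longrightarrow> x \<otimes> y \<in> cox W"
  by (rule subgroup.m_closed[OF cox_subgroup])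

lemma cox_one [simp]: "\<one> \<in> cox W"
  by (rule subgroup.one_closed[OF cox_subgroup])

lemma word_rev [simp]: "word (rev xs) \<otimes> word xs = \<one>"
  by (induction xs) (simp_all add: m_assoc)

text \<open>The braid relation: the relator of length \<open>2 m\<close> is the inverse of one alternating word of length \<open>m\<close>
followed by the other one.\<close>

lemma word_alternating_braid:
  assumes "m i j \<noteq> 0"
  shows "word (alternating i j (m i j)) = word (alternating j i (m i j))"
proof -
  let ?k = "m i j"
  have "word (concat (replicate n [i, j])) = (sref W i \<otimes> sref W j) [^] n" for n
  proof (induction n)
    case (Suc n)
    have "(sref W i \<otimes> sref W j) [^] Suc n = (sref W i \<otimes> sref W j) \<otimes> (sref W i \<otimes> sref W j) [^] n"
      by (rule nat_pow_Suc2) simp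
    then show ?case using Suc by (simp add: m_assoc del: nat_pow_Suc)
  qed simp
  then have "word (alternating i j (2 * ?k)) = \<one>"
    by (simp add: coxeter_matrix_def flip: relator_alternating)
  moreover have "alternating i j (2 * ?k) = rev (alternating j i ?k) @ alternating i j ?k"
    by (simp add: alternating_add rev_alternating mult_2)
  ultimately have "word (rev (alternating j i ?k)) \<otimes> word (alternating i j ?k) = \<one>"
    by simp
  then have "word (rev (alternating j i ?k)) \<otimes> word (alternating i j ?k) =
      word (rev (alternating j i ?k)) \<otimes> word (alternating j i ?k)"
    by simp
  then show ?thesis
    by (simp del: word_rev)
qed

text \<open>Word length. It drives the induction for the positivity of roots, before inversions are available; \<open>len\<close> counts
inversions.\<close>

definition wlen :: "'a \<Rightarrow> nat" where
  "wlen x = (LEAST n. \<exists>xs. length xs = n \<and> word xs = x)"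

lemma wlen_word_le: "wlen (word xs) \<le> length xs"
  unfolding wlen_def by (rule Least_le) blast

lemma reduced_word:
  assumes "x \<in> cox W"
  obtains xs where "word xs = x" "length xs = wlen x"
proof -
  obtain ys where "x = word ys" using cox_eq_words[OF assms] .
  then have "\<exists>n xs. length xs = n \<and> word xs = x" by blast
  from LeastI_ex[OF this] show thesis
    using that unfolding wlen_def by blast
qed

lemma wlen_mult_word_le:
  assumes "x \<in> cox W"
  shows "wlen (x \<otimes> word ys) \<le> wlen x + length ys"
proof -
  obtain xs where "word xs = x" "length xs = wlen x"
    using reduced_word[OF assms] .
  then show ?thesis using wlen_word_le[of "xs @ ys"] by simp
qed

lemma last_letter:
  assumes "x \<in> cox W" "x \<noteq> \<one>"
  obtains y i where "y \<in> cox W" "x = y \<otimes> sref W i" "wlen x = Suc (wlen y)"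
proof -
  obtain xs where xs: "word xs = x" "length xs = wlen x"
    using reduced_word[OF assms(1)] .
  with assms(2) have "xs \<noteq> []" by auto
  then obtain zs i where zs: "xs = zs @ [i]"
    by (metis rev_exhaust)
  then have x: "x = word zs \<otimes> sref W i"
    using xs by simp
  moreover have "wlen x = Suc (wlen (word zs))"
    using xs zs wlen_word_le[of zs] wlen_mult_word_le[of "word zs" "[i]"] x by simp
  ultimately show thesis using that word_cox by blast
qed

text \<open>Split off from \<open>x\<close> the longest possible alternating word in \<open>i\<close> and \<open>j\<close> that ends in \<open>j\<close>, where \<open>j\<close> is the last letter of a
reduced word of \<open>x\<close>, so that \<open>x = v u\<close> with additive lengths. Maximality makes both \<open>v s\<^sub>i\<close> and \<open>v s\<^sub>j\<close> at
least as long as \<open>v\<close>, so \<open>v\<close> sends both simple roots to nonnegative vectors by induction. By the braid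
relation \<open>u\<close> is shorter than \<open>m i j\<close>, since \<open>x s\<^sub>i\<close> is not shorter than \<open>x\<close>; hence \<open>u\<close> sends
\<open>simple_root i\<close> to a nonnegative combination of the two simple roots.\<close>

lemma ascent_root_nonneg:
  assumes "x \<in> cox W" "wlen x \<le> wlen (x \<otimes> sref W i)"
  shows "0 \<le> (x \<cdot> simple_root i) $ l"
  using assms
proof (induction "wlen x" arbitrary: x i rule: less_induct)
  case (less x i)
  note x = less.prems(1)
  show ?case
  proof (cases "x = \<one>")
    case False
    obtain y j where y: "y \<in> cox W" "x = y \<otimes> sref W j" "wlen x = Suc (wlen y)"
      using last_letter[OF x False] .
    have "i \<noteq> j"
      using less.prems(2) y by (auto simp: cox_closed)
    define good where
      "good k \<longleftrightarrow> (\<exists>v\<in>cox W. x = v \<otimes> word (alternating i j k) \<and> wlen v + k = wlen x)" for k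
    have "good (Suc 0)"
      unfolding good_def using y by (intro bexI[of _ y]) simp_all
    moreover have good_le: "k \<le> wlen x" if "good k" for k
      using that by (auto simp: good_def)
    ultimately obtain k where k: "good k" "Suc 0 \<le> k" and greatest: "\<And>k'. good k' \<Longrightarrow> k' \<le> k"
      using GreatestI_nat[of good "Suc 0" "wlen x"] Greatest_le_nat[of good _ "wlen x"] by blast
    obtain v where v: "v \<in> cox W" "x = v \<otimes> word (alternating i j k)" "wlen v + k = wlen x"
      using k(1) by (auto simp: good_def)
    have vc: "v \<in> carrier W" using v(1) cox_closed by simp
    define p where "p = (if even k then j else i)"
    define q where "q = (if even k then i else j)"
    \<comment> \<open>\<open>p\<close> would be the next letter in front of the alternating word, \<open>q\<close> is its current first letter.\<close>
    have "wlen v \<le> wlen (v \<otimes> sref W p)"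
    proof (rule ccontr)
      assume less: "\<not> ?thesis"
      have eq: "x = (v \<otimes> sref W p) \<otimes> word (alternating i j (Suc k))"
        using v vc by (simp add: p_def m_assoc)
      moreover have "wlen (v \<otimes> sref W p) + Suc k = wlen x"
        using less v wlen_mult_word_le[of "v \<otimes> sref W p" "alternating i j (Suc k)"]
        by (simp add: eq[symmetric] del: alternating.simps)
      ultimately have "good (Suc k)"
        unfolding good_def using v(1) by (intro bexI[of _ "v \<otimes> sref W p"]) auto
      then show False using greatest[of "Suc k"] by simp
    qed
    then have pos_p: "0 \<le> (v \<cdot> simple_root p) $ l"
      using less.hyps[of v p] v k by simp
    obtain k' where k': "k = Suc k'" using k(2) by (cases k) auto
    have "wlen v \<le> wlen (v \<otimes> sref W q)"
    proof -
      have "x = (v \<otimes> sref W q) \<otimes> word (alternating i j k')"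
        using v vc by (simp add: k' q_def m_assoc)
      then have "wlen x \<le> wlen (v \<otimes> sref W q) + k'"
        using wlen_mult_word_le[of "v \<otimes> sref W q" "alternating i j k'"] v(1) by simp
      then show ?thesis using v(3) k' by simp
    qed
    then have pos_q: "0 \<le> (v \<cdot> simple_root q) $ l"
      using less.hyps[of v q] v k by simp
    have "m i j = 0 \<or> Suc k \<le> m i j"
    proof (rule ccontr)
      assume contr: "\<not> ?thesis"
      then obtain n where n: "m i j = Suc n" by (cases "m i j") auto
      have km: "k - m i j + m i j = k" using contr by simp
      define zs where
        "zs = (if even (m i j) then alternating i j (k - m i j) else alternating j i (k - m i j))"
      have zs: "alternating i j k = zs @ alternating i j (m i j)" "length zs = k - m i j"
        using alternating_add[of i j "k - m i j" "m i j", unfolded km] by (simp_all add: zs_def)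
      have "x = v \<otimes> (word zs \<otimes> word (alternating j i (m i j)))"
        using v zs word_alternating_braid[of i j] contr by simp
      also have "alternating j i (m i j) = alternating i j n @ [i]"
        by (simp only: n alternating_snoc)
      finally have "x \<otimes> sref W i = v \<otimes> word (zs @ alternating i j n)"
        using vc by (simp add: m_assoc)
      then have "wlen (x \<otimes> sref W i) \<le> wlen v + (k - m i j + n)"
        using wlen_mult_word_le[OF v(1), of "zs @ alternating i j n"] zs by simp
      also have "\<dots> < wlen x"
        using contr n v(3) by simp
      finally show False using less.prems(2) by simp
    qed
    then have "0 \<le> cheb (cheb_coeff i j) (Suc k)" "0 \<le> cheb (cheb_coeff i j) k"
      using cheb_coeff_nonneg[OF \<open>i \<noteq> j\<close>] by auto
    moreover have "x \<cdot> simple_root i = cheb (cheb_coeff i j) (Suc k) *\<^sub>R (v \<cdot> simple_root q) +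
        cheb (cheb_coeff i j) k *\<^sub>R (v \<cdot> simple_root p)"
      using linear_add[OF act_linear[OF vc]] linear_scale[OF act_linear[OF vc]]
      by (simp add: v(2) act_mult vc act_word refl_word_alternating p_def q_def del: cheb.simps)
    ultimately show ?thesis
      using pos_p pos_q by simp
  qed (simp add: simple_root_nth)
qed

section \<open>Positive roots and inversions\<close>

abbreviation R :: "(real ^ 'i) set" where
  "R \<equiv> roots W"

abbreviation P :: "(real ^ 'i) set" where
  "P \<equiv> pos_roots W"

lemma pos_roots_iff: "\<beta> \<in> P \<longleftrightarrow> \<beta> \<in> R \<and> (\<forall>i. 0 \<le> \<beta> $ i)"
  by (simp add: pos_roots_def)

lemma pos_imp_root: "\<beta> \<in> P \<Longrightarrow> \<beta> \<in> R"
  by (simp add: pos_roots_def)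

lemma rootsI: "x \<in> cox W \<Longrightarrow> x \<cdot> simple_root i \<in> R"
  by (auto simp: roots_def)

lemma simple_root_in_roots [simp]: "simple_root i \<in> R"
  using rootsI[of \<one> i] by simp

lemma simple_root_pos [simp]: "simple_root i \<in> P"
  by (simp add: pos_roots_iff simple_root_nth)

lemma conj_cox: "x \<in> carrier W \<Longrightarrow> y \<in> cox W \<Longrightarrow> x \<otimes> y \<otimes> inv x \<in> cox W"
  using normal.inv_op_closed2[OF cox_normal] .

text \<open>An element of \<open>twist W\<close> permutes the simple roots, so it can be moved to the right until it is absorbed by
the simple root.\<close>

lemma act_roots:
  assumes "x \<in> carrier W" "\<beta> \<in> R"
  shows "x \<cdot> \<beta> \<in> R"
proof -
  obtain y i where y: "y \<in> cox W" "\<beta> = y \<cdot> simple_root i"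
    using assms(2) by (auto simp: roots_def)
  obtain t xs where t: "t \<in> twist W" "x = t \<otimes> word xs"
    using twist_word_cases[OF assms(1)] .
  define z where "z = t \<otimes> (word xs \<otimes> y) \<otimes> inv t"
  have z: "z \<in> cox W"
    unfolding z_def using y t twist_closed by (intro conj_cox) auto
  have "z \<cdot> simple_root (tperm t i) = x \<cdot> \<beta>"
    using t y twist_closed[OF t(1)]
    by (simp add: z_def act_mult cox_closed act_twist flip: twist_map_simple)
      (simp flip: act_twist)
  then show ?thesis using rootsI[OF z, of "tperm t i"] by simp
qed

lemma uminus_root_iff [simp]: "- \<beta> \<in> R \<longleftrightarrow> \<beta> \<in> R"
proof -
  have "- \<beta> \<in> R" if root: "\<beta> \<in> R" for \<beta>
  proof -
    obtain y i where y: "y \<in> cox W" "\<beta> = y \<cdot> simple_root i"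
      using root by (auto simp: roots_def)
    have "(y \<otimes> sref W i) \<cdot> simple_root i = - \<beta>"
      using y by (simp add: act_mult cox_closed linear_neg[OF act_linear])
    then show ?thesis using y rootsI[of "y \<otimes> sref W i" i] by simp
  qed
  from this[of \<beta>] this[of "- \<beta>"] show ?thesis by auto
qed

lemma form_root [simp]: "\<beta> \<in> R \<Longrightarrow> form \<beta> \<beta> = 1"
  by (auto simp: roots_def cox_closed)

text \<open>Let \<open>\<beta>\<close> be the image of \<open>simple_root i\<close> under \<open>x\<close>. Either \<open>ascent_root_nonneg\<close> applies to \<open>x\<close>, or
\<open>x s\<^sub>i\<close> is shorter than \<open>x\<close> and it applies to \<open>x s\<^sub>i\<close>, which sends \<open>simple_root i\<close> to \<open>- \<beta>\<close>.\<close>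

lemma uminus_pos_iff:
  assumes "\<beta> \<in> R"
  shows "- \<beta> \<in> P \<longleftrightarrow> \<beta> \<notin> P"
proof
  assume "- \<beta> \<in> P"
  show "\<beta> \<notin> P"
  proof
    assume "\<beta> \<in> P"
    with \<open>- \<beta> \<in> P\<close> have "\<beta> = 0"
      by (auto simp: pos_roots_iff vec_eq_iff antisym)
    with form_root[OF assms] show False by (simp add: form_simps)
  qed
next
  assume "\<beta> \<notin> P"
  obtain y i where y: "y \<in> cox W" "\<beta> = y \<cdot> simple_root i"
    using assms by (auto simp: roots_def)
  have yc: "y \<in> carrier W" using y cox_closed by simp
  have "\<not> wlen y \<le> wlen (y \<otimes> sref W i)"
    using ascent_root_nonneg[OF y(1)] y(2) \<open>\<beta> \<notin> P\<close> assms by (auto simp: pos_roots_iff)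
  then have "0 \<le> ((y \<otimes> sref W i) \<cdot> simple_root i) $ l" for l
    using ascent_root_nonneg[of "y \<otimes> sref W i" i] y yc by simp
  then have "0 \<le> (- \<beta>) $ l" for l
    using y yc by (simp add: act_mult linear_neg[OF act_linear])
  then show "- \<beta> \<in> P"
    using assms by (simp only: pos_roots_iff uminus_root_iff) simp
qed

lemma neg_roots_iff: "\<beta> \<in> neg_roots W \<longleftrightarrow> \<beta> \<in> R \<and> \<beta> \<notin> P"
  using uminus_pos_iff[of \<beta>] by (auto simp: neg_roots_def pos_roots_iff)

lemma inversions_iff:
  assumes "w \<in> carrier W"
  shows "\<beta> \<in> inversions W w \<longleftrightarrow> \<beta> \<in> P \<and> w \<cdot> \<beta> \<notin> P"
  using assms by (auto simp: inversions_def neg_roots_iff act_roots pos_imp_root)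

lemma act_uminus: "x \<in> carrier W \<Longrightarrow> x \<cdot> (- v) = - (x \<cdot> v)"
  by (simp add: linear_neg[OF act_linear])

lemma pos_root_multiple:
  assumes "\<beta> \<in> P" "\<And>k. k \<noteq> i \<Longrightarrow> \<beta> $ k = 0"
  shows "\<beta> = simple_root i"
proof -
  have b: "\<beta> = (\<beta> $ i) *\<^sub>R simple_root i"
    using assms(2) by (auto simp: vec_eq_iff simple_root_nth)
  have "form \<beta> \<beta> = 1" using assms(1) pos_imp_root by simp
  then have "(\<beta> $ i)\<^sup>2 = 1"
    by (subst (asm) (1 2) b) (simp add: form_simps power2_eq_square)
  moreover have "0 \<le> \<beta> $ i" using assms(1) by (simp add: pos_roots_iff)
  ultimately have "\<beta> $ i = 1" by (simp add: power2_eq_1_iff)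
  then show ?thesis using b by simp
qed

lemma refl_root [simp]: "\<beta> \<in> R \<Longrightarrow> \<sigma> i \<beta> \<in> R"
  using act_roots[of "sref W i" \<beta>] by simp

text \<open>A simple reflection changes only one coordinate, and a positive root that is not simple has another nonzero
coordinate, which keeps its sign.\<close>

lemma refl_pos:
  assumes "\<beta> \<in> P" "\<beta> \<noteq> simple_root i"
  shows "\<sigma> i \<beta> \<in> P"
proof -
  obtain k where k: "k \<noteq> i" "\<beta> $ k \<noteq> 0"
    using pos_root_multiple[OF assms(1), of i] assms(2) by auto
  have "(\<sigma> i \<beta>) $ k = \<beta> $ k"
    using k by (simp add: simple_reflection_def simple_root_nth)
  moreover have "0 < \<beta> $ k"
    using assms(1) k by (simp add: pos_roots_iff order_less_le)
  ultimately have "\<not> 0 \<le> (- \<sigma> i \<beta>) $ k"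
    by simp
  then have "- \<sigma> i \<beta> \<notin> P"
    unfolding pos_roots_iff by blast
  then show ?thesis
    using uminus_pos_iff[of "\<sigma> i \<beta>"] assms(1) pos_imp_root by simp
qed

lemma refl_uminus: "\<sigma> i (- v) = - \<sigma> i v"
  by (simp add: linear_neg[OF refl_linear])

lemma refl_pos_iff:
  assumes "\<beta> \<in> R" "\<beta> \<noteq> simple_root i" "\<beta> \<noteq> - simple_root i"
  shows "\<sigma> i \<beta> \<in> P \<longleftrightarrow> \<beta> \<in> P"
proof (cases "\<beta> \<in> P")
  case False
  then have "- \<beta> \<in> P" using assms(1) by (simp add: uminus_pos_iff)
  moreover have "- \<beta> \<noteq> simple_root i" using assms(3) by (metis minus_minus)
  ultimately have "\<sigma> i (- \<beta>) \<in> P" by (rule refl_pos)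
  then show ?thesis using False uminus_pos_iff[of "\<sigma> i \<beta>"] assms(1) by (simp add: refl_uminus)
qed (use refl_pos assms in auto)

lemma twist_pos:
  assumes "t \<in> twist W" "\<beta> \<in> P"
  shows "t \<cdot> \<beta> \<in> P"
proof -
  have "0 \<le> (tmap t \<beta>) $ k" for k
    using assms(2) by (auto simp: twist_map_def pos_roots_iff simple_root_nth intro!: sum_nonneg)
  then show ?thesis
    using assms act_roots[of t \<beta>] twist_closed[of t] by (simp add: pos_roots_iff act_twist)
qed

lemma finite_inversions:
  assumes "w \<in> carrier W"
  shows "finite (inversions W w)"
proof -
  obtain t xs where t: "t \<in> twist W" and w: "w = t \<otimes> word xs"
    using twist_word_cases[OF assms] .
  have tc: "t \<in> carrier W" using t twist_closed by simp
  have "finite (inversions W (t \<otimes> word xs))"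
  proof (induction xs rule: rev_induct)
    case Nil
    have "inversions W t = {}"
      using twist_pos[OF t] by (auto simp: inversions_iff[OF tc])
    then show ?case using tc by simp
  next
    case (snoc i xs)
    let ?w = "t \<otimes> word xs"
    have "inversions W (?w \<otimes> sref W i) \<subseteq> insert (simple_root i) (\<sigma> i ` inversions W ?w)"
    proof
      fix \<beta> assume "\<beta> \<in> inversions W (?w \<otimes> sref W i)"
      then have b: "\<beta> \<in> P" "?w \<cdot> \<sigma> i \<beta> \<notin> P"
        using tc by (auto simp: inversions_iff act_mult[of ?w])
      show "\<beta> \<in> insert (simple_root i) (\<sigma> i ` inversions W ?w)"
      proof (cases "\<beta> = simple_root i")
        case False
        then have "\<sigma> i \<beta> \<in> inversions W ?w"
          using b tc refl_pos by (simp add: inversions_iff)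
        then have "\<sigma> i (\<sigma> i \<beta>) \<in> \<sigma> i ` inversions W ?w" by (rule imageI)
        then show ?thesis by simp
      qed simp
    qed
    then have "finite (inversions W (?w \<otimes> sref W i))"
      using snoc finite_subset by blast
    then show ?case using tc by (simp add: m_assoc)
  qed
  then show ?thesis by (simp add: w)
qed

text \<open>The last letter of a nonempty reduced word is a descent. In particular the reflection representation of
\<open>cox W\<close> is faithful.\<close>

lemma cox_no_descent_one:
  assumes "x \<in> cox W" "\<And>i. x \<cdot> simple_root i \<in> P"
  shows "x = \<one>"
proof (rule ccontr)
  assume "x \<noteq> \<one>"
  then obtain y i where y: "y \<in> cox W" "x = y \<otimes> sref W i" "wlen x = Suc (wlen y)"
    using last_letter[OF assms(1)] by blast
  have yc: "y \<in> carrier W" using y cox_closed by simp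
  have "y \<cdot> simple_root i \<in> P"
    using ascent_root_nonneg[OF y(1), of i] y yc by (simp add: pos_roots_iff act_roots)
  then have "- (x \<cdot> simple_root i) \<in> P"
    using y yc by (simp add: act_mult act_uminus)
  then show False
    using assms(2)[of i] uminus_pos_iff pos_imp_root by blast
qed

text \<open>The form is invariant, so conjugation of a reflection moves its root.\<close>

lemma act_conj_sref:
  assumes "x \<in> carrier W"
  shows "(x \<otimes> sref W i \<otimes> inv x) \<cdot> v = v - (2 * form (x \<cdot> simple_root i) v) *\<^sub>R (x \<cdot> simple_root i)"
proof -
  have "form (x \<cdot> simple_root i) v = form (simple_root i) (inv x \<cdot> v)"
    using form_act[OF assms, of "simple_root i" "inv x \<cdot> v"] assms by simp
  then show ?thesis
    using assms by (simp add: act_mult simple_reflection_def linear_diff[OF act_linear] linear_scale[OF act_linear])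
qed

lemma conj_sref_eq:
  assumes "w \<in> carrier W" "w \<cdot> simple_root i = simple_root j \<or> w \<cdot> simple_root i = - simple_root j"
  shows "w \<otimes> sref W i \<otimes> inv w = sref W j"
proof -
  let ?y = "w \<otimes> sref W i \<otimes> inv w"
  have y: "?y \<in> cox W" using conj_cox[OF assms(1)] by simp
  have "?y \<cdot> v = \<sigma> j v" for v
    using assms(2) by (auto simp: act_conj_sref[OF assms(1)] simple_reflection_def form_simps)
  then have "(?y \<otimes> sref W j) \<cdot> simple_root l = simple_root l" for l
    using y by (simp add: act_mult cox_closed)
  then have "?y \<otimes> sref W j = \<one>"
    using y by (intro cox_no_descent_one) auto
  then show ?thesis
    using y inv_equality[of ?y "sref W j"] by (simp add: cox_closed)
qed

section \<open>Lengths of products and of conjugates\<close>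

text \<open>Shifting the inversions of \<open>a b\<close> by \<open>b\<close> puts them in a form in which \<open>a\<close> and \<open>b\<close> can be varied separately;
lengths of different products then become sizes of comparable sets.\<close>

lemma inversions_mult_image:
  assumes "a \<in> carrier W" "b \<in> carrier W"
  shows "act W b ` inversions W (a \<otimes> b) = {\<delta> \<in> R. inv b \<cdot> \<delta> \<in> P \<and> a \<cdot> \<delta> \<notin> P}"
proof (intro equalityI subsetI)
  fix \<delta> assume "\<delta> \<in> act W b ` inversions W (a \<otimes> b)"
  then show "\<delta> \<in> {\<delta> \<in> R. inv b \<cdot> \<delta> \<in> P \<and> a \<cdot> \<delta> \<notin> P}"
    using assms by (auto simp: inversions_iff act_mult act_roots pos_imp_root)
next
  fix \<delta> assume "\<delta> \<in> {\<delta> \<in> R. inv b \<cdot> \<delta> \<in> P \<and> a \<cdot> \<delta> \<notin> P}"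
  then have "inv b \<cdot> \<delta> \<in> inversions W (a \<otimes> b)"
    using assms by (auto simp: inversions_iff act_mult)
  then have "b \<cdot> inv b \<cdot> \<delta> \<in> act W b ` inversions W (a \<otimes> b)" by (rule imageI)
  then show "\<delta> \<in> act W b ` inversions W (a \<otimes> b)" using assms by simp
qed

lemma act_inj: "x \<in> carrier W \<Longrightarrow> inj (act W x)"
  by (rule inj_on_inverseI[of _ "act W (inv x)"]) simp

lemma len_mult:
  assumes "a \<in> carrier W" "b \<in> carrier W"
  shows "len W (a \<otimes> b) = card {\<delta> \<in> R. inv b \<cdot> \<delta> \<in> P \<and> a \<cdot> \<delta> \<notin> P}"
  unfolding len_def inversions_mult_image[OF assms, symmetric]
  using act_inj[OF assms(2)] by (metis card_image inj_on_subset subset_UNIV)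

lemma finite_crossings:
  assumes "a \<in> carrier W" "b \<in> carrier W"
  shows "finite {\<delta> \<in> R. inv b \<cdot> \<delta> \<in> P \<and> a \<cdot> \<delta> \<notin> P}"
  unfolding inversions_mult_image[OF assms, symmetric]
  using assms by (intro finite_imageI finite_inversions) simp

lemma len_mult_le:
  assumes "a \<in> carrier W" "b \<in> carrier W" "c \<in> carrier W" "d \<in> carrier W"
    and "\<And>\<delta>. \<delta> \<in> R \<Longrightarrow> inv b \<cdot> \<delta> \<in> P \<Longrightarrow> a \<cdot> \<delta> \<notin> P \<Longrightarrow> inv d \<cdot> \<delta> \<in> P \<and> c \<cdot> \<delta> \<notin> P"
  shows "len W (a \<otimes> b) \<le> len W (c \<otimes> d)"
  unfolding len_mult[OF assms(1,2)] len_mult[OF assms(3,4)]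
  using assms(5) by (intro card_mono finite_crossings[OF assms(3,4)]) auto

lemma len_mult_less:
  assumes "a \<in> carrier W" "b \<in> carrier W" "c \<in> carrier W" "d \<in> carrier W"
    and "\<And>\<delta>. \<delta> \<in> R \<Longrightarrow> inv b \<cdot> \<delta> \<in> P \<Longrightarrow> a \<cdot> \<delta> \<notin> P \<Longrightarrow> inv d \<cdot> \<delta> \<in> P \<and> c \<cdot> \<delta> \<notin> P"
    and "\<gamma> \<in> R" "inv d \<cdot> \<gamma> \<in> P" "c \<cdot> \<gamma> \<notin> P" "inv b \<cdot> \<gamma> \<notin> P \<or> a \<cdot> \<gamma> \<in> P"
  shows "len W (a \<otimes> b) < len W (c \<otimes> d)"
  unfolding len_mult[OF assms(1,2)] len_mult[OF assms(3,4)]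
  using assms(5-) by (intro psubset_card_mono finite_crossings[OF assms(3,4)]) blast

lemma len_mult_sref_ascent:
  assumes "w \<in> carrier W" "w \<cdot> simple_root j \<in> P"
  shows "len W w < len W (w \<otimes> sref W j)"
proof -
  have "len W (w \<otimes> \<one>) < len W (w \<otimes> sref W j)"
  proof (rule len_mult_less[where \<gamma> = "- simple_root j"])
    fix \<delta> assume d: "\<delta> \<in> R" "inv \<one> \<cdot> \<delta> \<in> P" "w \<cdot> \<delta> \<notin> P"
    then show "inv sref W j \<cdot> \<delta> \<in> P \<and> w \<cdot> \<delta> \<notin> P"
      using assms(2) refl_pos[of \<delta> j] by auto
  qed (use assms uminus_pos_iff[of "simple_root j"] uminus_pos_iff[of "w \<cdot> simple_root j"]
      in \<open>auto simp: refl_uminus act_uminus act_roots\<close>)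
  then show ?thesis using assms by simp
qed

lemma len_mult_sref_descent:
  assumes "w \<in> carrier W" "w \<cdot> simple_root j \<notin> P"
  shows "len W (w \<otimes> sref W j) < len W w"
proof -
  have "(w \<otimes> sref W j) \<cdot> simple_root j \<in> P"
    using assms uminus_pos_iff[of "w \<cdot> simple_root j"] by (simp add: act_mult act_uminus act_roots)
  then show ?thesis
    using len_mult_sref_ascent[of "w \<otimes> sref W j" j] assms by simp
qed

lemma len_mult_sref_iff:
  assumes "w \<in> carrier W"
  shows "len W w < len W (w \<otimes> sref W j) \<longleftrightarrow> w \<cdot> simple_root j \<in> P"
    and "len W (w \<otimes> sref W j) < len W w \<longleftrightarrow> w \<cdot> simple_root j \<notin> P"
  using len_mult_sref_ascent[OF assms, of j] len_mult_sref_descent[OF assms, of j] by fastforce+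

lemma len_sref_mult_ascent:
  assumes "w \<in> carrier W" "inv w \<cdot> simple_root j \<in> P"
  shows "len W w < len W (sref W j \<otimes> w)"
proof -
  have "len W (\<one> \<otimes> w) < len W (sref W j \<otimes> w)"
  proof (rule len_mult_less[where \<gamma> = "simple_root j"])
    fix \<delta> assume d: "\<delta> \<in> R" "inv w \<cdot> \<delta> \<in> P" "\<one> \<cdot> \<delta> \<notin> P"
    have "\<delta> \<noteq> - simple_root j"
      using d assms uminus_pos_iff[of "inv w \<cdot> simple_root j"] by (auto simp: act_uminus act_roots)
    moreover have "\<delta> \<noteq> simple_root j" using d(3) by auto
    ultimately show "inv w \<cdot> \<delta> \<in> P \<and> sref W j \<cdot> \<delta> \<notin> P"
      using d by (simp add: refl_pos_iff)
  qed (use assms uminus_pos_iff[of "simple_root j"] in auto)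
  then show ?thesis using assms by simp
qed

text \<open>The roots whose sign is changed by \<open>w\<close>, where signs are taken with respect to the positive system
\<open>x\<^sup>-\<^sup>1 P\<close>. Counting both members of \<open>\<plusminus> \<gamma>\<close>, rather than inversions only, makes the sets for different \<open>x\<close>
comparable by inclusion.\<close>

definition switched :: "'a \<Rightarrow> 'a \<Rightarrow> (real ^ 'i) set" where
  "switched x w = {\<gamma> \<in> R. x \<cdot> \<gamma> \<in> P \<longleftrightarrow> x \<cdot> w \<cdot> \<gamma> \<notin> P}"

text \<open>The roots in the set with \<open>x \<gamma>\<close> positive are the inversions of \<open>x w x\<^sup>-\<^sup>1\<close> shifted by \<open>x\<^sup>-\<^sup>1\<close>; the others are their
negatives.\<close>

lemma switched_conj:
  assumes "x \<in> carrier W" "w \<in> carrier W"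
  shows "finite (switched x w)" "card (switched x w) = 2 * len W (x \<otimes> w \<otimes> inv x)"
proof -
  define C where "C = {\<gamma> \<in> R. x \<cdot> \<gamma> \<in> P \<and> x \<cdot> w \<cdot> \<gamma> \<notin> P}"
  have C: "finite C" "len W (x \<otimes> w \<otimes> inv x) = card C"
    using finite_crossings[of "x \<otimes> w" "inv x"] len_mult[of "x \<otimes> w" "inv x"] assms
    by (simp_all add: C_def act_mult)
  have neg: "x \<cdot> (- \<gamma>) \<in> P \<longleftrightarrow> x \<cdot> \<gamma> \<notin> P" "x \<cdot> w \<cdot> (- \<gamma>) \<in> P \<longleftrightarrow> x \<cdot> w \<cdot> \<gamma> \<notin> P"
    if "\<gamma> \<in> R" for \<gamma>
    using that assms by (simp_all add: act_uminus uminus_pos_iff act_roots)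
  have "uminus ` C = {\<gamma> \<in> R. x \<cdot> \<gamma> \<notin> P \<and> x \<cdot> w \<cdot> \<gamma> \<in> P}"
  proof (intro equalityI subsetI)
    fix \<gamma> assume "\<gamma> \<in> {\<gamma> \<in> R. x \<cdot> \<gamma> \<notin> P \<and> x \<cdot> w \<cdot> \<gamma> \<in> P}"
    then have "- \<gamma> \<in> C" using neg[of \<gamma>] by (auto simp: C_def)
    then have "- (- \<gamma>) \<in> uminus ` C" by (rule imageI)
    then show "\<gamma> \<in> uminus ` C" by simp
  qed (use neg in \<open>auto simp: C_def\<close>)
  then have eq: "switched x w = C \<union> uminus ` C" and "C \<inter> uminus ` C = {}"
    by (auto simp: switched_def C_def)
  then show "finite (switched x w)" "card (switched x w) = 2 * len W (x \<otimes> w \<otimes> inv x)"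
    using C by (simp_all add: card_Un_disjoint card_image)
qed

lemma len_conj_mono:
  assumes "x \<in> carrier W" "y \<in> carrier W" "w \<in> carrier W" "switched x w \<subseteq> switched y w"
  shows "len W (x \<otimes> w \<otimes> inv x) \<le> len W (y \<otimes> w \<otimes> inv y)"
  using card_mono[OF switched_conj(1)[OF assms(2,3)] assms(4)] assms by (simp add: switched_conj(2))

lemma len_conj_strict_mono:
  assumes "x \<in> carrier W" "y \<in> carrier W" "w \<in> carrier W" "switched x w \<subset> switched y w"
  shows "len W (x \<otimes> w \<otimes> inv x) < len W (y \<otimes> w \<otimes> inv y)"
  using psubset_card_mono[OF switched_conj(1)[OF assms(2,3)] assms(4)] assms
  by (simp add: switched_conj(2))

section \<open>Conjugating an involution by a simple reflection\<close>

lemma involution_closed: "involution W w \<Longrightarrow> w \<in> carrier W"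
  by (simp add: involution_def)

lemma involution_inv: "involution W w \<Longrightarrow> inv w = w"
  by (auto simp: involution_def intro: inv_equality)

lemma involution_act [simp]: "involution W w \<Longrightarrow> w \<cdot> w \<cdot> v = v"
  by (simp add: involution_def flip: act_mult)

lemma conj_simple_closed: "w \<in> carrier W \<Longrightarrow> conj_simple W j w \<in> carrier W"
  by (simp add: conj_simple_def)

lemma conj_simple_involution:
  assumes "involution W w"
  shows "involution W (conj_simple W j w)"
proof -
  have "w \<otimes> (w \<otimes> sref W j) = sref W j"
    using assms by (simp add: involution_def flip: m_assoc)
  then show ?thesis
    using assms by (simp add: involution_def conj_simple_def m_assoc)
qed

lemma conj_simple_conj_simple [simp]:
  "w \<in> carrier W \<Longrightarrow> conj_simple W j (conj_simple W j w) = w"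
  by (simp add: conj_simple_def m_assoc)

lemma conj_simple_fixed:
  assumes "involution W w" "w \<cdot> simple_root j = simple_root j \<or> w \<cdot> simple_root j = - simple_root j"
  shows "conj_simple W j w = w"
proof -
  have wc: "w \<in> carrier W" using assms involution_closed by simp
  have "w \<otimes> sref W j \<otimes> inv w = sref W j"
    using conj_sref_eq[OF wc assms(2)] .
  then have "sref W j \<otimes> w \<otimes> sref W j = (w \<otimes> sref W j \<otimes> inv w) \<otimes> w \<otimes> sref W j" by simp
  also have "\<dots> = w" using wc by (simp add: m_assoc)
  finally show ?thesis by (simp add: conj_simple_def)
qed

text \<open>The positive systems \<open>P\<close> and \<open>s\<^sub>j P\<close> differ only in \<open>\<plusminus> \<alpha>\<^sub>j\<close>, and none of \<open>\<plusminus> \<alpha>\<^sub>j\<close>, \<open>\<plusminus> w \<alpha>\<^sub>j\<close> changes its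
sign under \<open>w\<close> with respect to \<open>P\<close>. With respect to \<open>s\<^sub>j P\<close> the root \<open>\<alpha>\<^sub>j\<close> does.\<close>

lemma conj_simple_ascent:
  assumes "involution W w" "w \<cdot> simple_root j \<in> P" "w \<cdot> simple_root j \<noteq> simple_root j"
  shows "len W w < len W (conj_simple W j w)"
proof -
  have wc: "w \<in> carrier W" using assms involution_closed by simp
  let ?\<alpha> = "simple_root j"
  have neg: "w \<cdot> (- ?\<alpha>) \<notin> P" "- ?\<alpha> \<notin> P"
    using assms(2) wc uminus_pos_iff[of "w \<cdot> ?\<alpha>"] uminus_pos_iff[of ?\<alpha>]
    by (auto simp: act_uminus act_roots)
  have "switched \<one> w \<subseteq> switched (sref W j) w"
  proof
    fix \<gamma> assume g: "\<gamma> \<in> switched \<one> w"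
    then have r: "\<gamma> \<in> R" "w \<cdot> \<gamma> \<in> R" and s: "\<gamma> \<in> P \<longleftrightarrow> w \<cdot> \<gamma> \<notin> P"
      using wc by (auto simp: switched_def act_roots)
    have "\<gamma> \<noteq> ?\<alpha>" "\<gamma> \<noteq> - ?\<alpha>"
      using s neg assms(2) by auto
    moreover have "w \<cdot> \<gamma> \<noteq> ?\<alpha>" "w \<cdot> \<gamma> \<noteq> - ?\<alpha>"
      using s neg assms(2) involution_act[OF assms(1), of \<gamma>] by auto
    ultimately show "\<gamma> \<in> switched (sref W j) w"
      using s r by (simp add: switched_def refl_pos_iff)
  qed
  moreover have "?\<alpha> \<in> switched (sref W j) w - switched \<one> w"
    using neg refl_pos[OF assms(2,3)] assms(2) by (simp add: switched_def)
  ultimately have "len W (\<one> \<otimes> w \<otimes> inv \<one>) < len W (sref W j \<otimes> w \<otimes> inv sref W j)"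
    using wc by (intro len_conj_strict_mono) auto
  then show ?thesis using wc by (simp add: conj_simple_def)
qed

text \<open>The conjugate satisfies the hypotheses of \<open>conj_simple_ascent\<close>, and conjugating it again gives \<open>w\<close> back.\<close>

lemma conj_simple_descent:
  assumes "involution W w" "w \<cdot> simple_root j \<notin> P" "w \<cdot> simple_root j \<noteq> - simple_root j"
  shows "len W (conj_simple W j w) < len W w"
proof -
  have wc: "w \<in> carrier W" using assms involution_closed by simp
  let ?\<alpha> = "simple_root j"
  have eq: "conj_simple W j w \<cdot> ?\<alpha> = \<sigma> j (- (w \<cdot> ?\<alpha>))"
    using wc by (simp add: conj_simple_def act_mult act_uminus refl_uminus)
  have "- (w \<cdot> ?\<alpha>) \<in> P"
    using assms(2) wc by (simp add: uminus_pos_iff act_roots)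
  moreover have "- (w \<cdot> ?\<alpha>) \<noteq> ?\<alpha>"
    using assms(3) by (metis minus_minus)
  ultimately have "conj_simple W j w \<cdot> ?\<alpha> \<in> P"
    unfolding eq by (rule refl_pos)
  moreover have "conj_simple W j w \<cdot> ?\<alpha> \<noteq> ?\<alpha>"
  proof
    assume "conj_simple W j w \<cdot> ?\<alpha> = ?\<alpha>"
    then have "\<sigma> j (\<sigma> j (w \<cdot> ?\<alpha>)) = \<sigma> j (- ?\<alpha>)"
      by (simp add: eq refl_uminus minus_equation_iff[of "\<sigma> j (w \<cdot> ?\<alpha>)"])
    then show False using assms(2) by (simp add: refl_uminus)
  qed
  ultimately have "len W (conj_simple W j w) < len W (conj_simple W j (conj_simple W j w))"
    by (intro conj_simple_ascent conj_simple_involution assms)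
  then show ?thesis using wc by simp
qed

section \<open>Standard parabolic subgroups and their roots\<close>

lemma parabolic_words:
  assumes "x \<in> parabolic W K"
  obtains xs where "set xs \<subseteq> K" "x = word xs"
  using generate_sref_eq_words[of x K] assms by (auto simp: parabolic_def)

lemma parabolic_subgroup: "subgroup (parabolic W K) W"
  unfolding parabolic_def by (rule generate_is_subgroup) auto

lemma parabolic_one [simp]: "\<one> \<in> parabolic W K"
  by (rule subgroup.one_closed[OF parabolic_subgroup])

lemma parabolic_mult: "x \<in> parabolic W K \<Longrightarrow> y \<in> parabolic W K \<Longrightarrow> x \<otimes> y \<in> parabolic W K"
  by (rule subgroup.m_closed[OF parabolic_subgroup])

lemma parabolic_inv: "x \<in> parabolic W K \<Longrightarrow> inv x \<in> parabolic W K"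
  by (rule subgroup.m_inv_closed[OF parabolic_subgroup])

lemma parabolic_closed: "x \<in> parabolic W K \<Longrightarrow> x \<in> carrier W"
  by (rule subgroup.mem_carrier[OF parabolic_subgroup])

lemma parabolic_cox: "x \<in> parabolic W K \<Longrightarrow> x \<in> cox W"
  by (elim parabolic_words) simp

lemma parabolic_mono: "K \<subseteq> J \<Longrightarrow> parabolic W K \<subseteq> parabolic W J"
  unfolding parabolic_def by (intro mono_generate image_mono)

lemma sref_parabolic: "j \<in> K \<Longrightarrow> sref W j \<in> parabolic W K"
  unfolding parabolic_def by (intro generate.incl) auto

lemma parabolic_induct [consumes 1, case_names one step]:
  assumes "x \<in> parabolic W K" "Q \<one>"
    and "\<And>k y. k \<in> K \<Longrightarrow> y \<in> parabolic W K \<Longrightarrow> Q y \<Longrightarrow> Q (sref W k \<otimes> y)"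
  shows "Q x"
proof -
  obtain xs where "set xs \<subseteq> K" "x = word xs" using parabolic_words[OF assms(1)] .
  moreover have "set xs \<subseteq> K \<Longrightarrow> word xs \<in> parabolic W K \<and> Q (word xs)" for xs
  proof (induction xs)
    case (Cons k xs)
    then show ?case
      using assms(3)[of k "word xs"] parabolic_mult[OF sref_parabolic[of k K], of "word xs"] by simp
  qed (simp add: assms(2))
  ultimately show ?thesis by simp
qed

lemma parabolic_root_act:
  assumes "x \<in> parabolic W K" "\<beta> \<in> parabolic_roots W K"
  shows "x \<cdot> \<beta> \<in> parabolic_roots W K"
proof -
  obtain y j where y: "y \<in> parabolic W K" "j \<in> K" "\<beta> = y \<cdot> simple_root j"
    using assms(2) by (auto simp: parabolic_roots_def)
  then have "x \<cdot> \<beta> = (x \<otimes> y) \<cdot> simple_root j"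
    using assms(1) parabolic_closed by (simp add: act_mult)
  then show ?thesis
    using y parabolic_mult[OF assms(1) y(1)] unfolding parabolic_roots_def by blast
qed

lemma parabolic_root_act_iff:
  assumes "x \<in> parabolic W K"
  shows "x \<cdot> \<beta> \<in> parabolic_roots W K \<longleftrightarrow> \<beta> \<in> parabolic_roots W K"
  using parabolic_root_act[OF assms] parabolic_root_act[OF parabolic_inv[OF assms], of "x \<cdot> \<beta>"]
    parabolic_closed[OF assms] by auto

lemma simple_root_parabolic: "j \<in> K \<Longrightarrow> simple_root j \<in> parabolic_roots W K"
  unfolding parabolic_roots_def by (rule CollectI, rule exI[of _ \<one>]) auto

lemma parabolic_root_root: "\<beta> \<in> parabolic_roots W K \<Longrightarrow> \<beta> \<in> R"
  using parabolic_cox by (auto simp: parabolic_roots_def intro: rootsI)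

lemma parabolic_pos_roots_iff:
  "\<beta> \<in> parabolic_pos_roots W K \<longleftrightarrow> \<beta> \<in> parabolic_roots W K \<and> \<beta> \<in> P"
  by (simp add: parabolic_pos_roots_def)

lemma parabolic_root_uminus_iff [simp]:
  "- \<beta> \<in> parabolic_roots W K \<longleftrightarrow> \<beta> \<in> parabolic_roots W K"
proof -
  have "- \<beta> \<in> parabolic_roots W K" if root: "\<beta> \<in> parabolic_roots W K" for \<beta>
  proof -
    obtain y j where y: "y \<in> parabolic W K" "j \<in> K" "\<beta> = y \<cdot> simple_root j"
      using root by (auto simp: parabolic_roots_def)
    have "(y \<otimes> sref W j) \<cdot> simple_root j \<in> parabolic_roots W K"
      using y by (intro parabolic_root_act parabolic_mult sref_parabolic simple_root_parabolic)
    then show ?thesis using y parabolic_closed by (simp add: act_mult act_uminus)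
  qed
  from this[of \<beta>] this[of "- \<beta>"] show ?thesis by auto
qed

lemma parabolic_act_nth:
  assumes "x \<in> parabolic W K" "i \<notin> K"
  shows "(x \<cdot> v) $ i = v $ i"
  using assms
proof (induction rule: parabolic_induct)
  case (step k y)
  then have "k \<noteq> i" by auto
  then show ?case
    using step parabolic_closed by (simp add: act_mult simple_reflection_def simple_root_nth)
qed simp

lemma parabolic_root_nth:
  assumes "\<beta> \<in> parabolic_roots W K" "i \<notin> K"
  shows "\<beta> $ i = 0"
  using assms parabolic_act_nth by (auto simp: parabolic_roots_def simple_root_nth)

text \<open>A simple reflection of the parabolic subgroup changes the sign of its own two roots only, and the orbit of a
root outside the subsystem never reaches these.\<close>

lemma parabolic_pos_outside:
  assumes "x \<in> parabolic W K" "\<beta> \<in> R" "\<beta> \<notin> parabolic_roots W K"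
  shows "x \<cdot> \<beta> \<in> P \<longleftrightarrow> \<beta> \<in> P"
  using assms
proof (induction rule: parabolic_induct)
  case (step k y)
  have "y \<cdot> \<beta> \<notin> parabolic_roots W K"
    using step parabolic_root_act_iff by simp
  then have "y \<cdot> \<beta> \<noteq> simple_root k" "y \<cdot> \<beta> \<noteq> - simple_root k"
    using simple_root_parabolic[OF step(1)] by auto
  then show ?case
    using step parabolic_closed by (simp add: act_mult refl_pos_iff act_roots)
qed simp

lemma cox_eq_parabolic_UNIV: "parabolic W UNIV = cox W"
  by (simp add: parabolic_def generate_sref)

lemma parabolic_eq_cox_imp_UNIV:
  assumes "parabolic W J = cox W"
  shows "J = UNIV"
proof -
  have "i \<in> J" for i
  proof (rule ccontr)
    assume "i \<notin> J"
    then have "(sref W i \<cdot> simple_root i) $ i = simple_root i $ i"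
      using assms by (intro parabolic_act_nth[of _ J]) simp_all
    then show False by (simp add: simple_root_nth)
  qed
  then show ?thesis by auto
qed

text \<open>For a root the left-hand side is \<open>1\<close>, so some summand is positive.\<close>

lemma form_expand:
  "form v v = (\<Sum>k\<in>UNIV. v $ k * form (simple_root k) v)"
proof -
  interpret bounded: linear "\<lambda>u. form u v"
    using form_bilinear by (simp add: bilinear_def)
  show ?thesis
    by (subst (1) simple_root_expansion) (simp only: bounded.sum bounded.scale real_scaleR_def)
qed

text \<open>For a positive root \<open>\<beta>\<close> let \<open>t\<close> be the reflection in \<open>\<beta>\<close>, an involution. Some \<open>k\<close> in the support of
\<open>\<beta>\<close> has \<open>form (simple_root k) \<beta> > 0\<close>. Unless \<open>\<beta>\<close> is \<open>simple_root k\<close>, then \<open>t\<close> sends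
\<open>simple_root k\<close> to a negative root other than \<open>- simple_root k\<close>, so that \<open>s\<^sub>k t s\<^sub>k\<close>, the reflection in
\<open>s\<^sub>k \<beta>\<close>, is shorter than \<open>t\<close>. Induction on the length of \<open>t\<close> applies to \<open>s\<^sub>k \<beta>\<close>, which is still
supported in \<open>K\<close>.\<close>

lemma supported_root_in_parabolic:
  assumes "\<beta> \<in> R" "\<And>i. i \<notin> K \<Longrightarrow> \<beta> $ i = 0"
  shows "\<beta> \<in> parabolic_roots W K"
proof -
  have pos: "\<beta> \<in> parabolic_roots W K"
    if "t \<in> carrier W" "\<And>v. t \<cdot> v = v - (2 * form \<beta> v) *\<^sub>R \<beta>" "involution W t"
      "\<beta> \<in> P" "\<And>i. i \<notin> K \<Longrightarrow> \<beta> $ i = 0" for t \<beta>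
    using that
  proof (induction "len W t" arbitrary: t \<beta> rule: less_induct)
    case (less t \<beta>)
    have r: "\<beta> \<in> R" using less.prems pos_imp_root by simp
    then have "0 < (\<Sum>k\<in>UNIV. \<beta> $ k * form (simple_root k) \<beta>)"
      by (simp flip: form_expand)
    then obtain k where "0 < \<beta> $ k * form (simple_root k) \<beta>"
      using sum_nonpos[of UNIV "\<lambda>k. \<beta> $ k * form (simple_root k) \<beta>"] by (meson not_less)
    moreover have "0 \<le> \<beta> $ k" using less.prems(4) by (simp add: pos_roots_iff)
    ultimately have bk: "0 < \<beta> $ k" and fk: "0 < form (simple_root k) \<beta>"
      by (auto simp: zero_less_mult_iff)
    have kK: "k \<in> K" using bk less.prems(5)[of k] by auto
    show ?case
    proof (cases "\<beta> = simple_root k")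
      case True
      then show ?thesis using kK simple_root_parabolic by simp
    next
      case False
      obtain l where l: "l \<noteq> k" "\<beta> $ l \<noteq> 0"
        using pos_root_multiple[OF less.prems(4), of k] False by auto
      have bl: "0 < \<beta> $ l" using l less.prems(4) by (simp add: pos_roots_iff order_less_le)
      have "(t \<cdot> simple_root k) $ l < 0"
        using l bl fk by (simp add: less.prems(2) simple_root_nth form_sym[of \<beta>])
      then have "t \<cdot> simple_root k \<notin> P" "t \<cdot> simple_root k \<noteq> - simple_root k"
        using l by (auto simp: pos_roots_iff simple_root_nth not_le)
      then have len: "len W (conj_simple W k t) < len W t"
        using less.prems(3) by (intro conj_simple_descent)
      have "conj_simple W k t \<cdot> v = v - (2 * form (\<sigma> k \<beta>) v) *\<^sub>R \<sigma> k \<beta>" for v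
      proof -
        have "form \<beta> (\<sigma> k v) = form (\<sigma> k \<beta>) v"
          using form_refl[of k "\<sigma> k \<beta>" v] by simp
        then show ?thesis
          using less.prems(1)
          by (simp add: conj_simple_def act_mult less.prems(2) linear_diff[OF refl_linear]
              linear_scale[OF refl_linear])
      qed
      moreover have "\<sigma> k \<beta> \<in> P" using refl_pos[OF less.prems(4) False] .
      moreover have "\<sigma> k \<beta> $ i = 0" if "i \<notin> K" for i
        using that kK less.prems(5) by (auto simp: simple_reflection_def simple_root_nth)
      ultimately have "\<sigma> k \<beta> \<in> parabolic_roots W K"
        using less.hyps[OF len] less.prems conj_simple_closed conj_simple_involution by blast
      then show ?thesis
        using parabolic_root_act_iff[OF sref_parabolic[OF kK], of \<beta>] by simp
    qed
  qed
  obtain x i where x: "x \<in> cox W" "\<beta> = x \<cdot> simple_root i"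
    using assms(1) by (auto simp: roots_def)
  have xc: "x \<in> carrier W" using x cox_closed by simp
  define t where "t = x \<otimes> sref W i \<otimes> inv x"
  have t: "t \<in> carrier W" "\<And>v. t \<cdot> v = v - (2 * form \<beta> v) *\<^sub>R \<beta>"
    using xc by (simp_all add: t_def x(2) act_conj_sref)
  have "involution W t"
    using xc t(1) by (simp add: involution_def) (simp add: t_def m_assoc)
  note t = t this
  show ?thesis
  proof (cases "\<beta> \<in> P")
    case True
    then show ?thesis using pos[OF t] assms by blast
  next
    case False
    then have "- \<beta> \<in> P" using assms uminus_pos_iff by simp
    moreover have "\<And>v. t \<cdot> v = v - (2 * form (- \<beta>) v) *\<^sub>R - \<beta>"
      using t(2) by (simp add: form_simps)
    ultimately have "- \<beta> \<in> parabolic_roots W K"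
      using pos[OF t(1) _ t(3), of "- \<beta>"] assms by simp
    then show ?thesis by simp
  qed
qed

section \<open>Locally extremal involutions\<close>

text \<open>For \<open>e = 1\<close> no simple reflection in \<open>J\<close> shortens the involution \<open>w\<close> by conjugation; for \<open>e = - 1\<close> none
lengthens it.\<close>

definition extremal :: "real \<Rightarrow> 'i set \<Rightarrow> 'a \<Rightarrow> bool" where
  "extremal e J w \<longleftrightarrow>
    (\<forall>j\<in>J. e *\<^sub>R (w \<cdot> simple_root j) \<in> P \<or> e *\<^sub>R (w \<cdot> simple_root j) = - simple_root j)"

text \<open>For an involution these are the simple reflections that commute with \<open>w\<close> and are descents (\<open>e = 1\<close>) or
ascents (\<open>e = - 1\<close>) of \<open>w\<close>, that is, \<open>descent_set W J w\<close> or \<open>ascent_set W J w\<close>.\<close>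

definition reversed :: "real \<Rightarrow> 'i set \<Rightarrow> 'a \<Rightarrow> 'i set" where
  "reversed e J w = {j \<in> J. e *\<^sub>R (w \<cdot> simple_root j) = - simple_root j}"

lemma act_expand:
  assumes "x \<in> carrier W"
  shows "e *\<^sub>R (x \<cdot> v) = (\<Sum>j\<in>UNIV. v $ j *\<^sub>R (e *\<^sub>R (x \<cdot> simple_root j)))"
proof -
  have "x \<cdot> v = (\<Sum>j\<in>UNIV. v $ j *\<^sub>R (x \<cdot> simple_root j))"
    by (subst simple_root_expansion[of v])
      (simp add: linear_sum[OF act_linear[OF assms]] linear_scale[OF act_linear[OF assms]])
  then show ?thesis
    by (simp add: scaleR_sum_right mult.commute)
qed

lemma act_nth_expand:
  assumes "x \<in> carrier W"
  shows "(e *\<^sub>R (x \<cdot> v)) $ i = (\<Sum>j\<in>UNIV. v $ j * (e *\<^sub>R (x \<cdot> simple_root j)) $ i)"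
  by (subst act_expand[OF assms]) (simp only: sum_component vector_scaleR_component real_scaleR_def)

lemma signed_root:
  assumes "e \<in> {1, - 1}" "\<beta> \<in> R"
  shows "e *\<^sub>R \<beta> \<in> R"
  using assms by auto

lemma signed_pos_combination:
  assumes "x \<in> carrier W" "e \<in> {1, - 1}" "\<And>k. k \<in> K \<Longrightarrow> e *\<^sub>R (x \<cdot> simple_root k) \<in> P"
    and "\<beta> \<in> parabolic_pos_roots W K"
  shows "e *\<^sub>R (x \<cdot> \<beta>) \<in> P"
proof -
  have b: "\<beta> \<in> P" "\<beta> \<in> parabolic_roots W K"
    using assms(4) by (simp_all add: parabolic_pos_roots_iff)
  have "0 \<le> \<beta> $ j * (e *\<^sub>R (x \<cdot> simple_root j)) $ i" for i j
  proof (cases "j \<in> K")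
    case True
    then have "0 \<le> (e *\<^sub>R (x \<cdot> simple_root j)) $ i"
      using assms(3)[of j] unfolding pos_roots_iff by blast
    moreover have "0 \<le> \<beta> $ j" using b(1) by (simp add: pos_roots_iff)
    ultimately show ?thesis by (intro mult_nonneg_nonneg)
  qed (use parabolic_root_nth[OF b(2)] in simp)
  then have "0 \<le> (e *\<^sub>R (x \<cdot> \<beta>)) $ i" for i
    by (subst act_nth_expand[OF assms(1)]) (intro sum_nonneg)
  moreover have "e *\<^sub>R (x \<cdot> \<beta>) \<in> R"
    using assms(1,2) b(1) by (intro signed_root act_roots pos_imp_root)
  ultimately show ?thesis unfolding pos_roots_iff by blast
qed

lemma reversed_span:
  assumes "w \<in> carrier W" "\<And>i. i \<notin> reversed e J w \<Longrightarrow> v $ i = 0"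
  shows "e *\<^sub>R (w \<cdot> v) = - v"
proof -
  have "e *\<^sub>R (w \<cdot> v) = (\<Sum>j\<in>UNIV. v $ j *\<^sub>R (- simple_root j))"
  proof (rule trans[OF act_expand[OF assms(1)]], rule sum.cong[OF refl])
    fix j
    show "v $ j *\<^sub>R (e *\<^sub>R (w \<cdot> simple_root j)) = v $ j *\<^sub>R (- simple_root j)"
      using assms(2)[of j] by (cases "j \<in> reversed e J w") (auto simp: reversed_def)
  qed
  also have "\<dots> = - v"
    by (subst (2) simple_root_expansion) (simp add: sum_negf)
  finally show ?thesis .
qed

lemma reversed_root:
  assumes "w \<in> carrier W" "\<beta> \<in> parabolic_roots W (reversed e J w)"
  shows "e *\<^sub>R (w \<cdot> \<beta>) = - \<beta>"
  using parabolic_root_nth[OF assms(2)] by (intro reversed_span[OF assms(1)])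

text \<open>All coordinates of \<open>e w \<beta>\<close> outside the reversed simple roots are nonnegative, being sums of nonnegative
terms. If \<open>e w \<beta>\<close> is negative they vanish, so \<open>e w\<close> sends \<open>w \<beta>\<close> to \<open>- w \<beta>\<close>. As \<open>w\<close> is an involution, this
means \<open>w \<beta> = - e \<beta>\<close>, and \<open>\<beta>\<close> is itself supported on the reversed simple roots.\<close>

lemma extremal_root_cases:
  assumes w: "involution W w" and e: "e \<in> {1, - 1}" and ext: "extremal e J w"
    and b: "\<beta> \<in> parabolic_pos_roots W J" and notpos: "e *\<^sub>R (w \<cdot> \<beta>) \<notin> P"
  shows "\<beta> \<in> parabolic_roots W (reversed e J w)"
proof -
  have wc: "w \<in> carrier W" using w involution_closed by simp
  have bP: "\<beta> \<in> P" and bJ: "\<beta> \<in> parabolic_roots W J"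
    using b by (simp_all add: parabolic_pos_roots_iff)
  let ?K = "reversed e J w"
  \<comment> \<open>It turns out that \<open>\<gamma>\<close> equals \<open>\<beta>\<close>.\<close>
  define \<gamma> where "\<gamma> = - (e *\<^sub>R (w \<cdot> \<beta>))"
  have r: "e *\<^sub>R (w \<cdot> \<beta>) \<in> R"
    using wc e bP by (intro signed_root act_roots pos_imp_root)
  then have gP: "\<gamma> \<in> P"
    using notpos by (simp add: \<gamma>_def uminus_pos_iff)
  have gK: "\<gamma> $ i = 0" if i: "i \<notin> ?K" for i
  proof -
    have "0 \<le> \<beta> $ j * (e *\<^sub>R (w \<cdot> simple_root j)) $ i" for j
    proof (cases "j \<in> J")
      case True
      then consider "e *\<^sub>R (w \<cdot> simple_root j) \<in> P" | "e *\<^sub>R (w \<cdot> simple_root j) = - simple_root j"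
        using ext unfolding extremal_def by blast
      then have "0 \<le> (e *\<^sub>R (w \<cdot> simple_root j)) $ i"
      proof cases
        case 1
        then show ?thesis unfolding pos_roots_iff by blast
      next
        case 2
        then have "i \<noteq> j" using i True by (auto simp: reversed_def)
        then show ?thesis unfolding 2 by (simp add: simple_root_nth)
      qed
      moreover have "0 \<le> \<beta> $ j" using bP by (simp add: pos_roots_iff)
      ultimately show ?thesis by (intro mult_nonneg_nonneg)
    qed (use parabolic_root_nth[OF bJ] in simp)
    then have "0 \<le> (e *\<^sub>R (w \<cdot> \<beta>)) $ i"
      by (subst act_nth_expand[OF wc]) (intro sum_nonneg)
    then have "\<gamma> $ i \<le> 0" unfolding \<gamma>_def by simp
    moreover have "0 \<le> \<gamma> $ i" using gP by (simp add: pos_roots_iff)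
    ultimately show ?thesis by simp
  qed
  then have "e *\<^sub>R (w \<cdot> \<gamma>) = - \<gamma>"
    by (intro reversed_span[OF wc])
  moreover have "e *\<^sub>R (w \<cdot> \<gamma>) = - \<beta>"
    using e wc w unfolding \<gamma>_def
    by (auto simp: linear_scale[OF act_linear] act_uminus)
  ultimately have "\<gamma> = \<beta>" by simp
  then show ?thesis
    using supported_root_in_parabolic[of \<beta> ?K] gK bP pos_imp_root by simp
qed

lemma extremal_parabolic_root:
  assumes w: "involution W w" and e: "e \<in> {1, - 1}" and ext: "extremal e J w"
    and b: "\<gamma> \<in> parabolic_roots W J"
  shows "(e *\<^sub>R (w \<cdot> \<gamma>) \<in> P \<longleftrightarrow> \<gamma> \<in> P) \<or> e *\<^sub>R (w \<cdot> \<gamma>) = - \<gamma>"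
proof -
  have wc: "w \<in> carrier W" using w involution_closed by simp
  have pos: "e *\<^sub>R (w \<cdot> \<beta>) \<in> P \<or> e *\<^sub>R (w \<cdot> \<beta>) = - \<beta>"
    if "\<beta> \<in> P" "\<beta> \<in> parabolic_roots W J" for \<beta>
    using extremal_root_cases[OF w e ext, of \<beta>] reversed_root[OF wc, of \<beta> e J] that
    by (auto simp: parabolic_pos_roots_iff)
  have r: "\<gamma> \<in> R" using b parabolic_root_root by simp
  show ?thesis
  proof (cases "\<gamma> \<in> P")
    case False
    then have "- \<gamma> \<in> P" using r by (simp add: uminus_pos_iff)
    then have "- (e *\<^sub>R (w \<cdot> \<gamma>)) \<in> P \<or> - (e *\<^sub>R (w \<cdot> \<gamma>)) = \<gamma>"
      using pos[of "- \<gamma>"] b wc by (simp add: act_uminus)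
    moreover have "e *\<^sub>R (w \<cdot> \<gamma>) \<in> R"
      using wc e r by (intro signed_root act_roots)
    ultimately show ?thesis using False uminus_pos_iff by (metis minus_minus)
  qed (use pos b in auto)
qed

lemma extremal_max_iff_inversions:
  assumes "involution W w"
  shows "extremal (- 1) J w \<longleftrightarrow>
    inversions W w \<inter> parabolic_pos_roots W J = parabolic_pos_roots W J - fixed_roots W w"
proof -
  have wc: "w \<in> carrier W" using assms involution_closed by simp
  have P: "- (w \<cdot> \<beta>) \<in> P \<longleftrightarrow> w \<cdot> \<beta> \<notin> P" if "\<beta> \<in> P" for \<beta>
    using that wc by (simp add: uminus_pos_iff act_roots pos_imp_root)
  show ?thesis
  proof
    assume ext: "extremal (- 1) J w"
    have "w \<cdot> \<beta> \<notin> P \<longleftrightarrow> w \<cdot> \<beta> \<noteq> \<beta>" if "\<beta> \<in> parabolic_pos_roots W J" for \<beta>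
      using extremal_root_cases[OF assms _ ext that] reversed_root[OF wc, of \<beta> "- 1" J] that P
      by (auto simp: parabolic_pos_roots_iff)
    then show "inversions W w \<inter> parabolic_pos_roots W J = parabolic_pos_roots W J - fixed_roots W w"
      using wc by (auto simp: inversions_iff fixed_roots_def parabolic_pos_roots_iff pos_imp_root)
  next
    assume eq: "inversions W w \<inter> parabolic_pos_roots W J = parabolic_pos_roots W J - fixed_roots W w"
    have "- (w \<cdot> simple_root j) \<in> P \<or> w \<cdot> simple_root j = simple_root j" if "j \<in> J" for j
    proof -
      have "simple_root j \<in> parabolic_pos_roots W J"
        using that simple_root_parabolic by (simp add: parabolic_pos_roots_iff)
      then have "simple_root j \<in> inversions W w \<or> simple_root j \<in> fixed_roots W w"
        using eq by blast
      then show ?thesis using wc P by (auto simp: inversions_iff fixed_roots_def)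
    qed
    then show "extremal (- 1) J w" by (auto simp: extremal_def)
  qed
qed

lemma extremal_min_iff_inversions:
  assumes "involution W w"
  shows "extremal 1 J w \<longleftrightarrow>
    inversions W w \<inter> parabolic_pos_roots W J = parabolic_pos_roots W J \<inter> minus_roots W w"
proof -
  have wc: "w \<in> carrier W" using assms involution_closed by simp
  show ?thesis
  proof
    assume ext: "extremal 1 J w"
    have "w \<cdot> \<beta> = - \<beta>" if "\<beta> \<in> parabolic_pos_roots W J" "w \<cdot> \<beta> \<notin> P" for \<beta>
      using extremal_root_cases[OF assms _ ext that(1)] reversed_root[OF wc, of \<beta> 1 J] that by simp
    then show "inversions W w \<inter> parabolic_pos_roots W J = parabolic_pos_roots W J \<inter> minus_roots W w"
      using wc by (auto simp: inversions_iff minus_roots_def eigenspace_def)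
  next
    assume eq: "inversions W w \<inter> parabolic_pos_roots W J = parabolic_pos_roots W J \<inter> minus_roots W w"
    have "w \<cdot> simple_root j = - simple_root j" if "j \<in> J" "w \<cdot> simple_root j \<notin> P" for j
    proof -
      have "simple_root j \<in> inversions W w \<inter> parabolic_pos_roots W J"
        using that wc simple_root_parabolic by (simp add: parabolic_pos_roots_iff inversions_iff)
      then show ?thesis using eq by (auto simp: minus_roots_def eigenspace_def)
    qed
    then show "extremal 1 J w" by (auto simp: extremal_def)
  qed
qed

text \<open>Each root whose sign with respect to \<open>x\<^sup>-\<^sup>1 P\<close> is changed by \<open>w\<close> also changes its sign with respect to \<open>P\<close>:
outside the parabolic subsystem the two signs agree, and inside it \<open>w\<close> changes all signs except those of fixed roots.\<close>

lemma extremal_max_len: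
  assumes w: "involution W w" and ext: "extremal (- 1) J w" and x: "x \<in> parabolic W J"
  shows "len W (x \<otimes> w \<otimes> inv x) \<le> len W w"
proof -
  have wc: "w \<in> carrier W" and xc: "x \<in> carrier W"
    using w x involution_closed parabolic_closed by auto
  have fixed: "w \<cdot> \<gamma> = \<gamma>"
    if "\<gamma> \<in> parabolic_roots W J" "\<gamma> \<in> P \<longleftrightarrow> w \<cdot> \<gamma> \<in> P" for \<gamma>
    using extremal_parabolic_root[OF w _ ext that(1)] that wc parabolic_root_root[OF that(1)]
    by (auto simp: uminus_pos_iff act_roots)
  have "switched x w \<subseteq> switched \<one> w"
  proof
    fix \<gamma> assume g: "\<gamma> \<in> switched x w"
    then have r: "\<gamma> \<in> R" "w \<cdot> \<gamma> \<in> R" and s: "x \<cdot> \<gamma> \<in> P \<longleftrightarrow> x \<cdot> w \<cdot> \<gamma> \<notin> P"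
      using wc by (auto simp: switched_def act_roots)
    have "\<gamma> \<in> P \<longleftrightarrow> w \<cdot> \<gamma> \<notin> P"
    proof (rule ccontr)
      assume "\<not> ?thesis"
      then have same: "\<gamma> \<in> P \<longleftrightarrow> w \<cdot> \<gamma> \<in> P" by blast
      show False
      proof (cases "\<gamma> \<in> parabolic_roots W J \<or> w \<cdot> \<gamma> \<in> parabolic_roots W J")
        case True
        then have "w \<cdot> \<gamma> = \<gamma>" using fixed[of \<gamma>] fixed[of "w \<cdot> \<gamma>"] same w by auto
        then show False using s by simp
      next
        case False
        then show False using s same r parabolic_pos_outside[OF x] by simp
      qed
    qed
    then show "\<gamma> \<in> switched \<one> w" using r by (simp add: switched_def)
  qed
  then show ?thesis using len_conj_mono[OF xc _ wc, of \<one>] wc by simp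
qed

text \<open>Dual to the maximal case: inside the parabolic subsystem, \<open>w\<close> changes only the signs of the roots that it
negates, and these signs change with respect to every positive system.\<close>

lemma extremal_min_len:
  assumes w: "involution W w" and ext: "extremal 1 J w" and x: "x \<in> parabolic W J"
  shows "len W w \<le> len W (x \<otimes> w \<otimes> inv x)"
proof -
  have wc: "w \<in> carrier W" and xc: "x \<in> carrier W"
    using w x involution_closed parabolic_closed by auto
  have opposite: "w \<cdot> \<gamma> = - \<gamma>"
    if "\<gamma> \<in> parabolic_roots W J" "\<gamma> \<in> P \<longleftrightarrow> w \<cdot> \<gamma> \<notin> P" for \<gamma>
    using extremal_parabolic_root[OF w _ ext that(1)] that by auto
  have "switched \<one> w \<subseteq> switched x w"
  proof
    fix \<gamma> assume g: "\<gamma> \<in> switched \<one> w"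
    then have r: "\<gamma> \<in> R" "w \<cdot> \<gamma> \<in> R" and s: "\<gamma> \<in> P \<longleftrightarrow> w \<cdot> \<gamma> \<notin> P"
      using wc by (auto simp: switched_def act_roots)
    have "x \<cdot> \<gamma> \<in> P \<longleftrightarrow> x \<cdot> w \<cdot> \<gamma> \<notin> P"
    proof (cases "\<gamma> \<in> parabolic_roots W J \<or> w \<cdot> \<gamma> \<in> parabolic_roots W J")
      case True
      then have "w \<cdot> \<gamma> = - \<gamma> \<or> w \<cdot> w \<cdot> \<gamma> = - (w \<cdot> \<gamma>)"
        using opposite[of \<gamma>] opposite[of "w \<cdot> \<gamma>"] s w by auto
      then have "w \<cdot> \<gamma> = - \<gamma>"
        using w by (metis involution_act minus_minus)
      then show ?thesis
        using xc r by (simp add: act_uminus uminus_pos_iff act_roots)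
    next
      case False
      then show ?thesis using s r parabolic_pos_outside[OF x] by simp
    qed
    then show "\<gamma> \<in> switched x w" using r by (simp add: switched_def)
  qed
  then show ?thesis using len_conj_mono[OF _ xc wc, of \<one>] wc by simp
qed

section \<open>Extremal elements of conjugation orbits\<close>

lemma conj_orbit_eq:
  assumes "Orb \<in> conj_orbits W (parabolic W J)" "w \<in> Orb"
  shows "Orb = {x \<otimes> w \<otimes> inv x | x. x \<in> parabolic W J}"
proof -
  obtain y where y: "y \<in> carrier W" "Orb = {x \<otimes> y \<otimes> inv x | x. x \<in> parabolic W J}"
    using assms(1) by (auto simp: conj_orbits_def)
  then obtain a where a: "a \<in> parabolic W J" "w = a \<otimes> y \<otimes> inv a"
    using assms(2) by auto
  have ac: "a \<in> carrier W" using a parabolic_closed by simp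
  have 1: "x \<otimes> w \<otimes> inv x = (x \<otimes> a) \<otimes> y \<otimes> inv (x \<otimes> a)" if "x \<in> parabolic W J" for x
    using that parabolic_closed[OF that] ac y(1) by (simp add: a(2) inv_mult_group m_assoc)
  have 2: "x \<otimes> y \<otimes> inv x = (x \<otimes> inv a) \<otimes> w \<otimes> inv (x \<otimes> inv a)" if "x \<in> parabolic W J" for x
    using that parabolic_closed[OF that] ac y(1) by (simp add: a(2) inv_mult_group m_assoc)
  show ?thesis
    unfolding y(2) using 1 2 a parabolic_mult parabolic_inv by blast
qed

lemma conj_simple_in_orbit:
  assumes "Orb \<in> conj_orbits W (parabolic W J)" "w \<in> Orb" "j \<in> J"
  shows "conj_simple W j w \<in> Orb"
proof -
  have "conj_simple W j w = sref W j \<otimes> w \<otimes> inv sref W j" by (simp add: conj_simple_def)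
  then show ?thesis
    using sref_parabolic[OF assms(3)] unfolding conj_orbit_eq[OF assms(1,2)] by blast
qed

lemma not_extremal_max_ascent:
  assumes "involution W w" "\<not> extremal (- 1) J w"
  obtains j where "j \<in> J" "w \<cdot> simple_root j \<in> P" "w \<cdot> simple_root j \<noteq> simple_root j"
    "len W w < len W (conj_simple W j w)"
proof -
  have wc: "w \<in> carrier W" using assms involution_closed by simp
  obtain j where "j \<in> J" "- (w \<cdot> simple_root j) \<notin> P" "w \<cdot> simple_root j \<noteq> simple_root j"
    using assms(2) by (auto simp: extremal_def)
  then show thesis
    using that conj_simple_ascent[OF assms(1), of j] wc uminus_pos_iff[of "w \<cdot> simple_root j"]
    by (auto simp: act_roots)
qed

lemma not_extremal_min_descent:
  assumes "involution W w" "\<not> extremal 1 J w"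
  obtains j where "j \<in> J" "w \<cdot> simple_root j \<notin> P" "w \<cdot> simple_root j \<noteq> - simple_root j"
    "len W (conj_simple W j w) < len W w"
proof -
  obtain j where "j \<in> J" "w \<cdot> simple_root j \<notin> P" "w \<cdot> simple_root j \<noteq> - simple_root j"
    using assms(2) by (auto simp: extremal_def)
  then show thesis
    using that conj_simple_descent[OF assms(1), of j] by auto
qed

lemma max_len_iff_extremal:
  assumes "Orb \<in> conj_orbits W (parabolic W J)" "w \<in> Orb" "involution W w"
  shows "w \<in> max_len W Orb \<longleftrightarrow> extremal (- 1) J w"
proof
  assume max: "w \<in> max_len W Orb"
  show "extremal (- 1) J w"
  proof (rule ccontr)
    assume "\<not> ?thesis"
    then obtain j where "j \<in> J" "len W w < len W (conj_simple W j w)"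
      using not_extremal_max_ascent[OF assms(3)] by metis
    then show False
      using max conj_simple_in_orbit[OF assms(1,2)] by (fastforce simp: max_len_def)
  qed
next
  assume "extremal (- 1) J w"
  then have "len W v \<le> len W w" if "v \<in> Orb" for v
    using that extremal_max_len[OF assms(3)] conj_orbit_eq[OF assms(1,2)] by auto
  then show "w \<in> max_len W Orb" using assms(2) by (simp add: max_len_def)
qed

lemma min_len_iff_extremal:
  assumes "Orb \<in> conj_orbits W (parabolic W J)" "w \<in> Orb" "involution W w"
  shows "w \<in> min_len W Orb \<longleftrightarrow> extremal 1 J w"
proof
  assume min: "w \<in> min_len W Orb"
  show "extremal 1 J w"
  proof (rule ccontr)
    assume "\<not> ?thesis"
    then obtain j where "j \<in> J" "len W (conj_simple W j w) < len W w"
      using not_extremal_min_descent[OF assms(3)] by metis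
    then show False
      using min conj_simple_in_orbit[OF assms(1,2)] by (fastforce simp: min_len_def)
  qed
next
  assume "extremal 1 J w"
  then have "len W w \<le> len W v" if "v \<in> Orb" for v
    using that extremal_min_len[OF assms(3)] conj_orbit_eq[OF assms(1,2)] by auto
  then show "w \<in> min_len W Orb" using assms(2) by (simp add: min_len_def)
qed

text \<open>An orbit of an infinite group may have unbounded lengths; the element \<open>u\<close> of maximal length is what makes the
ascent stop.\<close>

lemma ascends_to_max:
  assumes "Orb \<in> conj_orbits W (parabolic W J)" "\<forall>u\<in>Orb. involution W u" "w \<in> Orb"
    and "u \<in> max_len W Orb"
  shows "\<exists>w'\<in>max_len W Orb. ascends W J w w'"
  using assms(3)
proof (induction "len W u - len W w" arbitrary: w rule: less_induct)
  case (less w)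
  show ?case
  proof (cases "w \<in> max_len W Orb")
    case True
    then show ?thesis by (auto simp: ascends_def)
  next
    case False
    then have "\<not> extremal (- 1) J w"
      using max_len_iff_extremal[OF assms(1)] less.prems assms(2) by blast
    then obtain j where j: "j \<in> J" "len W w < len W (conj_simple W j w)"
      using not_extremal_max_ascent[of w J] less.prems assms(2) by metis
    have v: "conj_simple W j w \<in> Orb"
      using conj_simple_in_orbit[OF assms(1) less.prems j(1)] .
    then have "len W (conj_simple W j w) \<le> len W u"
      using assms(4) by (auto simp: max_len_def)
    then obtain w' where "w' \<in> max_len W Orb" "ascends W J (conj_simple W j w) w'"
      using less.hyps[OF _ v] j(2) by fastforce
    then show ?thesis
      using j unfolding ascends_def by (blast intro: converse_rtranclp_into_rtranclp)
  qed
qed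

lemma descends_to_min:
  assumes "Orb \<in> conj_orbits W (parabolic W J)" "\<forall>u\<in>Orb. involution W u" "w \<in> Orb"
  shows "\<exists>w'\<in>min_len W Orb. descends W J w w'"
  using assms(3)
proof (induction "len W w" arbitrary: w rule: less_induct)
  case (less w)
  show ?case
  proof (cases "w \<in> min_len W Orb")
    case True
    then show ?thesis by (auto simp: descends_def)
  next
    case False
    then have "\<not> extremal 1 J w"
      using min_len_iff_extremal[OF assms(1)] less.prems assms(2) by blast
    then obtain j where j: "j \<in> J" "len W (conj_simple W j w) < len W w"
      using not_extremal_min_descent[of w J] less.prems assms(2) by metis
    have "conj_simple W j w \<in> Orb"
      using conj_simple_in_orbit[OF assms(1) less.prems j(1)] .
    then obtain w' where "w' \<in> min_len W Orb" "descends W J (conj_simple W j w) w'"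
      using less.hyps j(2) by blast
    then show ?thesis
      using j unfolding descends_def by (blast intro: converse_rtranclp_into_rtranclp)
  qed
qed

section \<open>Coset descriptions\<close>

lemma l_coset_parabolic_iff: "u \<in> y <# parabolic W K \<longleftrightarrow> (\<exists>b\<in>parabolic W K. u = y \<otimes> b)"
  by (auto simp: l_coset_def)

lemma double_coset_iff:
  "u \<in> double_coset W J x K \<longleftrightarrow> (\<exists>a\<in>parabolic W J. \<exists>b\<in>parabolic W K. u = a \<otimes> x \<otimes> b)"
  by (auto simp: double_coset_def set_mult_def r_coset_def)

lemma double_coset_self: "x \<in> carrier W \<Longrightarrow> x \<in> double_coset W J x K"
  unfolding double_coset_iff by (intro bexI[of _ \<one>]) simp_all

lemma sref_mult_in_double_coset:
  assumes "x \<in> carrier W" "j \<in> J"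
  shows "sref W j \<otimes> x \<in> double_coset W J x K"
  unfolding double_coset_iff using sref_parabolic[OF assms(2)] assms(1)
  by (intro bexI[of _ "sref W j"] bexI[of _ \<one>]) simp_all

lemma left_coset_subset_double_coset:
  assumes "w \<in> carrier W" "v \<in> parabolic W K" "v \<otimes> v = \<one>"
  shows "w <# parabolic W K \<subseteq> double_coset W J (w \<otimes> v) K"
proof
  fix u assume "u \<in> w <# parabolic W K"
  then obtain b where b: "b \<in> parabolic W K" "u = w \<otimes> b"
    by (auto simp: l_coset_parabolic_iff)
  then have "u = \<one> \<otimes> (w \<otimes> v) \<otimes> (v \<otimes> b)"
    using assms parabolic_closed[OF b(1)] parabolic_closed[OF assms(2)]
    by (simp add: m_assoc) (simp add: assms(3) flip: m_assoc[of v v])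
  then show "u \<in> double_coset W J (w \<otimes> v) K"
    unfolding double_coset_iff using parabolic_mult[OF assms(2) b(1)] parabolic_one by blast
qed

lemma ascent_set_eq:
  assumes "involution W w"
  shows "ascent_set W J w = reversed (- 1) J w"
proof -
  have wc: "w \<in> carrier W" using assms involution_closed by simp
  have "conj_simple W j w = w \<and> w \<cdot> simple_root j \<in> P \<longleftrightarrow> w \<cdot> simple_root j = simple_root j" for j
    using conj_simple_ascent[OF assms, of j] conj_simple_fixed[OF assms, of j]
    by (cases "w \<cdot> simple_root j = simple_root j") auto
  then show ?thesis
    unfolding ascent_set_def reversed_def len_mult_sref_iff(1)[OF wc] by simp
qed

lemma descent_set_eq:
  assumes "involution W w"
  shows "descent_set W J w = reversed 1 J w"
proof -
  have wc: "w \<in> carrier W" using assms involution_closed by simp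
  have "conj_simple W j w = w \<and> w \<cdot> simple_root j \<notin> P \<longleftrightarrow> w \<cdot> simple_root j = - simple_root j" for j
    using conj_simple_descent[OF assms, of j] conj_simple_fixed[OF assms, of j]
      uminus_pos_iff[of "simple_root j"] by (metis less_irrefl simple_root_in_roots simple_root_pos)
  then show ?thesis
    unfolding descent_set_def reversed_def len_mult_sref_iff(2)[OF wc] by simp
qed

lemma reversed_subset: "reversed e J w \<subseteq> J"
  by (auto simp: reversed_def)

lemma extremal_reversed_roots:
  assumes "involution W w" "e \<in> {1, - 1}" "extremal e J w"
  shows "parabolic_pos_roots W J \<inter> parabolic_pos_roots W (reversed e J w) =
    {\<beta> \<in> parabolic_pos_roots W J. e *\<^sub>R (w \<cdot> \<beta>) = - \<beta>}"
proof -
  have wc: "w \<in> carrier W" using assms involution_closed by simp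
  have "\<beta> \<in> parabolic_pos_roots W (reversed e J w) \<longleftrightarrow> e *\<^sub>R (w \<cdot> \<beta>) = - \<beta>"
    if b: "\<beta> \<in> parabolic_pos_roots W J" for \<beta>
  proof
    assume "e *\<^sub>R (w \<cdot> \<beta>) = - \<beta>"
    moreover have "- \<beta> \<notin> P" using b uminus_pos_iff[of \<beta>] pos_imp_root by (auto simp: parabolic_pos_roots_iff)
    ultimately show "\<beta> \<in> parabolic_pos_roots W (reversed e J w)"
      using extremal_root_cases[OF assms b] b by (simp add: parabolic_pos_roots_iff)
  qed (use reversed_root[OF wc] in \<open>auto simp: parabolic_pos_roots_iff\<close>)
  then show ?thesis by blast
qed

lemma extremal_max_fixed_roots:
  assumes "involution W w" "extremal (- 1) J w"
  shows "parabolic_pos_roots W J \<inter> parabolic_pos_roots W (reversed (- 1) J w) =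
    parabolic_pos_roots W J \<inter> fixed_roots W w"
  unfolding extremal_reversed_roots[OF assms(1) insertI2[OF singletonI] assms(2)]
  by (auto simp: fixed_roots_def parabolic_pos_roots_iff pos_imp_root)

lemma extremal_min_minus_roots:
  assumes "involution W w" "extremal 1 J w"
  shows "parabolic_pos_roots W J \<inter> parabolic_pos_roots W (reversed 1 J w) =
    parabolic_pos_roots W J \<inter> minus_roots W w"
proof -
  have wc: "w \<in> carrier W" using assms involution_closed by simp
  have "w \<cdot> \<beta> = - \<beta> \<longleftrightarrow> \<beta> \<in> minus_roots W w" if "\<beta> \<in> parabolic_pos_roots W J" for \<beta>
  proof -
    have b: "\<beta> \<in> P" using that by (simp add: parabolic_pos_roots_iff)
    then have "- \<beta> \<notin> P" using uminus_pos_iff pos_imp_root by simp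
    then show ?thesis
      using b wc by (auto simp: minus_roots_def eigenspace_def inversions_iff)
  qed
  then show ?thesis
    unfolding extremal_reversed_roots[OF assms(1) insertI1 assms(2)] by auto
qed

lemma parabolic_commutes:
  assumes "w \<in> carrier W" "e \<in> {1, - 1}" "u \<in> parabolic W (reversed e J w)"
  shows "w \<otimes> u = u \<otimes> w"
  using assms(3)
proof (induction rule: parabolic_induct)
  case (step k y)
  have "w \<cdot> simple_root k = simple_root k \<or> w \<cdot> simple_root k = - simple_root k"
    using step(1) assms(2) by (auto simp: reversed_def)
  then have s: "w \<otimes> sref W k \<otimes> inv w = sref W k"
    using conj_sref_eq[OF assms(1)] by blast
  have yc: "y \<in> carrier W" using step parabolic_closed by simp
  have "w \<otimes> (sref W k \<otimes> y) = (w \<otimes> sref W k \<otimes> inv w) \<otimes> (w \<otimes> y)"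
    using assms(1) yc by (simp add: m_assoc)
  also have "\<dots> = sref W k \<otimes> y \<otimes> w"
    using assms(1) yc step by (simp add: s m_assoc)
  finally show ?case .
qed (use assms in simp)

lemma pos_on_parabolic:
  assumes "y \<in> carrier W" "\<And>k. k \<in> K \<Longrightarrow> y \<cdot> simple_root k \<in> P" "\<beta> \<in> parabolic_pos_roots W K"
  shows "y \<cdot> \<beta> \<in> P"
  using signed_pos_combination[of y 1 K \<beta>] assms by simp

text \<open>The inversions of \<open>y\<close> lie outside the parabolic subsystem, so \<open>u\<^sup>-\<^sup>1\<close> keeps them positive and turns them
into inversions of \<open>y u\<close>.\<close>

lemma left_coset_min:
  assumes "y \<in> carrier W" "\<And>k. k \<in> K \<Longrightarrow> y \<cdot> simple_root k \<in> P" "u \<in> parabolic W K"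
  shows "len W y \<le> len W (y \<otimes> u)"
proof -
  have uc: "u \<in> carrier W" using assms parabolic_closed by simp
  have "len W (y \<otimes> \<one>) \<le> len W (y \<otimes> u)"
  proof (rule len_mult_le)
    fix \<delta> assume d: "\<delta> \<in> R" "inv \<one> \<cdot> \<delta> \<in> P" "y \<cdot> \<delta> \<notin> P"
    then have "\<delta> \<notin> parabolic_roots W K"
      using pos_on_parabolic[OF assms(1,2), of K \<delta>] by (auto simp: parabolic_pos_roots_iff)
    then show "inv u \<cdot> \<delta> \<in> P \<and> y \<cdot> \<delta> \<notin> P"
      using d parabolic_pos_outside[OF parabolic_inv[OF assms(3)]] by simp
  qed (use assms uc in auto)
  then show ?thesis using assms by simp
qed

lemma left_coset_self: "y \<in> carrier W \<Longrightarrow> y \<in> y <# parabolic W K"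
  unfolding l_coset_parabolic_iff by (rule bexI[of _ \<one>]) simp_all

lemma left_reps_iff:
  "y \<in> left_reps W K \<longleftrightarrow> y \<in> carrier W \<and> (\<forall>k\<in>K. y \<cdot> simple_root k \<in> P)"
proof (cases "y \<in> carrier W")
  case True
  have "y \<in> min_len W (y <# parabolic W K) \<longleftrightarrow> (\<forall>k\<in>K. y \<cdot> simple_root k \<in> P)"
  proof
    assume min: "y \<in> min_len W (y <# parabolic W K)"
    have "\<not> len W (y \<otimes> sref W k) < len W y" if "k \<in> K" for k
    proof -
      have "y \<otimes> sref W k \<in> y <# parabolic W K"
        using sref_parabolic[OF that] by (auto simp: l_coset_parabolic_iff)
      then show ?thesis using min by (simp add: min_len_def not_less)
    qed
    then show "\<forall>k\<in>K. y \<cdot> simple_root k \<in> P"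
      using len_mult_sref_descent[OF True] by blast
  next
    assume pos: "\<forall>k\<in>K. y \<cdot> simple_root k \<in> P"
    have "len W y \<le> len W u" if "u \<in> y <# parabolic W K" for u
      using that left_coset_min[OF True, of K] pos by (auto simp: l_coset_parabolic_iff)
    then show "y \<in> min_len W (y <# parabolic W K)"
      using left_coset_self[OF True] by (simp add: min_len_def)
  qed
  then show ?thesis using True by (simp add: left_reps_def)
qed (simp add: left_reps_def)

lemma max_len_nonempty:
  assumes "u \<in> X" "\<And>y. y \<in> X \<Longrightarrow> len W y \<le> N"
  shows "max_len W X \<noteq> {}"
proof -
  have "\<exists>v. v \<in> X \<and> (\<forall>y. y \<in> X \<longrightarrow> len W y \<le> len W v)"
    using assms by (intro ex_has_greatest_nat[where b = "Suc N"]) (auto simp: less_Suc_eq_le)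
  then show ?thesis by (auto simp: max_len_def)
qed

lemma longest_negative:
  assumes "v \<in> max_len W (parabolic W K)" "k \<in> K"
  shows "v \<cdot> simple_root k \<notin> P"
proof
  have v: "v \<in> parabolic W K" using assms by (simp add: max_len_def)
  assume "v \<cdot> simple_root k \<in> P"
  then have "len W v < len W (v \<otimes> sref W k)"
    using v by (intro len_mult_sref_ascent parabolic_closed)
  moreover have "v \<otimes> sref W k \<in> parabolic W K"
    using v assms(2) by (intro parabolic_mult sref_parabolic)
  ultimately show False using assms(1) by (auto simp: max_len_def not_le)
qed

lemma longest_parabolic_root:
  assumes v: "v \<in> max_len W (parabolic W K)" and b: "\<beta> \<in> parabolic_roots W K"
  shows "v \<cdot> \<beta> \<in> P \<longleftrightarrow> \<beta> \<notin> P"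
proof -
  have vc: "v \<in> carrier W" using v by (auto simp: max_len_def parabolic_closed)
  have neg: "v \<cdot> \<beta> \<notin> P" if "\<beta> \<in> parabolic_pos_roots W K" for \<beta>
  proof -
    have "- 1 *\<^sub>R (v \<cdot> simple_root k) \<in> P" if "k \<in> K" for k
      using longest_negative[OF v that] vc by (simp add: uminus_pos_iff act_roots)
    then have "- 1 *\<^sub>R (v \<cdot> \<beta>) \<in> P"
      using signed_pos_combination[OF vc _ _ that, of "- 1"] by simp
    moreover have "v \<cdot> \<beta> \<in> R"
      using that vc by (simp add: act_roots parabolic_pos_roots_iff pos_imp_root)
    ultimately show ?thesis by (simp add: uminus_pos_iff)
  qed
  have r: "\<beta> \<in> R" using b parabolic_root_root by simp
  show ?thesis
    using neg[of \<beta>] neg[of "- \<beta>"] b r vc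
    by (auto simp: parabolic_pos_roots_iff act_uminus uminus_pos_iff act_roots)
qed

text \<open>The square preserves positivity inside the subsystem, where the longest element reverses it twice, and outside
of it; hence it has no inversions.\<close>

lemma longest_involution:
  assumes v: "v \<in> max_len W (parabolic W K)"
  shows "involution W v"
proof -
  have vK: "v \<in> parabolic W K" using v by (simp add: max_len_def)
  have vc: "v \<in> carrier W" using vK parabolic_closed by simp
  have "(v \<otimes> v) \<cdot> simple_root i \<in> P" for i
  proof (cases "i \<in> K")
    case True
    then have i: "simple_root i \<in> parabolic_roots W K" using simple_root_parabolic by simp
    then show ?thesis
      using longest_parabolic_root[OF v i] longest_parabolic_root[OF v parabolic_root_act[OF vK i]] vc
      by (simp add: act_mult)
  next
    case False
    then have "simple_root i \<notin> parabolic_roots W K"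
      using parabolic_root_nth[of "simple_root i" K i] by (auto simp: simple_root_nth)
    then show ?thesis
      using parabolic_pos_outside[OF parabolic_mult[OF vK vK], of "simple_root i"] by simp
  qed
  then have "v \<otimes> v = \<one>"
    using parabolic_cox[OF vK] by (intro cox_no_descent_one) auto
  then show ?thesis using vc by (simp add: involution_def)
qed

text \<open>The map \<open>- v\<close> is an involution preserving the positive roots of the subsystem. Writing \<open>- v \<alpha>\<^sub>k\<close> as a
nonnegative combination of simple roots and applying \<open>- v\<close> exhibits \<open>\<alpha>\<^sub>k\<close> as a nonnegative combination of
positive roots, which therefore are all multiples of \<open>\<alpha>\<^sub>k\<close>.\<close>

lemma longest_permutes:
  assumes v: "v \<in> max_len W (parabolic W K)"
  shows "bij_betw (\<lambda>\<alpha>. - (v \<cdot> \<alpha>)) (simple_root ` K) (simple_root ` K)"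
proof -
  have vK: "v \<in> parabolic W K" using v by (simp add: max_len_def)
  have vc: "v \<in> carrier W" using vK parabolic_closed by simp
  have inv2 [simp]: "v \<cdot> v \<cdot> u = u" for u
    using longest_involution[OF v] by simp
  have neg: "- (v \<cdot> simple_root k) \<in> P" "- (v \<cdot> simple_root k) \<in> parabolic_roots W K" if "k \<in> K" for k
    using that longest_negative[OF v that] vc parabolic_root_act[OF vK simple_root_parabolic[OF that]]
    by (simp_all add: uminus_pos_iff act_roots)
  have "\<exists>i\<in>K. - (v \<cdot> simple_root k) = simple_root i" if k: "k \<in> K" for k
  proof -
    define \<beta> where "\<beta> = - (v \<cdot> simple_root k)"
    have b: "\<beta> \<in> P" "\<beta> \<in> parabolic_roots W K" using neg[OF k] by (simp_all add: \<beta>_def)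
    have nonneg: "0 \<le> \<beta> $ j * (- 1 *\<^sub>R (v \<cdot> simple_root j)) $ l" for j l
    proof (cases "j \<in> K")
      case True
      have "0 \<le> (- 1 *\<^sub>R (v \<cdot> simple_root j)) $ l"
        using neg(1)[OF True] unfolding pos_roots_iff by simp
      moreover have "0 \<le> \<beta> $ j" using b(1) by (simp add: pos_roots_iff)
      ultimately show ?thesis by (intro mult_nonneg_nonneg)
    qed (use parabolic_root_nth[OF b(2)] in simp)
    have "form \<beta> \<beta> = 1" using pos_imp_root[OF b(1)] by simp
    then have "\<beta> \<noteq> 0" by (auto simp: form_simps)
    then obtain i where i: "\<beta> $ i \<noteq> 0" by (auto simp: vec_eq_iff)
    then have iK: "i \<in> K" using parabolic_root_nth[OF b(2)] by blast
    have "(- (v \<cdot> simple_root i)) $ l = 0" if "l \<noteq> k" for l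
    proof -
      have "(\<Sum>j\<in>UNIV. \<beta> $ j * (- 1 *\<^sub>R (v \<cdot> simple_root j)) $ l) = (- 1 *\<^sub>R (v \<cdot> \<beta>)) $ l"
        using act_nth_expand[OF vc, of "- 1" \<beta> l] by simp
      also have "v \<cdot> \<beta> = - simple_root k"
        using vc by (simp add: \<beta>_def act_uminus)
      finally have "(\<Sum>j\<in>UNIV. \<beta> $ j * (- 1 *\<^sub>R (v \<cdot> simple_root j)) $ l) = 0"
        using that by (simp add: simple_root_nth)
      then have "\<beta> $ i * (- 1 *\<^sub>R (v \<cdot> simple_root i)) $ l = 0"
        using nonneg by (subst (asm) sum_nonneg_eq_0_iff) auto
      then show ?thesis using i by simp
    qed
    then have "- (v \<cdot> simple_root i) = simple_root k"
      by (intro pos_root_multiple neg(1)[OF iK])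
    then have "v \<cdot> simple_root k = - (v \<cdot> v \<cdot> simple_root i)"
      using vc by (metis act_uminus)
    then show ?thesis using iK by auto
  qed
  then have maps: "(\<lambda>\<alpha>. - (v \<cdot> \<alpha>)) ` simple_root ` K \<subseteq> simple_root ` K" by auto
  show ?thesis
    by (rule bij_betw_byWitness[where f' = "\<lambda>\<alpha>. - (v \<cdot> \<alpha>)"]) (use maps vc in \<open>auto simp: act_uminus\<close>)
qed

text \<open>If \<open>w\<close> is extremal and \<open>y = a w b\<close> is a distinguished representative, then \<open>y = c w\<close> with \<open>c = a b\<close>, and
\<open>c\<close> is positive on the simple roots of \<open>K\<close>. A root \<open>\<delta>\<close> with \<open>w \<delta>\<close> positive and \<open>c \<delta>\<close> negative must be negative:
otherwise it would belong to \<open>J\<close>, hence to \<open>K\<close>, where \<open>c\<close> is positive. Conversely, a simple reflection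
that lengthens \<open>w\<close> by conjugation gives a longer distinguished representative \<open>s\<^sub>j w\<close>.\<close>

lemma max_description_iff:
  assumes w: "involution W w"
  shows "max_description W J w \<longleftrightarrow> extremal (- 1) J w"
proof -
  define K where "K = reversed (- 1) J w"
  have wc: "w \<in> carrier W" using w involution_closed by simp
  have asc: "ascent_set W J w = K" using ascent_set_eq[OF w] by (simp add: K_def)
  have fix_K: "w \<cdot> simple_root k = simple_root k" if "k \<in> K" for k
    using that by (simp add: K_def reversed_def)
  show ?thesis
  proof
    assume "max_description W J w"
    then have max: "w \<in> max_len W (double_coset W J w K \<inter> left_reps W K)"
      unfolding max_description_def Let_def asc using wc involution_closed by fastforce
    show "extremal (- 1) J w"
    proof (rule ccontr)
      assume "\<not> ?thesis"
      then obtain j where j: "j \<in> J" "w \<cdot> simple_root j \<in> P" "w \<cdot> simple_root j \<noteq> simple_root j"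
        using not_extremal_max_ascent[OF w] by metis
      have "len W w < len W (sref W j \<otimes> w)"
        using len_sref_mult_ascent[OF wc] j(2) w by (simp add: involution_inv)
      moreover have "sref W j \<otimes> w \<in> double_coset W J w K"
        using sref_mult_in_double_coset[OF wc j(1)] .
      moreover have "sref W j \<otimes> w \<in> left_reps W K"
      proof -
        have "(sref W j \<otimes> w) \<cdot> simple_root k \<in> P" if "k \<in> K" for k
        proof -
          have "simple_root k \<noteq> simple_root j" using fix_K[OF that] j(3) by metis
          then show ?thesis using refl_pos[of "simple_root k" j] fix_K[OF that] wc by (simp add: act_mult)
        qed
        then show ?thesis using wc by (simp add: left_reps_iff)
      qed
      ultimately show False using max by (force simp: max_len_def not_le)
    qed
  next
    assume ext: "extremal (- 1) J w"
    have roots: "parabolic_pos_roots W J \<inter> parabolic_pos_roots W K = parabolic_pos_roots W J \<inter> fixed_roots W w"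
      using extremal_max_fixed_roots[OF w ext] by (simp add: K_def)
    have self: "w \<in> double_coset W J w K" using double_coset_self[OF wc] .
    have rep: "w \<in> left_reps W K" using wc fix_K by (simp add: left_reps_iff)
    have "len W y \<le> len W w" if y: "y \<in> double_coset W J w K" "y \<in> left_reps W K" for y
    proof -
      obtain a b where ab: "a \<in> parabolic W J" "b \<in> parabolic W K" "y = a \<otimes> w \<otimes> b"
        using y(1) by (auto simp: double_coset_iff)
      define c where "c = a \<otimes> b"
      have cJ: "c \<in> parabolic W J"
        using ab parabolic_mono[of K J] reversed_subset by (auto simp: c_def K_def intro!: parabolic_mult)
      have cc: "c \<in> carrier W" using cJ parabolic_closed by simp
      have "w \<otimes> b = b \<otimes> w"
        using parabolic_commutes[OF wc, of "- 1" b J] ab(2) by (simp add: K_def)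
      then have yc: "y = c \<otimes> w"
        using ab wc parabolic_closed by (simp add: c_def m_assoc)
      have cK: "c \<cdot> simple_root k \<in> P" if "k \<in> K" for k
        using y(2) that fix_K[OF that] cc wc by (auto simp: left_reps_iff yc act_mult)
      have "len W (c \<otimes> w) \<le> len W (\<one> \<otimes> w)"
      proof (rule len_mult_le)
        fix \<delta> assume d: "\<delta> \<in> R" "inv w \<cdot> \<delta> \<in> P" "c \<cdot> \<delta> \<notin> P"
        have "\<delta> \<notin> P"
        proof
          assume "\<delta> \<in> P"
          then have "\<delta> \<in> parabolic_pos_roots W J"
            using d parabolic_pos_outside[OF cJ] by (auto simp: parabolic_pos_roots_iff)
          moreover have "- 1 *\<^sub>R (w \<cdot> \<delta>) \<notin> P"
            using d wc w by (simp add: involution_inv uminus_pos_iff act_roots)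
          ultimately have "\<delta> \<in> parabolic_pos_roots W K"
            using extremal_root_cases[OF w _ ext, of \<delta>] \<open>\<delta> \<in> P\<close>
            by (simp add: K_def parabolic_pos_roots_iff)
          then show False using pos_on_parabolic[OF cc cK] d by blast
        qed
        then show "inv w \<cdot> \<delta> \<in> P \<and> \<one> \<cdot> \<delta> \<notin> P" using d by simp
      qed (use wc cc in auto)
      then show ?thesis using wc yc by simp
    qed
    then have max: "w \<in> max_len W (double_coset W J w K \<inter> left_reps W K)"
      using self rep by (auto simp: max_len_def)
    have "bij_betw (act W w) (simple_root ` K) (simple_root ` K)"
      by (subst bij_betw_cong[of _ _ id]) (use fix_K in auto)
    then show "max_description W J w"
      unfolding max_description_def Let_def asc using wc w max roots
      by (intro exI[of _ w] exI[of _ \<one>]) simp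
  qed
qed

text \<open>Here \<open>x = w v\<close> with \<open>v\<close> the longest element for \<open>K\<close>, and elements of the double coset have the form \<open>c w\<close>
with \<open>c\<close> in the parabolic subgroup of \<open>J\<close>. Let \<open>w \<delta>\<close> be positive and
\<open>c \<delta>\<close> negative. If \<open>\<delta>\<close> is positive, it belongs to \<open>K\<close> as in \<open>max_description_iff\<close>, and if it is negative, it
does not, since \<open>w\<close> fixes the roots of \<open>K\<close>; in both cases \<open>v \<delta>\<close> is negative. Conversely, if \<open>s\<^sub>j\<close> lengthens \<open>w\<close> by conjugation,
then \<open>w \<alpha>\<^sub>j\<close> is a positive root outside \<open>K\<close>, and \<open>s\<^sub>j x\<close> is longer than \<open>x\<close>.\<close>

lemma max_description_longest_iff:
  assumes w: "involution W w" and fin: "finite (parabolic W J)"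
  shows "max_description_longest W J w \<longleftrightarrow> extremal (- 1) J w"
proof -
  define K where "K = reversed (- 1) J w"
  have KJ: "K \<subseteq> J" using reversed_subset by (simp add: K_def)
  have wc: "w \<in> carrier W" using w involution_closed by simp
  have asc: "ascent_set W J w = K" using ascent_set_eq[OF w] by (simp add: K_def)
  have fix_K: "w \<cdot> \<beta> = \<beta>" if "\<beta> \<in> parabolic_roots W K" for \<beta>
    using reversed_root[OF wc, of \<beta> "- 1" J] that by (simp add: K_def)
  have comm: "w \<otimes> u = u \<otimes> w" if "u \<in> parabolic W K" for u
    using parabolic_commutes[OF wc, of "- 1" u J] that by (simp add: K_def)
  show ?thesis
  proof
    assume "max_description_longest W J w"
    then obtain x v where wxv: "w = x \<otimes> v" and v: "v \<in> max_len W (parabolic W K)"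
      and x: "involution W x" and max: "x \<in> max_len W (double_coset W J x K)"
      unfolding max_description_longest_def Let_def asc by blast
    have vK: "v \<in> parabolic W K" using v by (simp add: max_len_def)
    have vc: "v \<in> carrier W" using vK parabolic_closed by simp
    have xc: "x \<in> carrier W" using x involution_closed by simp
    have v2: "v \<otimes> v = \<one>" using longest_involution[OF v] by (simp add: involution_def)
    have xwv: "x = w \<otimes> v" using xc vc by (simp add: wxv m_assoc v2)
    have inv_x: "inv x = v \<otimes> w"
      using w wc vc longest_involution[OF v] by (simp add: xwv inv_mult_group involution_inv)
    show "extremal (- 1) J w"
    proof (rule ccontr)
      assume "\<not> ?thesis"
      then obtain j where j: "j \<in> J" "w \<cdot> simple_root j \<in> P" "w \<cdot> simple_root j \<noteq> simple_root j"
        using not_extremal_max_ascent[OF w] by metis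
      have "w \<cdot> simple_root j \<notin> parabolic_roots W K"
        using fix_K[of "w \<cdot> simple_root j"] w j(3) by auto
      then have "inv x \<cdot> simple_root j \<in> P"
        using j(2) vc wc parabolic_pos_outside[OF vK, of "w \<cdot> simple_root j"]
        by (simp add: inv_x act_mult pos_imp_root)
      then have "len W x < len W (sref W j \<otimes> x)"
        by (rule len_sref_mult_ascent[OF xc])
      then show False
        using sref_mult_in_double_coset[OF xc j(1), of K] max by (force simp: max_len_def not_le)
    qed
  next
    assume ext: "extremal (- 1) J w"
    have roots: "parabolic_pos_roots W J \<inter> parabolic_pos_roots W K = parabolic_pos_roots W J \<inter> fixed_roots W w"
      using extremal_max_fixed_roots[OF w ext] by (simp add: K_def)
    have "finite (parabolic W K)" using finite_subset[OF parabolic_mono[OF KJ] fin] .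
    then obtain v where v: "v \<in> max_len W (parabolic W K)"
      using max_len_nonempty[OF parabolic_one, of K "Max (len W ` parabolic W K)"] by auto
    have vK: "v \<in> parabolic W K" using v by (simp add: max_len_def)
    have vc: "v \<in> carrier W" using vK parabolic_closed by simp
    have vinv: "involution W v" using longest_involution[OF v] .
    have v2: "v \<otimes> v = \<one>" using vinv by (simp add: involution_def)
    define x where "x = w \<otimes> v"
    have xc: "x \<in> carrier W" using wc vc by (simp add: x_def)
    have wxv: "w = x \<otimes> v" using wc vc by (simp add: x_def m_assoc v2)
    have xv: "x = v \<otimes> w" using comm[OF vK] by (simp add: x_def)
    have "x \<otimes> x = w \<otimes> (v \<otimes> v) \<otimes> w"
      using wc vc by (subst (2) xv) (simp add: x_def m_assoc)
    then have x: "involution W x"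
      using xc wc w by (simp add: involution_def v2)
    have max_dc: "len W y \<le> len W x" if y: "y \<in> double_coset W J x K" for y
    proof -
      obtain a b where ab: "a \<in> parabolic W J" "b \<in> parabolic W K" "y = a \<otimes> x \<otimes> b"
        using y by (auto simp: double_coset_iff)
      define c where "c = a \<otimes> (v \<otimes> b)"
      have cJ: "c \<in> parabolic W J"
        using ab vK parabolic_mono[OF KJ] by (auto simp: c_def intro!: parabolic_mult)
      have cc: "c \<in> carrier W" using cJ parabolic_closed by simp
      have yc: "y = c \<otimes> w"
        using ab wc vc parabolic_closed comm[OF parabolic_mult[OF vK ab(2)]]
        by (simp add: c_def x_def m_assoc)
      have "len W (c \<otimes> w) \<le> len W (v \<otimes> w)"
      proof (rule len_mult_le)
        fix \<delta> assume d: "\<delta> \<in> R" "inv w \<cdot> \<delta> \<in> P" "c \<cdot> \<delta> \<notin> P"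
        then have wd: "w \<cdot> \<delta> \<in> P" using w by (simp add: involution_inv)
        have "v \<cdot> \<delta> \<notin> P"
        proof (cases "\<delta> \<in> P")
          case True
          then have "\<delta> \<in> parabolic_pos_roots W J"
            using d parabolic_pos_outside[OF cJ] by (auto simp: parabolic_pos_roots_iff)
          moreover have "- 1 *\<^sub>R (w \<cdot> \<delta>) \<notin> P"
            using d wc wd by (simp add: uminus_pos_iff act_roots)
          ultimately have "\<delta> \<in> parabolic_roots W K"
            using extremal_root_cases[OF w _ ext, of \<delta>] by (simp add: K_def)
          then show ?thesis using longest_parabolic_root[OF v] True by simp
        next
          case False
          then have "\<delta> \<notin> parabolic_roots W K" using fix_K[of \<delta>] wd by auto
          then show ?thesis using parabolic_pos_outside[OF vK d(1)] False by simp
        qed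
        then show "inv w \<cdot> \<delta> \<in> P \<and> v \<cdot> \<delta> \<notin> P" using d by simp
      qed (use wc cc vc in auto)
      then show ?thesis by (simp add: yc xv)
    qed
    have x_dc: "x \<in> double_coset W J x K" using double_coset_self[OF xc] .
    have "w <# parabolic W K \<subseteq> double_coset W J x K"
      unfolding x_def by (rule left_coset_subset_double_coset[OF wc vK v2])
    then have "x \<in> max_len W (w <# parabolic W K)"
      using max_dc vK by (auto simp: max_len_def l_coset_parabolic_iff x_def)
    moreover have "x \<in> max_len W (double_coset W J x K)"
      using max_dc x_dc by (simp add: max_len_def)
    moreover have "x \<cdot> simple_root k = v \<cdot> simple_root k" if "k \<in> K" for k
      using that wc vc fix_K[OF parabolic_root_act[OF vK simple_root_parabolic[OF that]]]
      by (simp add: x_def act_mult)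
    then have "bij_betw (\<lambda>\<alpha>. - act W x \<alpha>) (simple_root ` K) (simple_root ` K)"
      by (subst bij_betw_cong[of _ _ "\<lambda>\<alpha>. - act W v \<alpha>"]) (use longest_permutes[OF v] in auto)
    ultimately show "max_description_longest W J w"
      unfolding max_description_longest_def Let_def asc using wxv v x roots by blast
  qed
qed

text \<open>The parabolic subgroup of \<open>K\<close> has a longest element even if that of \<open>J\<close> is infinite, since all positive
roots of \<open>K\<close> are inversions of \<open>w\<close>. For \<open>x = w v\<close>, a positive root \<open>\<beta>\<close> of \<open>J\<close> with \<open>x \<beta>\<close>
negative would yield the root \<open>v \<beta>\<close> of \<open>K\<close> by \<open>extremal_root_cases\<close>, but \<open>x\<close> is positive on
\<open>K\<close>; so \<open>x\<close> has no inversions in \<open>J\<close> and is shortest in its double coset. Conversely, if \<open>s\<^sub>j\<close> shortens \<open>w\<close>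
by conjugation, minimality of \<open>x\<close> makes \<open>x \<alpha>\<^sub>j\<close> positive, whence \<open>w \<alpha>\<^sub>j = v x \<alpha>\<^sub>j\<close> is negative and belongs
to \<open>K\<close>, where \<open>w\<close> is \<open>- 1\<close>; this forces \<open>w \<alpha>\<^sub>j = - \<alpha>\<^sub>j\<close>.\<close>

lemma min_description_iff:
  assumes w: "involution W w"
  shows "min_description W J w \<longleftrightarrow> extremal 1 J w"
proof -
  define K where "K = reversed 1 J w"
  have KJ: "K \<subseteq> J" using reversed_subset by (simp add: K_def)
  have wc: "w \<in> carrier W" using w involution_closed by simp
  have desc: "descent_set W J w = K" using descent_set_eq[OF w] by (simp add: K_def)
  have neg_K: "w \<cdot> \<beta> = - \<beta>" if "\<beta> \<in> parabolic_roots W K" for \<beta>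
    using reversed_root[OF wc, of \<beta> 1 J] that by (simp add: K_def)
  have comm: "w \<otimes> u = u \<otimes> w" if "u \<in> parabolic W K" for u
    using parabolic_commutes[OF wc, of 1 u J] that by (simp add: K_def)
  show ?thesis
  proof
    assume "min_description W J w"
    then obtain x v where wxv: "w = x \<otimes> v" and v: "v \<in> max_len W (parabolic W K)"
      and x: "involution W x" and min: "x \<in> min_len W (double_coset W J x K)"
      unfolding min_description_def Let_def desc by blast
    have vK: "v \<in> parabolic W K" using v by (simp add: max_len_def)
    have vc: "v \<in> carrier W" using vK parabolic_closed by simp
    have xc: "x \<in> carrier W" using x involution_closed by simp
    have vinv: "involution W v" using longest_involution[OF v] .
    have w_vx: "w = v \<otimes> x"
      using involution_inv[OF w] xc vc by (simp add: wxv inv_mult_group involution_inv vinv x)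
    show "extremal 1 J w"
    proof (rule ccontr)
      assume "\<not> ?thesis"
      then obtain j where j: "j \<in> J" "w \<cdot> simple_root j \<notin> P" "w \<cdot> simple_root j \<noteq> - simple_root j"
        using not_extremal_min_descent[OF w] by metis
      have "x \<cdot> simple_root j \<in> P"
      proof (rule ccontr)
        assume "x \<cdot> simple_root j \<notin> P"
        then have "inv (sref W j \<otimes> x) \<cdot> simple_root j \<in> P"
          using xc by (simp add: inv_mult_group involution_inv x act_mult act_uminus uminus_pos_iff act_roots)
        then have "len W (sref W j \<otimes> x) < len W x"
          using len_sref_mult_ascent[of "sref W j \<otimes> x" j] xc by simp
        then show False
          using sref_mult_in_double_coset[OF xc j(1), of K] min by (force simp: min_len_def not_le)
      qed
      moreover have "v \<cdot> x \<cdot> simple_root j \<notin> P"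
        using j(2) vc xc by (simp add: w_vx act_mult)
      ultimately have "x \<cdot> simple_root j \<in> parabolic_roots W K"
        using parabolic_pos_outside[OF vK] pos_imp_root by blast
      then have "w \<cdot> simple_root j \<in> parabolic_roots W K"
        using vc xc by (simp add: w_vx act_mult parabolic_root_act[OF vK])
      then have "w \<cdot> w \<cdot> simple_root j = - (w \<cdot> simple_root j)" by (rule neg_K)
      then show False using j(3) w by (metis involution_act minus_minus)
    qed
  next
    assume ext: "extremal 1 J w"
    have roots: "parabolic_pos_roots W J \<inter> parabolic_pos_roots W K = parabolic_pos_roots W J \<inter> minus_roots W w"
      using extremal_min_minus_roots[OF w ext] by (simp add: K_def)
    have bound: "len W y \<le> len W w" if y: "y \<in> parabolic W K" for y
    proof -
      have yc: "y \<in> carrier W" using y parabolic_closed by simp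
      have "inversions W y \<subseteq> inversions W w"
      proof
        fix \<beta> assume "\<beta> \<in> inversions W y"
        then have b: "\<beta> \<in> P" "y \<cdot> \<beta> \<notin> P" using yc by (auto simp: inversions_iff)
        then have "\<beta> \<in> parabolic_roots W K"
          using parabolic_pos_outside[OF y] pos_imp_root by blast
        then show "\<beta> \<in> inversions W w"
          using neg_K b wc pos_imp_root uminus_pos_iff by (auto simp: inversions_iff)
      qed
      then show ?thesis unfolding len_def by (intro card_mono finite_inversions wc)
    qed
    then obtain v where v: "v \<in> max_len W (parabolic W K)"
      using max_len_nonempty[OF parabolic_one] by blast
    have vK: "v \<in> parabolic W K" using v by (simp add: max_len_def)
    have vc: "v \<in> carrier W" using vK parabolic_closed by simp
    have vinv: "involution W v" using longest_involution[OF v] .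
    have v2: "v \<otimes> v = \<one>" using vinv by (simp add: involution_def)
    define x where "x = w \<otimes> v"
    have xc: "x \<in> carrier W" using wc vc by (simp add: x_def)
    have wxv: "w = x \<otimes> v" using wc vc by (simp add: x_def m_assoc v2)
    have xv: "x = v \<otimes> w" using comm[OF vK] by (simp add: x_def)
    have "x \<otimes> x = w \<otimes> (v \<otimes> v) \<otimes> w"
      using wc vc by (subst (2) xv) (simp add: x_def m_assoc)
    then have x: "involution W x"
      using xc wc w by (simp add: involution_def v2)
    have x_simple: "x \<cdot> simple_root k = - (v \<cdot> simple_root k)" if "k \<in> K" for k
      using that wc vc neg_K[OF parabolic_root_act[OF vK simple_root_parabolic[OF that]]]
      by (simp add: x_def act_mult)
    then have x_bij: "bij_betw (act W x) (simple_root ` K) (simple_root ` K)"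
      by (subst bij_betw_cong[of _ _ "\<lambda>\<alpha>. - act W v \<alpha>"]) (use longest_permutes[OF v] in auto)
    then have "x \<cdot> simple_root k \<in> P" if "k \<in> K" for k
      using that bij_betwE by fastforce
    then have x_pos: "x \<cdot> \<beta> \<in> P" if "\<beta> \<in> parabolic_pos_roots W K" for \<beta>
      using pos_on_parabolic[OF xc _ that] by blast
    have min_dc: "len W x \<le> len W y" if y: "y \<in> double_coset W J x K" for y
    proof -
      obtain a b where ab: "a \<in> parabolic W J" "b \<in> parabolic W K" "y = a \<otimes> x \<otimes> b"
        using y by (auto simp: double_coset_iff)
      \<comment> \<open>\<open>x b = (v b v) x\<close>, because \<open>v\<close> and \<open>b\<close> commute with \<open>w\<close>.\<close>
      define c where "c = a \<otimes> (v \<otimes> b \<otimes> v)"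
      have cJ: "c \<in> parabolic W J"
        using ab vK parabolic_mono[OF KJ] by (auto simp: c_def intro!: parabolic_mult)
      have cc: "c \<in> carrier W" using cJ parabolic_closed by simp
      have bc: "b \<in> carrier W" "a \<in> carrier W" using ab parabolic_closed by auto
      have "c \<otimes> x = a \<otimes> (v \<otimes> b \<otimes> (v \<otimes> v) \<otimes> w)"
        using bc vc wc by (simp add: c_def xv m_assoc)
      also have "\<dots> = a \<otimes> (w \<otimes> (v \<otimes> b))"
        using bc vc wc comm[OF parabolic_mult[OF vK ab(2)]] by (simp add: v2)
      also have "\<dots> = y"
        using bc vc wc by (simp add: ab(3) x_def m_assoc)
      finally have yc: "y = c \<otimes> x" by simp
      have "len W (\<one> \<otimes> x) \<le> len W (c \<otimes> x)"
      proof (rule len_mult_le)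
        fix \<delta> assume d: "\<delta> \<in> R" "inv x \<cdot> \<delta> \<in> P" "\<one> \<cdot> \<delta> \<notin> P"
        define \<beta> where "\<beta> = - \<delta>"
        have b: "\<beta> \<in> P" "x \<cdot> \<beta> \<notin> P"
          using d xc by (simp_all add: \<beta>_def uminus_pos_iff act_uminus involution_inv x act_roots)
        have "\<beta> \<notin> parabolic_roots W J"
        proof
          assume bJ: "\<beta> \<in> parabolic_roots W J"
          have not_K: "\<beta> \<notin> parabolic_roots W K"
            using x_pos b by (auto simp: parabolic_pos_roots_iff)
          then have "v \<cdot> \<beta> \<in> P"
            using b parabolic_pos_outside[OF vK] pos_imp_root by blast
          moreover have "v \<cdot> \<beta> \<in> parabolic_roots W J"
            using bJ vK parabolic_mono[OF KJ] by (intro parabolic_root_act) auto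
          moreover have "w \<cdot> v \<cdot> \<beta> \<notin> P"
            using b(2) wc vc by (simp add: x_def act_mult)
          ultimately have "v \<cdot> \<beta> \<in> parabolic_roots W K"
            using extremal_root_cases[OF w _ ext, of "v \<cdot> \<beta>"] by (simp add: K_def parabolic_pos_roots_iff)
          then show False using not_K parabolic_root_act_iff[OF vK] by simp
        qed
        then have "\<delta> \<notin> parabolic_roots W J" by (simp add: \<beta>_def)
        then show "inv x \<cdot> \<delta> \<in> P \<and> c \<cdot> \<delta> \<notin> P"
          using d parabolic_pos_outside[OF cJ] by simp
      qed (use cc xc in auto)
      then show ?thesis using xc by (simp add: yc)
    qed
    have x_dc: "x \<in> double_coset W J x K" using double_coset_self[OF xc] .
    have "w <# parabolic W K \<subseteq> double_coset W J x K"
      unfolding x_def by (rule left_coset_subset_double_coset[OF wc vK v2])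
    then have "x \<in> min_len W (w <# parabolic W K)"
      using min_dc vK by (auto simp: min_len_def l_coset_parabolic_iff x_def)
    moreover have "x \<in> min_len W (double_coset W J x K)"
      using min_dc x_dc by (simp add: min_len_def)
    ultimately show "min_description W J w"
      unfolding min_description_def Let_def desc using wxv v x roots x_bij by blast
  qed
qed

end

section \<open>Weyl chambers\<close>

lemma dual_chamber_eq: "dual_chamber = {f. \<forall>i. 0 < f $ i}"
  by (simp add: dual_chamber_def simple_root_def inner_axis)

lemma closure_dual_chamber: "closure dual_chamber = {f :: real ^ 'i::finite. \<forall>i. 0 \<le> f $ i}"
proof
  have "closed {f :: real ^ 'i. \<forall>i. 0 \<le> f $ i}"
    by (intro closed_Collect_all closed_Collect_le continuous_intros)
  then show "closure dual_chamber \<subseteq> {f :: real ^ 'i. \<forall>i. 0 \<le> f $ i}"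
    by (intro closure_minimal) (auto simp: dual_chamber_eq less_imp_le)
next
  show "{f :: real ^ 'i. \<forall>i. 0 \<le> f $ i} \<subseteq> closure dual_chamber"
  proof
    fix f :: "real ^ 'i" assume f: "f \<in> {f. \<forall>i. 0 \<le> f $ i}"
    have "(\<lambda>n. f + inverse (real (Suc n)) *\<^sub>R 1) \<longlonglongrightarrow> f + 0 *\<^sub>R 1"
      by (intro tendsto_intros LIMSEQ_inverse_real_of_nat)
    moreover have "f + inverse (real (Suc n)) *\<^sub>R 1 \<in> dual_chamber" for n
      using f by (auto simp: dual_chamber_eq intro: add_nonneg_pos)
    ultimately show "f \<in> closure dual_chamber"
      unfolding closure_sequential by (intro exI[of _ "\<lambda>n. f + inverse (real (Suc n)) *\<^sub>R 1"]) simp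
  qed
qed

text \<open>A linear coordinate vanishing on an open part of a subspace vanishes on the subspace: \<open>u + t h\<close> stays in
\<open>U\<close> for small \<open>t > 0\<close>.\<close>

lemma open_subset_vanishing:
  fixes E :: "(real ^ 'i::finite) set"
  assumes "subspace E" "openin (top_of_set E) U" "u \<in> U" "\<And>f. f \<in> U \<Longrightarrow> f $ j = 0" "h \<in> E"
  shows "h $ j = 0"
proof -
  obtain T where T: "open T" "U = E \<inter> T"
    using assms(2) by (auto simp: openin_open)
  then obtain d where d: "0 < d" "ball u d \<subseteq> T"
    using assms(3) open_contains_ball by blast
  define t where "t = d / (norm h + 1)"
  have t: "0 < t" using d(1) by (simp add: t_def add_nonneg_pos)
  have "t * norm h < d"
  proof -
    have "d * norm h < d * (norm h + 1)" using d(1) by simp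
    then show ?thesis by (simp add: t_def pos_divide_less_eq add_nonneg_pos)
  qed
  then have "u + t *\<^sub>R h \<in> ball u d"
    using t by (simp add: dist_norm)
  moreover have "u + t *\<^sub>R h \<in> E"
    using assms(1,3,5) T(2) by (simp add: subspace_add subspace_scale)
  ultimately have "u + t *\<^sub>R h \<in> U" using d(2) T(2) by auto
  then have "(u + t *\<^sub>R h) $ j = 0" by (rule assms(4))
  moreover have "u $ j = 0" using assms(3,4) by simp
  ultimately show ?thesis using t by simp
qed

lemma contains_open_subset_linear_preimage:
  fixes T :: "'v::euclidean_space \<Rightarrow> 'v"
  assumes "linear T" "inj T"
  shows "contains_open_subset (closure {v. T v \<in> C}) {v. T v \<in> E} \<longleftrightarrow>
    contains_open_subset (closure C) E"
proof -
  have surj: "surj T" using linear_inj_imp_surj[OF assms] .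
  have image: "T ` {v. T v \<in> X} = X" for X using surj by auto
  have cl: "T ` closure {v. T v \<in> C} = closure C"
    using closure_injective_linear_image[OF assms, of "{v. T v \<in> C}"] by (simp only: image)
  show ?thesis
  proof
    assume "contains_open_subset (closure {v. T v \<in> C}) {v. T v \<in> E}"
    then obtain G where G: "open G" "{v. T v \<in> E} \<inter> G \<noteq> {}" "{v. T v \<in> E} \<inter> G \<subseteq> closure {v. T v \<in> C}"
      unfolding contains_open_subset_def openin_open by blast
    have eq: "T ` ({v. T v \<in> E} \<inter> G) = E \<inter> T ` G" by blast
    have "open (T ` G)"
      using G(1) open_surjective_linear_image[OF _ assms(1) surj] by blast
    moreover have "E \<inter> T ` G \<noteq> {}" unfolding eq[symmetric] using G(2) by blast
    moreover have "E \<inter> T ` G \<subseteq> closure C" unfolding eq[symmetric] cl[symmetric] using G(3) by blast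
    ultimately show "contains_open_subset (closure C) E"
      unfolding contains_open_subset_def
      by (intro exI[of _ "E \<inter> T ` G"]) (auto simp: openin_open)
  next
    assume "contains_open_subset (closure C) E"
    then obtain G where G: "open G" "E \<inter> G \<noteq> {}" "E \<inter> G \<subseteq> closure C"
      unfolding contains_open_subset_def openin_open by blast
    let ?U = "{v. T v \<in> E} \<inter> T -` G"
    have "open (T -` G)"
      using linear_continuous_on[OF linear_conv_bounded_linear[THEN iffD1, OF assms(1)]]
      by (rule open_vimage[OF G(1)])
    moreover have "?U \<noteq> {}"
    proof -
      obtain f where "f \<in> E \<inter> G" using G(2) by blast
      moreover obtain v where "T v = f" using surj by (metis surjD)
      ultimately show ?thesis by auto
    qed
    moreover have "?U \<subseteq> closure {v. T v \<in> C}"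
    proof
      fix v assume "v \<in> ?U"
      then have "T v \<in> T ` closure {v. T v \<in> C}" using G(3) unfolding cl by auto
      then show "v \<in> closure {v. T v \<in> C}" using assms(2) by (auto dest: injD)
    qed
    ultimately show "contains_open_subset (closure {v. T v \<in> C}) {v. T v \<in> E}"
      unfolding contains_open_subset_def
      by (intro exI[of _ ?U]) (auto simp: openin_open)
  qed
qed

context finite_rank_twisted_coxeter
begin

lemma inner_simple_root [simp]: "f \<bullet> simple_root i = f $ i"
  by (simp add: simple_root_def inner_axis)

lemma dual_eigenspace_iff:
  assumes "involution W w"
  shows "f \<in> dual_eigenspace W w e \<longleftrightarrow> (\<forall>v. f \<bullet> (w \<cdot> v) = e * (f \<bullet> v))"
  by (simp add: dual_eigenspace_def involution_inv[OF assms])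

lemma subspace_dual_eigenspace:
  assumes "involution W w"
  shows "subspace (dual_eigenspace W w e)"
  by (rule subspaceI) (auto simp: dual_eigenspace_iff[OF assms] inner_add_left algebra_simps)

text \<open>The linear form \<open>g + e (g \<circ> w)\<close>. For \<open>e = \<plusminus> 1\<close> and an involution \<open>w\<close> it lies in the \<open>e\<close>-eigenspace, and if it
vanishes on a vector \<open>v\<close> for all \<open>g\<close>, then \<open>e w v = - v\<close>.\<close>

definition symmetrized :: "real \<Rightarrow> 'a \<Rightarrow> real ^ 'i \<Rightarrow> real ^ 'i" where
  "symmetrized e w g = (\<chi> i. g \<bullet> simple_root i + e * (g \<bullet> (w \<cdot> simple_root i)))"

lemma symmetrized_inner:
  assumes "w \<in> carrier W"
  shows "symmetrized e w g \<bullet> v = g \<bullet> v + e * (g \<bullet> (w \<cdot> v))"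
proof -
  have "(\<lambda>v. symmetrized e w g \<bullet> v) = (\<lambda>v. g \<bullet> v + e * (g \<bullet> (w \<cdot> v)))"
  proof (rule linear_eq_on_simple)
    show "linear (\<lambda>v. g \<bullet> v + e * (g \<bullet> (w \<cdot> v)))"
      by (rule linearI) (simp_all add: linear_add[OF act_linear[OF assms]]
          linear_scale[OF act_linear[OF assms]] inner_add_right algebra_simps)
  qed (simp_all add: bounded_linear.linear[OF bounded_linear_inner_right] symmetrized_def)
  then show ?thesis by (simp add: fun_eq_iff)
qed

lemma symmetrized_eigen:
  assumes "involution W w" "e \<in> {1, - 1}"
  shows "symmetrized e w g \<in> dual_eigenspace W w e"
  using assms
  by (auto simp: dual_eigenspace_iff symmetrized_inner[OF involution_closed] algebra_simps)

lemma inner_nonneg_pos_root: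
  assumes "\<And>i. 0 \<le> f $ i" "\<beta> \<in> P"
  shows "0 \<le> f \<bullet> \<beta>"
  using assms by (auto simp: inner_vec_def pos_roots_iff intro!: sum_nonneg)

text \<open>If \<open>w\<close> is extremal, a form in the eigenspace vanishes on the reversed simple roots, and being positive on
the other simple roots is an open condition, satisfied by the symmetrization of the all-one form. Conversely, a
simple root \<open>\<alpha>\<^sub>j\<close> with \<open>e w \<alpha>\<^sub>j\<close> negative has \<open>f \<alpha>\<^sub>j = f (e w \<alpha>\<^sub>j)\<close>, which is both \<open>\<ge> 0\<close> and \<open>\<le> 0\<close> on the open
set, so \<open>f \<alpha>\<^sub>j = 0\<close> on the whole eigenspace; applied to all symmetrized forms this gives
\<open>e w \<alpha>\<^sub>j = - \<alpha>\<^sub>j\<close>.\<close>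

lemma dual_chamber_open_subset_iff_extremal:
  assumes w: "involution W w" and e: "e \<in> {1, - 1}"
  shows "contains_open_subset (closure dual_chamber) (dual_eigenspace W w e) \<longleftrightarrow> extremal e UNIV w"
proof
  have wc: "w \<in> carrier W" using w involution_closed by simp
  let ?E = "dual_eigenspace W w e"
  {
    assume ext: "extremal e UNIV w"
    let ?K = "reversed e UNIV w"
    define G where "G = (\<Inter>j\<in>- ?K. {f :: real ^ 'i. 0 < f $ j})"
    have "open G"
      unfolding G_def by (intro open_INT ballI open_Collect_less continuous_intros) simp
    moreover have "symmetrized e w 1 \<in> G"
    proof -
      have "0 < symmetrized e w 1 $ j" if "j \<notin> ?K" for j
      proof -
        have "e *\<^sub>R (w \<cdot> simple_root j) \<in> P"
          using ext that by (auto simp: extremal_def reversed_def)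
        then have "0 \<le> 1 \<bullet> (e *\<^sub>R (w \<cdot> simple_root j))"
          by (intro inner_nonneg_pos_root) simp_all
        then show ?thesis by (simp add: symmetrized_def add_pos_nonneg)
      qed
      then show ?thesis by (simp add: G_def)
    qed
    moreover have "?E \<inter> G \<subseteq> closure dual_chamber"
    proof
      fix f assume f: "f \<in> ?E \<inter> G"
      have "0 \<le> f $ j" for j
      proof (cases "j \<in> ?K")
        case True
        then have "f \<bullet> (e *\<^sub>R (w \<cdot> simple_root j)) = - (f $ j)"
          by (simp add: reversed_def)
        moreover have "f \<bullet> (w \<cdot> simple_root j) = e * f $ j"
          using f dual_eigenspace_iff[OF w] by simp
        ultimately show ?thesis using e by auto
      qed (use f in \<open>auto simp: G_def less_imp_le\<close>)
      then show "f \<in> closure dual_chamber" by (simp add: closure_dual_chamber)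
    qed
    ultimately show "contains_open_subset (closure dual_chamber) ?E"
      unfolding contains_open_subset_def using symmetrized_eigen[OF w e, of 1]
      by (intro exI[of _ "?E \<inter> G"]) (auto simp: openin_open)
  }
  assume "contains_open_subset (closure dual_chamber) ?E"
  then obtain U where U: "U \<noteq> {}" "openin (top_of_set ?E) U" "U \<subseteq> closure dual_chamber"
    unfolding contains_open_subset_def by blast
  show "extremal e UNIV w"
    unfolding extremal_def
  proof (intro ballI disjCI)
    fix j
    assume ne: "e *\<^sub>R (w \<cdot> simple_root j) \<noteq> - simple_root j"
    show "e *\<^sub>R (w \<cdot> simple_root j) \<in> P"
    proof (rule ccontr)
      let ?r = "e *\<^sub>R (w \<cdot> simple_root j)"
      assume "?r \<notin> P"
      moreover have "?r \<in> R" using wc e by (intro signed_root act_roots simple_root_in_roots)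
      ultimately have neg: "- ?r \<in> P" by (simp add: uminus_pos_iff)
      have "f $ j = 0" if "f \<in> U" for f
      proof -
        have f: "0 \<le> f $ i" for i using that U(3) by (auto simp: closure_dual_chamber)
        have "f \<in> ?E" using that U(2) openin_imp_subset by blast
        then have "f \<bullet> ?r = f $ j" using e dual_eigenspace_iff[OF w] by auto
        then show ?thesis
          using inner_nonneg_pos_root[OF f neg] f[of j] by (simp del: inner_scaleR_right)
      qed
      then have vanish: "h $ j = 0" if "h \<in> ?E" for h
        using open_subset_vanishing[OF subspace_dual_eigenspace[OF w] U(2)] U(1) that by blast
      have "?r $ i = (- simple_root j) $ i" for i
      proof -
        have "axis i 1 $ j = simple_root j $ i" by (simp add: axis_def simple_root_nth)
        then show ?thesis
          using vanish[OF symmetrized_eigen[OF w e, of "axis i 1"]]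
          by (simp add: symmetrized_def inner_axis')
      qed
      then show False using ne by (simp add: vec_eq_iff)
    qed
  qed
qed

text \<open>The map from \<open>V\<close> to its dual induced by the form.\<close>

definition flat :: "real ^ 'i \<Rightarrow> real ^ 'i" where
  "flat v = (\<chi> i. form (simple_root i) v)"

lemma flat_linear: "linear flat"
  by (rule linearI) (simp_all add: flat_def vec_eq_iff form_simps)

lemma flat_inner: "flat v \<bullet> u = form u v"
proof -
  have "(\<lambda>u. flat v \<bullet> u) = (\<lambda>u. form u v)"
  proof (rule linear_eq_on_simple)
    show "linear (\<lambda>u. form u v)" using form_bilinear by (simp add: bilinear_def)
  qed (simp_all add: bounded_linear.linear[OF bounded_linear_inner_right] flat_def)
  then show ?thesis by (simp add: fun_eq_iff)
qed

lemma cox_fixed: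
  assumes "flat v = 0" "x \<in> cox W"
  shows "x \<cdot> v = v"
proof -
  have "form (simple_root i) v = 0" for i
    using flat_inner[of v "simple_root i"] assms(1) by simp
  moreover obtain xs where "x = word xs" using cox_eq_words[OF assms(2)] .
  ultimately show ?thesis by (simp add: act_word refl_word_fixed)
qed

text \<open>A vector in the radical of the form is fixed by every reflection, hence by \<open>cox W\<close>, so it equals its own
average. But each simple root averages to \<open>0\<close>, since multiplication by its reflection reverses all signs.\<close>

lemma flat_inj:
  assumes "finite (cox W)"
  shows "inj flat"
proof -
  have zero: "(\<Sum>x\<in>cox W. x \<cdot> simple_root i) = 0" for i
  proof -
    have "bij_betw (\<lambda>x. x \<otimes> sref W i) (cox W) (cox W)"
      by (rule bij_betw_byWitness[where f' = "\<lambda>x. x \<otimes> sref W i"]) (auto simp: cox_closed)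
    then have "(\<Sum>x\<in>cox W. x \<cdot> simple_root i) = (\<Sum>x\<in>cox W. (x \<otimes> sref W i) \<cdot> simple_root i)"
      by (rule sum.reindex_bij_betw[symmetric])
    also have "\<dots> = - (\<Sum>x\<in>cox W. x \<cdot> simple_root i)"
      by (simp add: act_mult cox_closed act_uminus sum_negf)
    finally show ?thesis by (simp add: equation_minus_iff vec_eq_iff)
  qed
  have "v = 0" if v: "flat v = 0" for v
  proof -
    have "real (card (cox W)) *\<^sub>R v = (\<Sum>x\<in>cox W. x \<cdot> v)"
      using cox_fixed[OF v] by (simp add: sum_constant_scaleR del: sum_constant)
    also have "\<dots> = (\<Sum>x\<in>cox W. \<Sum>i\<in>UNIV. v $ i *\<^sub>R (x \<cdot> simple_root i))"
      using act_expand[of _ 1 v] by (intro sum.cong) (simp_all add: cox_closed)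
    also have "\<dots> = (\<Sum>i\<in>UNIV. v $ i *\<^sub>R (\<Sum>x\<in>cox W. x \<cdot> simple_root i))"
      by (subst sum.swap) (simp add: scaleR_sum_right)
    finally have "real (card (cox W)) *\<^sub>R v = 0" by (simp add: zero)
    moreover have "card (cox W) \<noteq> 0" using assms cox_one by (metis card_0_eq empty_iff)
    ultimately show ?thesis by simp
  qed
  then show ?thesis using linear_injective_0[OF flat_linear] by blast
qed

lemma chamber_open_subset_iff_dual:
  assumes fin: "finite (cox W)" and w: "involution W w"
  shows "contains_open_subset (closure (dominant_chamber W)) (eigenspace W w e) \<longleftrightarrow>
    contains_open_subset (closure dual_chamber) (dual_eigenspace W w e)"
proof -
  have wc: "w \<in> carrier W" using w involution_closed by simp
  have "dominant_chamber W = {v. flat v \<in> dual_chamber}"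
    by (simp add: dominant_chamber_def dual_chamber_eq flat_def)
  moreover have "eigenspace W w e = {v. flat v \<in> dual_eigenspace W w e}"
  proof -
    have "w \<cdot> v = e *\<^sub>R v \<longleftrightarrow> flat v \<in> dual_eigenspace W w e" for v
    proof -
      have "flat v \<bullet> (w \<cdot> u) = flat (w \<cdot> v) \<bullet> u" for u
        using form_act[OF wc, of "w \<cdot> u" v] w by (simp add: flat_inner)
      moreover have "e * (flat v \<bullet> u) = flat (e *\<^sub>R v) \<bullet> u" for u
        by (simp add: flat_inner form_simps)
      ultimately have "flat v \<in> dual_eigenspace W w e \<longleftrightarrow> (\<forall>u. flat (w \<cdot> v) \<bullet> u = flat (e *\<^sub>R v) \<bullet> u)"
        by (simp add: dual_eigenspace_iff[OF w])
      also have "\<dots> \<longleftrightarrow> flat (w \<cdot> v) = flat (e *\<^sub>R v)"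
        by (metis inner_simple_root vec_eq_iff)
      finally show ?thesis by (simp add: inj_eq[OF flat_inj[OF fin]])
    qed
    then show ?thesis by (simp add: eigenspace_def)
  qed
  ultimately show ?thesis
    using contains_open_subset_linear_preimage[OF flat_linear flat_inj[OF fin]] by simp
qed

text \<open>For an involution the image of \<open>id - w\<close> is the \<open>- 1\<close>-eigenspace.\<close>

lemma dominant_iff_eigenspace:
  assumes "involution W w"
  shows "dominant W w \<longleftrightarrow> contains_open_subset (closure (dominant_chamber W)) (eigenspace W w (- 1))"
proof -
  have lin: "linear (act W w)" using assms by (intro act_linear involution_closed)
  have "range (\<lambda>v. v - w \<cdot> v) = eigenspace W w (- 1)"
  proof (intro equalityI subsetI)
    fix v assume "v \<in> eigenspace W w (- 1)"
    then have "w \<cdot> v = - v" by (simp add: eigenspace_def)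
    then have "v = (1 / 2) *\<^sub>R v - w \<cdot> ((1 / 2) *\<^sub>R v)"
      by (simp add: linear_scale[OF lin] flip: scaleR_left.add)
    then show "v \<in> range (\<lambda>v. v - w \<cdot> v)" by (rule range_eqI)
  qed (use assms in \<open>auto simp: eigenspace_def linear_diff[OF lin]\<close>)
  then show ?thesis by (simp add: dominant_def)
qed

lemma fixed_len_conj:
  assumes "x \<in> carrier W" "u \<in> carrier W"
  shows "fixed_len W (x \<otimes> u \<otimes> inv x) = fixed_len W u"
proof -
  have "fixed_roots W (x \<otimes> u \<otimes> inv x) = act W x ` fixed_roots W u"
  proof (intro equalityI subsetI)
    fix \<beta> assume b: "\<beta> \<in> fixed_roots W (x \<otimes> u \<otimes> inv x)"
    then have "x \<cdot> u \<cdot> inv x \<cdot> \<beta> = \<beta>" using assms by (simp add: fixed_roots_def act_mult)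
    then have "inv x \<cdot> x \<cdot> u \<cdot> inv x \<cdot> \<beta> = inv x \<cdot> \<beta>" by simp
    then have "inv x \<cdot> \<beta> \<in> fixed_roots W u"
      using assms b by (simp add: fixed_roots_def act_roots)
    then have "x \<cdot> inv x \<cdot> \<beta> \<in> act W x ` fixed_roots W u" by (rule imageI)
    then show "\<beta> \<in> act W x ` fixed_roots W u" using assms by simp
  qed (use assms in \<open>auto simp: fixed_roots_def act_mult act_roots\<close>)
  then show ?thesis
    unfolding fixed_len_def using act_inj[OF assms(1)] by (metis card_image inj_on_subset subset_UNIV)
qed

lemma parabolic_roots_UNIV: "parabolic_roots W UNIV = R"
  by (auto simp: parabolic_roots_def roots_def cox_eq_parabolic_UNIV)

text \<open>For a maximal involution the positive roots are the inversions and the positive fixed roots.\<close>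

lemma card_roots_extremal:
  assumes fin: "finite (cox W)" and v: "involution W v" and ext: "extremal (- 1) UNIV v"
  shows "card R = fixed_len W v + 2 * len W v"
proof -
  have vc: "v \<in> carrier W" using v involution_closed by simp
  have "R = (\<lambda>(x, i). x \<cdot> simple_root i) ` (cox W \<times> UNIV)"
    by (auto simp: roots_def)
  then have finR: "finite R" using fin by simp
  have "parabolic_pos_roots W UNIV = P"
    by (auto simp: parabolic_pos_roots_def parabolic_roots_UNIV pos_imp_root)
  then have "inversions W v \<inter> P = P - fixed_roots W v"
    using extremal_max_iff_inversions[OF v, of UNIV] ext by simp
  moreover have "inversions W v \<subseteq> P" by (auto simp: inversions_def)
  ultimately have inv: "inversions W v = P - fixed_roots W v" by blast
  let ?I = "inversions W v" and ?F = "fixed_roots W v"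
  have I: "\<beta> \<in> ?I \<longleftrightarrow> \<beta> \<in> P \<and> v \<cdot> \<beta> \<noteq> \<beta>" for \<beta>
    by (auto simp: inv fixed_roots_def pos_imp_root)
  have F: "\<beta> \<in> ?F \<longleftrightarrow> \<beta> \<in> R \<and> v \<cdot> \<beta> = \<beta>" for \<beta>
    by (simp add: fixed_roots_def)
  have neg: "\<beta> \<in> uminus ` ?I \<longleftrightarrow> - \<beta> \<in> ?I" for \<beta>
    by (metis imageE image_eqI minus_minus)
  have "R = ?F \<union> (?I \<union> uminus ` ?I)"
  proof (intro equalityI subsetI)
    fix \<beta> assume "\<beta> \<in> R"
    then show "\<beta> \<in> ?F \<union> (?I \<union> uminus ` ?I)"
      using uminus_pos_iff[of \<beta>] vc by (auto simp: F neg) (auto simp: I act_uminus)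
  next
    fix \<beta> assume "\<beta> \<in> ?F \<union> (?I \<union> uminus ` ?I)"
    then show "\<beta> \<in> R"
      unfolding Un_iff neg using pos_imp_root[of \<beta>] pos_imp_root[of "- \<beta>"] by (auto simp: F I)
  qed
  moreover have "?F \<inter> (?I \<union> uminus ` ?I) = {}" "?I \<inter> uminus ` ?I = {}"
    using uminus_pos_iff pos_imp_root vc by (auto simp: F I act_uminus)
  moreover have "finite ?I" using finite_inversions[OF vc] .
  ultimately have "card R = card ?F + (card ?I + card (uminus ` ?I))"
    using finR by (metis card_Un_disjoint finite_Un)
  then show ?thesis by (simp add: card_image len_def fixed_len_def)
qed

end

section \<open>Extremal involutions in conjugation orbits\<close>

theorem proposition3:
  fixes W :: "('a, 'i::finite) twisted_coxeter"
    and J :: "'i set" and Orb :: "'a set" and w :: 'a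
  assumes "twisted_coxeter_group W"
    and "Orb \<in> conj_orbits W (parabolic W J)"
    and "\<forall>u\<in>Orb. involution W u"
    and "w \<in> Orb"
  shows
    "(max_len W Orb \<noteq> {} \<longrightarrow> (\<exists>w'\<in>max_len W Orb. ascends W J w w'))
   \<and> (\<exists>w'\<in>min_len W Orb. descends W J w w')

   \<and> (w \<in> max_len W Orb \<longleftrightarrow>
        inversions W w \<inter> parabolic_pos_roots W J = parabolic_pos_roots W J - fixed_roots W w)
   \<and> (w \<in> min_len W Orb \<longleftrightarrow>
        inversions W w \<inter> parabolic_pos_roots W J = parabolic_pos_roots W J \<inter> minus_roots W w)

   \<and> (w \<in> max_len W Orb \<longleftrightarrow> max_description W J w)
   \<and> (finite (parabolic W J) \<longrightarrow> (w \<in> max_len W Orb \<longleftrightarrow> max_description_longest W J w))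
   \<and> (w \<in> min_len W Orb \<longleftrightarrow> min_description W J w)

   \<and> (parabolic W J = cox W \<longrightarrow>
        (w \<in> max_len W Orb \<longleftrightarrow> contains_open_subset (closure dual_chamber) (dual_eigenspace W w (- 1)))
      \<and> (w \<in> min_len W Orb \<longleftrightarrow> contains_open_subset (closure dual_chamber) (dual_eigenspace W w 1)))

   \<and> (parabolic W J = cox W \<and> finite (cox W) \<longrightarrow>
        (w \<in> max_len W Orb \<longleftrightarrow>
           contains_open_subset (closure (dominant_chamber W)) (eigenspace W w (- 1)))
      \<and> (w \<in> min_len W Orb \<longleftrightarrow>
           contains_open_subset (closure (dominant_chamber W)) (eigenspace W w 1))
      \<and> {v \<in> Orb. dominant W v} \<noteq> {}
      \<and> (\<forall>u\<in>Orb. \<forall>v\<in>{v \<in> Orb. dominant W v}. card (roots W) = fixed_len W u + 2 * len W v))"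
proof -
  interpret twisted_coxeter_group W by (rule assms(1))
  interpret finite_rank_twisted_coxeter W by unfold_locales
  note orb = assms(2)
  have inv: "involution W u" if "u \<in> Orb" for u using assms(3) that by simp
  note w = inv[OF assms(4)]
  have max: "u \<in> max_len W Orb \<longleftrightarrow> extremal (- 1) J u"
    and min: "u \<in> min_len W Orb \<longleftrightarrow> extremal 1 J u" if "u \<in> Orb" for u
    using max_len_iff_extremal[OF orb that inv[OF that]] min_len_iff_extremal[OF orb that inv[OF that]]
    by auto
  have dual: "contains_open_subset (closure dual_chamber) (dual_eigenspace W u (- 1)) \<longleftrightarrow> u \<in> max_len W Orb"
    "contains_open_subset (closure dual_chamber) (dual_eigenspace W u 1) \<longleftrightarrow> u \<in> min_len W Orb"
    if "parabolic W J = cox W" "u \<in> Orb" for u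
    using dual_chamber_open_subset_iff_extremal[OF inv[OF that(2)]] parabolic_eq_cox_imp_UNIV[OF that(1)]
    by (simp_all add: max[OF that(2)] min[OF that(2)])
  have finite_case: "{v \<in> Orb. dominant W v} \<noteq> {}"
    "\<forall>u\<in>Orb. \<forall>v\<in>{v \<in> Orb. dominant W v}. card (roots W) = fixed_len W u + 2 * len W v"
    if J: "parabolic W J = cox W" and fin: "finite (cox W)"
  proof -
    have dom: "dominant W u \<longleftrightarrow> u \<in> max_len W Orb" if "u \<in> Orb" for u
      using dominant_iff_eigenspace[OF inv[OF that]] chamber_open_subset_iff_dual[OF fin inv[OF that]]
        dual(1)[OF J that] by simp
    have "Orb = (\<lambda>x. x \<otimes>\<^bsub>W\<^esub> w \<otimes>\<^bsub>W\<^esub> inv\<^bsub>W\<^esub> x) ` parabolic W J"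
      using conj_orbit_eq[OF orb assms(4)] by auto
    then have "finite Orb" using fin J by simp
    then have "max_len W Orb \<noteq> {}"
      using max_len_nonempty[OF assms(4), of "Max (len W ` Orb)"] by simp
    then show "{v \<in> Orb. dominant W v} \<noteq> {}"
      using dom by (auto simp: max_len_def)
    show "\<forall>u\<in>Orb. \<forall>v\<in>{v \<in> Orb. dominant W v}. card (roots W) = fixed_len W u + 2 * len W v"
    proof (intro ballI)
      fix u v assume u: "u \<in> Orb" and v: "v \<in> {v \<in> Orb. dominant W v}"
      have "extremal (- 1) UNIV v"
        using v dom max parabolic_eq_cox_imp_UNIV[OF J] by auto
      then have "card (roots W) = fixed_len W v + 2 * len W v"
        using v by (intro card_roots_extremal[OF fin] inv) auto
      moreover obtain x where "x \<in> parabolic W J" "v = x \<otimes>\<^bsub>W\<^esub> u \<otimes>\<^bsub>W\<^esub> inv\<^bsub>W\<^esub> x"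
        using conj_orbit_eq[OF orb u] v by auto
      ultimately show "card (roots W) = fixed_len W u + 2 * len W v"
        using fixed_len_conj[of x u] parabolic_closed involution_closed[OF inv[OF u]] by simp
    qed
  qed
  have "max_len W Orb \<noteq> {} \<longrightarrow> (\<exists>w'\<in>max_len W Orb. ascends W J w w')"
    using ascends_to_max[OF orb assms(3,4)] by blast
  moreover have "\<exists>w'\<in>min_len W Orb. descends W J w w'"
    using descends_to_min[OF orb assms(3,4)] .
  ultimately show ?thesis
    using finite_case dual[OF _ assms(4)] chamber_open_subset_iff_dual[OF _ w]
    unfolding max[OF assms(4)] min[OF assms(4)] extremal_max_iff_inversions[OF w, symmetric]
      extremal_min_iff_inversions[OF w, symmetric] max_description_iff[OF w] min_description_iff[OF w]
    by (simp add: max_description_longest_iff[OF w])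
qed

end
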